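(* The Destructive Shift Bribery problem for the Bucklin rule is in $\mathrm{P}$ (i.e., decidable in polynomial time).
   Context: **Elections.** An election is a pair $E=(C,V)$, where $C=\{c_1,\dots,c_m\}$ is a finite set of candidates and $V=\{v_1,\dots,v_n\}$ is a finite multiset of voters; each voter $v$ has a strict ranking (preference order) of all candidates from best to worst, and $\mathrm{pos}_v(c)\in\{1,\dots,m\}$ is the position of $c$ in $v$'s ranking (1 = best). An election rule $\mathcal{R}$ maps each election $E$ to a set $\mathcal{R}(E)\subseteq C$ of (tied) winners; $c$ is the unique winner if $\mathcal{R}(E)=\{c\}$. **Destructive Shift Bribery for $\mathcal{R}$.** Input: an election $E=(C,V)$ with $m$ candidates and $n$ voters, a despised candidate $d\in C$, a budget $B$ (a nonnegative integer), and for each voter $v_i$ a price function $\rho_i$. Shifting $d$ back by $t$ positions in a vote moves $d$ $t$ places towards the end of the ranking, each passed candidate moving up by one place and all else unchanged. A price function for a voter $v$ with $j=\mathrm{pos}_v(d)$ is $\rho:\mathbb{N}\to\mathbb{N}\cup\{+\infty\}$ with $\rho(0)=0$, $\rho(i)\le\rho(i')$ for $i<i'\le m-j$, and $\rho(i)=+\infty$ for $i>m-j$; $\rho(i)$ is the cost of shifting $d$ back by $i$ positions in $v$'s ranking. Price functions are encoded by listing their values at all arguments where they are finite; numbers are in binary. Question: are there nonnegative integers $t_1,\dots,t_n$ with $\sum_i\rho_i(t_i)\le B$ such that, after shifting $d$ back by $t_i$ positions in the ranking of each $v_i$, $d$ is not the unique $\mathcal{R}$-winner? **Bucklin.** The $\ell$-Approval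 score of a candidate is the number of voters that rank the candidate among the top $\ell$ positions. The Bucklin winning round is the smallest $\ell$ such that some candidate has $\ell$-Approval score at least $\lfloor |V|/2\rfloor+1$ (i.e., is ranked among the top $\ell$ positions by a strict majority of the voters). The Bucklin score of a candidate is his or her $\ell$-Approval score, where $\ell$ is the Bucklin winning round; the candidates with the highest Bucklin score are the Bucklin winners. *)

theory Defs
  imports Main "HOL-Library.Extended_Nat" "HOL-Computational_Algebra.Polynomial"
begin

section \<open>Elections and the Bucklin rule\<close>

text \<open>
  A vote is the list of all candidates from best to worst. The voters are kept in a list, so that
  per-voter data (price functions, shifts) can refer to them by index.
\<close>

type_synonym 'a election = "'a set \<times> 'a list list"
type_synonym 'a rule = "'a election \<Rightarrow> 'a set"

definition is_election :: "'a election \<Rightarrow> bool" where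
  "is_election E \<longleftrightarrow> (case E of (C, V) \<Rightarrow>
     finite C \<and> (\<forall>r\<in>set V. distinct r \<and> set r = C))"

definition pos :: "'a list \<Rightarrow> 'a \<Rightarrow> nat" where
  "pos r c = length (takeWhile (\<lambda>x. x \<noteq> c) r) + 1"

definition approval_score :: "'a list list \<Rightarrow> nat \<Rightarrow> 'a \<Rightarrow> nat" where
  "approval_score V l c = length (filter (\<lambda>r. pos r c \<le> l) V)"

definition bucklin_round :: "'a election \<Rightarrow> nat" where
  "bucklin_round E = (case E of (C, V) \<Rightarrow>
     (LEAST l. \<exists>c\<in>C. approval_score V l c \<ge> length V div 2 + 1))"

text \<open>
  If there are no voters, then no winning round exists, but all scores are 0 whatever the value
  of the \<open>LEAST\<close> term, so every candidate wins.
\<close>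

definition bucklin_score :: "'a election \<Rightarrow> 'a \<Rightarrow> nat" where
  "bucklin_score E c = approval_score (snd E) (bucklin_round E) c"

definition bucklin :: "'a rule" where
  "bucklin E = {c \<in> fst E. \<forall>c'\<in>fst E. bucklin_score E c' \<le> bucklin_score E c}"


section \<open>Destructive Shift Bribery\<close>

text \<open>
  Shifts that would move the candidate beyond the last place stop there; they have infinite price.
\<close>

definition shift_back :: "'a \<Rightarrow> nat \<Rightarrow> 'a list \<Rightarrow> 'a list" where
  "shift_back d t r =
     (let rest = removeAll d r; k = (pos r d - 1) + t in take k rest @ [d] @ drop k rest)"

lemma set_shift_back: "d \<in> set r \<Longrightarrow> set (shift_back d t r) = set r"
proof -
  have "set (take k xs) \<union> set (drop k xs) = set xs" for k and xs :: "'a list"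
    by (metis append_take_drop_id set_append)
  moreover assume "d \<in> set r"
  ultimately show ?thesis by (auto simp: shift_back_def Let_def)
qed

lemma distinct_shift_back: "distinct r \<Longrightarrow> distinct (shift_back d t r)"
proof -
  assume "distinct r"
  then have "distinct (removeAll d r)" "d \<notin> set (removeAll d r)" by (auto simp: distinct_removeAll)
  then show ?thesis
    by (auto simp: shift_back_def Let_def set_take_disj_set_drop_if_distinct dest: in_set_takeD in_set_dropD)
qed

lemma pos_shift_back:
  assumes "distinct r" "d \<in> set r" "pos r d + t \<le> length r"
  shows "pos (shift_back d t r) d = pos r d + t"
proof -
  let ?rest = "removeAll d r" and ?k = "(pos r d - 1) + t"
  have len: "length ?rest = length r - 1"
    using assms(1,2) by (metis distinct_remove1_removeAll length_remove1)
  have "\<forall>x\<in>set (take ?k ?rest). x \<noteq> d" by (auto dest: in_set_takeD)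
  then have "takeWhile (\<lambda>x. x \<noteq> d) (shift_back d t r) = take ?k ?rest"
    unfolding shift_back_def Let_def by (simp add: takeWhile_append2)
  moreover have "pos r d \<ge> 1" by (simp add: pos_def)
  ultimately show ?thesis using len assms(3) by (simp add: pos_def)
qed

lemma removeAll_shift_back: "removeAll d (shift_back d t r) = removeAll d r"
proof -
  have "removeAll d (take k xs @ d # drop k xs) = removeAll d xs" for k xs
    by (metis append_take_drop_id removeAll.simps(2) removeAll_append)
  moreover have "removeAll d (removeAll d r) = removeAll d r" by simp
  ultimately have "removeAll d (take k (removeAll d r) @ d # drop k (removeAll d r)) = removeAll d r" for k
    by metis
  then show ?thesis by (simp add: shift_back_def Let_def)
qed

lemma shift_back_0: "d \<in> set r \<Longrightarrow> distinct r \<Longrightarrow> shift_back d 0 r = r"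
proof -
  assume "d \<in> set r" "distinct r"
  then obtain a b where r: "r = a @ d # b" "d \<notin> set a" "d \<notin> set b" by (metis split_list distinct.simps(2) distinct_append not_distinct_conv_prefix split_list_first)
  have "takeWhile (\<lambda>x. x \<noteq> d) r = a" using r(2) unfolding r(1) by (induction a) auto
  then show ?thesis using r by (simp add: shift_back_def Let_def pos_def)
qed

definition is_price_function :: "nat \<Rightarrow> nat \<Rightarrow> (nat \<Rightarrow> enat) \<Rightarrow> bool" where
  "is_price_function m j \<rho> \<longleftrightarrow>
     \<rho> 0 = 0 \<and>
     (\<forall>i i'. i < i' \<and> i' \<le> m - j \<longrightarrow> \<rho> i \<le> \<rho> i') \<and>
     (\<forall>i > m - j. \<rho> i = \<infinity>)"

text \<open>
  Candidates of input elections are named by natural numbers, and the candidate set is given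
  by a listing without repetitions.
\<close>

record dsb_instance =
  candidates :: "nat list"
  votes :: "nat list list"
  despised :: nat
  budget :: nat
  prices :: "(nat \<Rightarrow> enat) list"

definition valid_instance :: "dsb_instance \<Rightarrow> bool" where
  "valid_instance I \<longleftrightarrow>
     distinct (candidates I) \<and>
     is_election (set (candidates I), votes I) \<and>
     despised I \<in> set (candidates I) \<and>
     length (prices I) = length (votes I) \<and>
     (\<forall>i < length (votes I).
        is_price_function (length (candidates I)) (pos (votes I ! i) (despised I)) (prices I ! i))"

definition yes_instance :: "nat rule \<Rightarrow> dsb_instance \<Rightarrow> bool" where
  "yes_instance R I \<longleftrightarrow>
     (\<exists>t :: nat \<Rightarrow> nat.
        (\<Sum>i < length (votes I). (prices I ! i) (t i)) \<le> enat (budget I) \<and>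
        R (set (candidates I),
           map (\<lambda>i. shift_back (despised I) (t i) (votes I ! i)) [0..<length (votes I)])
          \<noteq> {despised I})"


section \<open>Instances as bit strings\<close>

fun binary :: "nat \<Rightarrow> bool list" where
  "binary n = (if n = 0 then [] else odd n # binary (n div 2))"

declare binary.simps [simp del]

text \<open>
  Each list element is announced by \<open>True\<close> and the end of the list is marked by \<open>False\<close>. Hence
  the encodings are prefix-free, and numbers have length linear in the number of their bits
  (least significant bit first).
\<close>

definition enc_list :: "('a \<Rightarrow> bool list) \<Rightarrow> 'a list \<Rightarrow> bool list" where
  "enc_list f xs = concat (map (\<lambda>x. True # f x) xs) @ [False]"

definition enc_nat :: "nat \<Rightarrow> bool list" where
  "enc_nat n = enc_list (\<lambda>b. [b]) (binary n)"

text \<open>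
  By monotonicity, the arguments with finite price form an initial segment of the natural
  numbers, so listing the finite values in order of their arguments determines the function.
\<close>

definition finite_prices :: "(nat \<Rightarrow> enat) \<Rightarrow> nat list" where
  "finite_prices \<rho> = map (\<lambda>i. the_enat (\<rho> i)) (sorted_list_of_set {i. \<rho> i \<noteq> \<infinity>})"

definition enc_instance :: "dsb_instance \<Rightarrow> bool list" where
  "enc_instance I =
     enc_list enc_nat (candidates I) @
     enc_list (enc_list enc_nat) (votes I) @
     enc_nat (despised I) @
     enc_nat (budget I) @
     enc_list (\<lambda>\<rho>. enc_list enc_nat (finite_prices \<rho>)) (prices I)"

definition prefix_free :: "('a \<Rightarrow> bool list) \<Rightarrow> 'a set \<Rightarrow> bool" where
  "prefix_free f A \<longleftrightarrow> (\<forall>x\<in>A. \<forall>y\<in>A. \<forall>u v. f x @ u = f y @ v \<longrightarrow> x = y \<and> u = v)"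

lemma enc_list_prefix_free: assumes "prefix_free f A" shows "prefix_free (enc_list f) (lists A)"
proof -
  have "enc_list f xs @ u = enc_list f ys @ v \<Longrightarrow> xs \<in> lists A \<Longrightarrow> ys \<in> lists A \<Longrightarrow> xs = ys \<and> u = v" for xs ys u v
  proof (induction xs arbitrary: ys)
    case Nil then show ?case by (cases ys) (auto simp: enc_list_def)
  next
    case (Cons x xs)
    then obtain y ys' where ys: "ys = y # ys'" by (cases ys) (auto simp: enc_list_def)
    have "f x @ (enc_list f xs @ u) = f y @ (enc_list f ys' @ v)"
      using Cons.prems ys by (simp add: enc_list_def)
    then have "x = y" "enc_list f xs @ u = enc_list f ys' @ v" using assms Cons.prems ys unfolding prefix_free_def by auto
    then show ?case using Cons ys by auto
  qed
  then show ?thesis unfolding prefix_free_def by blast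
qed

lemma binary_inj: "binary m = binary n \<Longrightarrow> m = n"
proof (induction m arbitrary: n rule: less_induct)
  case (less m)
  show ?case
  proof (cases "m = 0 \<or> n = 0")
    case True then show ?thesis using less.prems by (simp add: binary.simps[of m] binary.simps[of n] split: if_splits)
  next
    case False
    then have e: "odd m = odd n" "binary (m div 2) = binary (n div 2)"
      using less.prems by (simp_all add: binary.simps[of m] binary.simps[of n])
    have "m div 2 = n div 2" using less.IH[of "m div 2"] e False by auto
    then show ?thesis using e(1) by (metis even_two_times_div_two odd_two_times_div_two_succ)
  qed
qed

lemma enc_nat_prefix_free: "prefix_free enc_nat UNIV"
proof -
  have "prefix_free (\<lambda>b. [b]) (UNIV :: bool set)" by (auto simp: prefix_free_def)
  then have "prefix_free (enc_list (\<lambda>b. [b])) (UNIV :: bool list set)"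
    using enc_list_prefix_free[of "\<lambda>b. [b]" UNIV] by simp
  then show ?thesis unfolding prefix_free_def enc_nat_def using binary_inj by blast
qed

lemma finite_prices_nth:
  assumes "is_price_function m j \<rho>"
  shows "\<rho> i = (if i < length (finite_prices \<rho>) then enat (finite_prices \<rho> ! i) else \<infinity>)"
proof -
  let ?F = "{i. \<rho> i \<noteq> \<infinity>}"
  have sub: "?F \<subseteq> {..m - j}" using assms unfolding is_price_function_def by (auto simp: not_less[symmetric])
  have dc: "i \<in> ?F" if "i' \<in> ?F" "i < i'" for i i'
    using that assms sub unfolding is_price_function_def by (metis (mono_tags, lifting) atMost_iff enat_ord_simps(5) mem_Collect_eq subsetD)
  have fin: "finite ?F" using sub finite_subset by blast
  have "\<exists>n. ?F = {..<n}"
  proof (intro exI set_eqI iffI)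
    fix i
    have "0 \<in> ?F" using assms by (auto simp: is_price_function_def zero_enat_def)
    then have ne: "?F \<noteq> {}" by blast
    show "i \<in> {..<Suc (Max ?F)}" if "i \<in> ?F" using that fin by (simp add: less_Suc_eq_le)
    show "i \<in> ?F" if "i \<in> {..<Suc (Max ?F)}"
      using Max_in[OF fin ne] dc[of "Max ?F" i] that by (cases "i = Max ?F") auto
  qed
  then obtain n where n: "?F = {..<n}" ..
  have "sorted_list_of_set ?F = [0..<n]" unfolding n by (simp add: lessThan_atLeast0)
  then have fp: "finite_prices \<rho> = map (\<lambda>i. the_enat (\<rho> i)) [0..<n]" unfolding finite_prices_def by simp
  have "i < n \<longleftrightarrow> \<rho> i \<noteq> \<infinity>" using n by blast
  moreover have "enat (the_enat (\<rho> i)) = \<rho> i" if "\<rho> i \<noteq> \<infinity>" using that by (cases "\<rho> i") simp_all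
  ultimately show ?thesis unfolding fp by simp
qed

lemma enc_instance_inj: "inj_on enc_instance {I. valid_instance I}"
proof (rule inj_onI)
  fix I J assume v: "I \<in> {I. valid_instance I}" "J \<in> {I. valid_instance I}" and e: "enc_instance I = enc_instance J"
  define P where "P = {\<rho>. \<exists>m j. is_price_function m j \<rho>}"
  have pn: "prefix_free (enc_list enc_nat) UNIV" using enc_list_prefix_free[OF enc_nat_prefix_free] by simp
  have pnn: "prefix_free (enc_list (enc_list enc_nat)) UNIV" using enc_list_prefix_free[OF pn] by simp
  have "\<rho> = \<rho>'" if P: "\<rho> \<in> P" "\<rho>' \<in> P" and eq: "finite_prices \<rho> = finite_prices \<rho>'" for \<rho> \<rho>'
  proof
    obtain m j m' j' where *: "is_price_function m j \<rho>" "is_price_function m' j' \<rho>'"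
      using P by (auto simp: P_def)
    show "\<rho> i = \<rho>' i" for i
      by (simp only: finite_prices_nth[OF *(1), of i] finite_prices_nth[OF *(2), of i] eq)
  qed
  then have "prefix_free (\<lambda>\<rho>. enc_list enc_nat (finite_prices \<rho>)) P"
    using pn unfolding prefix_free_def by blast
  note pp = enc_list_prefix_free[OF this]
  have "prices K \<in> lists P" if "valid_instance K" for K
  proof -
    have "\<rho> \<in> P" if "\<rho> \<in> set (prices K)" for \<rho>
      using that \<open>valid_instance K\<close> unfolding valid_instance_def P_def in_set_conv_nth by force
    then show ?thesis by auto
  qed
  with v have pr: "prices I \<in> lists P" "prices J \<in> lists P" by simp_all
  have n1: "x = y \<and> u = v" if "enc_list enc_nat x @ u = enc_list enc_nat y @ v" for x y u v
    using pn that unfolding prefix_free_def by blast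
  have n2: "x = y \<and> u = v"
    if "enc_list (enc_list enc_nat) x @ u = enc_list (enc_list enc_nat) y @ v" for x y u v
    using pnn that unfolding prefix_free_def by blast
  have n3: "x = y \<and> u = v" if "enc_nat x @ u = enc_nat y @ v" for x y u v
    using enc_nat_prefix_free that unfolding prefix_free_def by blast
  note e = e[unfolded enc_instance_def]
  note e1 = n1[OF e]
  note e2 = n2[OF conjunct2[OF e1]]
  note e3 = n3[OF conjunct2[OF e2]]
  note e4 = n3[OF conjunct2[OF e3]]
  have "prices I = prices J"
    using pp pr conjunct2[OF e4] unfolding prefix_free_def by (metis append_Nil2)
  with e1 e2 e3 e4 show "I = J" by simp
qed

definition destructive_shift_bribery :: "nat rule \<Rightarrow> bool list set" where
  "destructive_shift_bribery R = {enc_instance I | I. valid_instance I \<and> yes_instance R I}"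


section \<open>Deterministic multi-tape Turing machines and the class P\<close>

text \<open>
  States and tape symbols are initial segments of the natural numbers; symbol 0 is the blank.
  Tapes are infinite in both directions.
\<close>

datatype move = Left | Stay | Right

record tm =
  num_tapes :: nat
  num_symbols :: nat
  num_states :: nat
  start :: nat
  accept :: nat
  reject :: nat
  delta :: "nat \<Rightarrow> nat list \<Rightarrow> nat \<times> (nat \<times> move) list"

definition wf_tm :: "tm \<Rightarrow> bool" where
  "wf_tm M \<longleftrightarrow>
     num_tapes M \<ge> 1 \<and> num_symbols M \<ge> 3 \<and>
     start M < num_states M \<and> accept M < num_states M \<and> reject M < num_states M \<and>
     accept M \<noteq> reject M \<and>
     (\<forall>q < num_states M. \<forall>ss. length ss = num_tapes M \<and> set ss \<subseteq> {..<num_symbols M} \<longrightarrow>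
        (case delta M q ss of (q', as) \<Rightarrow>
           q' < num_states M \<and> length as = num_tapes M \<and> fst ` set as \<subseteq> {..<num_symbols M}))"

type_synonym tape = "(int \<Rightarrow> nat) \<times> int"
type_synonym config = "nat \<times> tape list"

fun read_tape :: "tape \<Rightarrow> nat" where
  "read_tape (f, h) = f h"

fun move_head :: "move \<Rightarrow> int \<Rightarrow> int" where
  "move_head Left h = h - 1"
| "move_head Stay h = h"
| "move_head Right h = h + 1"

fun act :: "nat \<times> move \<Rightarrow> tape \<Rightarrow> tape" where
  "act (s, mv) (f, h) = (f(h := s), move_head mv h)"

fun tm_step :: "tm \<Rightarrow> config \<Rightarrow> config" where
  "tm_step M (q, ts) =
     (if q = accept M \<or> q = reject M then (q, ts)
      else case delta M q (map read_tape ts) of (q', as) \<Rightarrow> (q', map2 act as ts))"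

definition input_tape :: "bool list \<Rightarrow> tape" where
  "input_tape x =
     (\<lambda>i. if 0 \<le> i \<and> i < int (length x) then (if x ! nat i then 2 else 1) else 0, 0)"

definition init_config :: "tm \<Rightarrow> bool list \<Rightarrow> config" where
  "init_config M x = (start M, input_tape x # replicate (num_tapes M - 1) (\<lambda>_. 0, 0))"

definition decides_in_time :: "tm \<Rightarrow> bool list set \<Rightarrow> (nat \<Rightarrow> nat) \<Rightarrow> bool" where
  "decides_in_time M L T \<longleftrightarrow>
     (\<forall>x. \<exists>n \<le> T (length x).
        fst ((tm_step M ^^ n) (init_config M x)) = (if x \<in> L then accept M else reject M))"

definition class_P :: "bool list set set" where
  "class_P = {L. \<exists>M (p :: nat poly). wf_tm M \<and> decides_in_time M L (poly p)}"

end

(*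
Destructive shift bribery for Bucklin reduces to polynomially many knapsack problems. The candidate d
is not the unique winner iff some c other than d and some round l satisfy: d has no majority among
the top l - 1, c has a majority among the top l, and c has at least the l-approval score of d
(if d wins, it can do so in round l only, and there c ties). For fixed c and l these conditions depend
on three counters only, each at most the number of voters, and every voter contributes to them
according to the chosen shift; a dynamic program over the voters keeps, for each triple of counters,
the largest budget that can be left.

For the Turing machine, data are kept on stacks in the prefix-free encoding of the instances. Since a
value can be moved without an end marker, a program that computes f on the top of the main stack
leaves everything below untouched, so programs compose with three tapes. Functions computable in this
way in polynomial time are closed under composition, pairing, case distinction and folds with
polynomially bounded accumulators.
*)

theory Submission imports Defs begin

section \<open>Stack programs\<close>

text \<open>The prices are binary, so neither costs nor budgets can index a table of polynomial
  size; the counters can. The winning round moves with the bribe and depends on all candidates, but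
  the criterion never computes it: a majority for c in round l bounds it from above, and the missing
  majority for d in round l - 1 excludes a sole win of d in any earlier round. Hence nothing about
  the remaining candidates has to be carried along. On the machine side, a fold is safe only if its
  accumulator has a polynomial bound known in advance. For the table this holds because each triple
  of counters occurs once and every remainder keeps exactly the length of the budget. Counters are
  unary, while numbers of the input stay digit lists throughout; the only arithmetic on digits is
  subtraction. Words that encode nothing have to be rejected too: the parser aborts on them, and
  validity of what does parse is part of the decided predicate.\<close>

datatype reg = RA | RB | RC
datatype sym = Bit bool | Mark
type_synonym stacks = "reg \<Rightarrow> sym list"

datatype com =
    Push reg sym
  | Pop reg
  | Abort
  | Seq com com  (infixr ";;" 60)
  | Cond reg "sym option set" com com
  | Loop reg "sym option set" com

fun top_sym :: "sym list \<Rightarrow> sym option" where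
  "top_sym [] = None"
| "top_sym (x # xs) = Some x"

text \<open>The number in \<open>exec c s t r\<close> is the exact number of machine steps; \<open>r = None\<close> means that
  the run was aborted.\<close>

inductive exec :: "com \<Rightarrow> stacks \<Rightarrow> nat \<Rightarrow> stacks option \<Rightarrow> bool" where
  Push: "exec (Push i x) s 2 (Some (s(i := x # s i)))"
| Pop: "exec (Pop i) s 1 (Some (s(i := tl (s i))))"
| Abort: "exec Abort s 1 None"
| Seq: "exec c1 s t1 (Some s1) \<Longrightarrow> exec c2 s1 t2 r \<Longrightarrow> exec (c1 ;; c2) s (Suc (t1 + t2)) r"
| SeqAbort: "exec c1 s t None \<Longrightarrow> exec (c1 ;; c2) s (Suc t) None"
| Cond: "exec (if top_sym (s i) \<in> S then c1 else c2) s t r \<Longrightarrow> exec (Cond i S c1 c2) s (Suc t) r"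
| LoopExit: "top_sym (s i) \<notin> S \<Longrightarrow> exec (Loop i S c) s 1 (Some s)"
| Loop: "top_sym (s i) \<in> S \<Longrightarrow> exec c s t1 (Some s1) \<Longrightarrow> exec (Loop i S c) s1 t2 r \<Longrightarrow>
    exec (Loop i S c) s (Suc (t1 + t2)) r"
| LoopAbort: "top_sym (s i) \<in> S \<Longrightarrow> exec c s t None \<Longrightarrow> exec (Loop i S c) s (Suc t) None"

section \<open>Compilation to Turing machines\<close>

text \<open>A machine step writes before it moves, whereas a push has to move left before it writes.
  \<open>Put\<close> is the state in between and remembers the pending symbol, so
  \<open>Push\<close> costs two steps.\<close>

datatype ctl = Run "com list" | Put reg sym "com list" | Acc | Rej

text \<open>The codes of the bits are those used by \<open>input_tape\<close>, and 0 is the blank.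
  Thus the initial input tape already is a stack holding the input word.\<close>

fun sym_code :: "sym \<Rightarrow> nat" where
  "sym_code (Bit b) = (if b then 2 else 1)"
| "sym_code Mark = 3"

definition sym_decode :: "nat \<Rightarrow> sym option" where
  "sym_decode n = (if n = 0 then None else if n = 1 then Some (Bit False)
     else if n = 2 then Some (Bit True) else Some Mark)"

fun ctl_step :: "ctl \<Rightarrow> (reg \<Rightarrow> nat) \<Rightarrow> ctl \<times> (reg \<Rightarrow> nat \<times> move)" where
  "ctl_step Acc v = (Acc, \<lambda>i. (v i, Stay))"
| "ctl_step Rej v = (Rej, \<lambda>i. (v i, Stay))"
| "ctl_step (Run []) v = (if v RA = 2 then Acc else Rej, \<lambda>i. (v i, Stay))"
| "ctl_step (Put i x K) v = (Run K, (\<lambda>i. (v i, Stay))(i := (sym_code x, Stay)))"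
| "ctl_step (Run (Push i x # K)) v = (Put i x K, (\<lambda>i. (v i, Stay))(i := (v i, Left)))"
| "ctl_step (Run (Pop i # K)) v = (Run K, (\<lambda>i. (v i, Stay))(i := (v i, Right)))"
| "ctl_step (Run (Abort # K)) v = (Rej, \<lambda>i. (v i, Stay))"
| "ctl_step (Run ((a ;; b) # K)) v = (Run (a # b # K), \<lambda>i. (v i, Stay))"
| "ctl_step (Run (Cond i S a b # K)) v =
     (Run ((if sym_decode (v i) \<in> S then a else b) # K), \<lambda>i. (v i, Stay))"
| "ctl_step (Run (Loop i S c # K)) v =
     (Run (if sym_decode (v i) \<in> S then c # Loop i S c # K else K), \<lambda>i. (v i, Stay))"

definition conf_step :: "ctl \<times> (reg \<Rightarrow> tape) \<Rightarrow> ctl \<times> (reg \<Rightarrow> tape)" where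
  "conf_step Q = (case Q of (q, ts) \<Rightarrow>
     (case ctl_step q (\<lambda>i. read_tape (ts i)) of (q', a) \<Rightarrow> (q', \<lambda>i. act (a i) (ts i))))"

text \<open>The head stands on the top of the stack, which grows to the left; behind its contents
  only blanks follow. Cells left of the head are unconstrained, so a popped symbol may stay there
  until a push overwrites it.\<close>

definition holds :: "sym list \<Rightarrow> tape \<Rightarrow> bool" where
  "holds xs tp = (\<forall>i. fst tp (snd tp + int i) = (if i < length xs then sym_code (xs ! i) else 0))"

lemma holds_read: "holds xs tp \<Longrightarrow> sym_decode (read_tape tp) = top_sym xs"
proof -
  assume "holds xs tp"
  from this[unfolded holds_def, rule_format, of 0] show ?thesis
    by (cases tp; cases xs; cases "hd xs") (auto simp: sym_decode_def)
qed

lemma holds_idle: "holds xs tp \<Longrightarrow> holds xs (act (read_tape tp, Stay) tp)"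
  by (cases tp) (simp add: holds_def)

lemma holds_pop: "holds xs tp \<Longrightarrow> holds (tl xs) (act (read_tape tp, Right) tp)"
proof -
  assume a: "holds xs tp"
  obtain f h where tp: "tp = (f, h)" by (cases tp)
  have "f (h + 1 + int i) = (if i < length (tl xs) then sym_code (tl xs ! i) else 0)" for i
    using a[unfolded holds_def tp, rule_format, of "Suc i"] by (simp add: nth_tl ac_simps less_diff_conv)
  then show ?thesis by (simp add: tp holds_def)
qed

lemma holds_push:
  assumes "holds xs tp"
  shows "holds (x # xs) (act (sym_code x, Stay) (act (read_tape tp, Left) tp))"
proof -
  obtain f h where tp: "tp = (f, h)" by (cases tp)
  have "(f(h - 1 := sym_code x)) (h - 1 + int i) =
      (if i < length (x # xs) then sym_code ((x # xs) ! i) else 0)" for i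
    using assms[unfolded holds_def tp, rule_format, of "i - 1"] by (cases i) auto
  then show ?thesis by (simp add: tp holds_def)
qed

lemma conf_step_simps [simp]:
  "conf_step (q, ts) = (let (q', a) = ctl_step q (\<lambda>i. read_tape (ts i)) in (q', \<lambda>i. act (a i) (ts i)))"
  by (simp add: conf_step_def Let_def)

lemma holds_idle_all: "\<forall>i. holds (s i) (ts i) \<Longrightarrow> \<forall>i. holds (s i) (act (read_tape (ts i), Stay) (ts i))"
  by (simp add: holds_idle)

lemma conf_steps_Suc_add:
  "(conf_step ^^ Suc (m + n)) Z = (conf_step ^^ n) ((conf_step ^^ m) (conf_step Z))"
  by (simp add: funpow_swap1 funpow_add add.commute[of m n])

lemma conf_steps_Suc: "(conf_step ^^ Suc n) Z = (conf_step ^^ n) (conf_step Z)"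
  by (simp add: funpow_swap1)

text \<open>The continuation \<open>K\<close> must be arbitrary in the induction, since a part of a
  compound command runs in front of the rest of that command. The step counts match because
  \<open>exec\<close> charges one step for each unfolding.\<close>

lemma exec_simulation:
  assumes "exec c s t r" "\<forall>i. holds (s i) (ts i)"
  shows "\<exists>ts'. case r of None \<Rightarrow> (conf_step ^^ t) (Run (c # K), ts) = (Rej, ts')
    | Some s' \<Rightarrow> (conf_step ^^ t) (Run (c # K), ts) = (Run K, ts') \<and> (\<forall>i. holds (s' i) (ts' i))"
  using assms
proof (induction arbitrary: ts K rule: exec.induct)
  case (Push i x s)
  then show ?case
    by (auto simp: numeral_2_eq_2 holds_push[simplified] holds_idle)
next
  case (Pop i s)
  then show ?case by (auto simp: holds_pop holds_idle)
next
  case (Abort s)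
  then show ?case by simp
next
  case (Seq c1 s t1 s1 c2 t2 r)
  from Seq.IH(1)[OF holds_idle_all[OF Seq.prems], of "c2 # K"] obtain ts1 where
      1: "(conf_step ^^ t1) (conf_step (Run ((c1 ;; c2) # K), ts)) = (Run (c2 # K), ts1)"
    and 2: "\<forall>i. holds (s1 i) (ts1 i)" by auto
  show ?case unfolding conf_steps_Suc_add 1 using Seq.IH(2)[OF 2, of K] .
next
  case (SeqAbort c1 s t c2)
  from SeqAbort.IH[OF holds_idle_all[OF SeqAbort.prems], of "c2 # K"]
  show ?case unfolding conf_steps_Suc by simp
next
  case (Cond s i S c1 c2 t r)
  have *: "conf_step (Run (Cond i S c1 c2 # K), ts) =
      (Run ((if top_sym (s i) \<in> S then c1 else c2) # K), \<lambda>i. act (read_tape (ts i), Stay) (ts i))"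
    using holds_read[OF Cond.prems[rule_format, of i]] by simp
  show ?case unfolding conf_steps_Suc * using Cond.IH[OF holds_idle_all[OF Cond.prems], of K] .
next
  case (LoopExit s i S c)
  then show ?case using holds_read[OF LoopExit.prems[rule_format, of i]] by (simp add: holds_idle)
next
  case (Loop s i S c t1 s1 t2 r)
  have "conf_step (Run (Loop i S c # K), ts) =
      (Run (c # Loop i S c # K), \<lambda>i. act (read_tape (ts i), Stay) (ts i))"
    using holds_read[OF Loop.prems[rule_format, of i]] Loop.hyps by simp
  with Loop.IH(1)[OF holds_idle_all[OF Loop.prems], of "Loop i S c # K"] obtain ts1 where
      1: "(conf_step ^^ t1) (conf_step (Run (Loop i S c # K), ts)) = (Run (Loop i S c # K), ts1)"
    and 2: "\<forall>i. holds (s1 i) (ts1 i)" by auto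
  show ?case unfolding conf_steps_Suc_add 1 using Loop.IH(2)[OF 2, of K] .
next
  case (LoopAbort s i S c t)
  have "conf_step (Run (Loop i S c # K), ts) =
      (Run (c # Loop i S c # K), \<lambda>i. act (read_tape (ts i), Stay) (ts i))"
    using holds_read[OF LoopAbort.prems[rule_format, of i]] LoopAbort.hyps by simp
  then show ?case unfolding conf_steps_Suc
    using LoopAbort.IH[OF holds_idle_all[OF LoopAbort.prems], of "Loop i S c # K"] by simp
qed

text \<open>The control state is the list of the commands still to be executed. Only finitely many such
  lists occur in runs of a fixed program.\<close>

fun conts :: "com \<Rightarrow> com list set" where
  "conts (a ;; b) = {[a ;; b]} \<union> (\<lambda>l. l @ [b]) ` conts a \<union> conts b"
| "conts (Cond i S a b) = {[Cond i S a b]} \<union> conts a \<union> conts b"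
| "conts (Loop i S c) = {[Loop i S c], []} \<union> (\<lambda>l. l @ [Loop i S c]) ` conts c"
| "conts c = {[c], []}"

text \<open>What one step may substitute for the command at the head of the continuation; a basic
  command is merely removed.\<close>

fun expansions :: "com \<Rightarrow> com list set" where
  "expansions (a ;; b) = {[a, b]}"
| "expansions (Cond i S a b) = {[a], [b]}"
| "expansions (Loop i S c) = {[c, Loop i S c], []}"
| "expansions c = {[]}"

lemma finite_conts: "finite (conts c)"
  by (induction c) auto

lemma conts_self: "[c] \<in> conts c"
  by (induction c) auto

lemma conts_nil: "[] \<in> conts c"
  by (induction c) auto

text \<open>Only the head of a continuation is ever replaced. Inside a component, the continuation
  ends with the fixed command that follows the component, and the replacement stays in front of this
  ending; once the component is used up, the ending itself is one of the recorded lists.\<close>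

lemma conts_closed: "x # K \<in> conts c \<Longrightarrow> l \<in> expansions x \<Longrightarrow> l @ K \<in> conts c"
proof (induction c arbitrary: x K l)
  case (Seq a b)
  consider "x = (a ;; b)" "K = []" | l' where "l' \<in> conts a" "x # K = l' @ [b]" | "x # K \<in> conts b"
    using Seq.prems(1) by auto
  then show ?case
  proof cases
    case 1
    then have "l @ K = [a] @ [b]" using Seq.prems(2) by simp
    then show ?thesis using conts_self[of a] by (metis UnI1 UnI2 conts.simps(1) image_eqI)
  next
    case (2 l')
    show ?thesis
    proof (cases l')
      case Nil
      then show ?thesis using 2 Seq.IH(2)[OF conts_self] Seq.prems(2) by simp
    next
      case (Cons y K')
      then have "l @ K' \<in> conts a" "l @ K = (l @ K') @ [b]"
        using 2 Seq.IH(1)[of x K' l] Seq.prems(2) by simp_all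
      then show ?thesis by (metis UnI1 UnI2 conts.simps(1) image_eqI)
    qed
  next
    case 3
    then show ?thesis using Seq.IH(2) Seq.prems(2) by simp
  qed
next
  case (Cond i S a b)
  consider "x = Cond i S a b" "K = []" | "x # K \<in> conts a" | "x # K \<in> conts b"
    using Cond.prems(1) by auto
  then show ?case
    using Cond.IH Cond.prems(2) conts_self[of a] conts_self[of b] by cases auto
next
  case (Loop i S c)
  have snoc: "m @ [Loop i S c] \<in> conts (Loop i S c)" if "m \<in> conts c" for m
    using that by simp
  consider "x = Loop i S c" "K = []" | l' where "l' \<in> conts c" "x # K = l' @ [Loop i S c]"
    using Loop.prems(1) by auto
  then have "x = Loop i S c \<and> K = [] \<or> (\<exists>K'. x # K' \<in> conts c \<and> K = K' @ [Loop i S c])"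
  proof cases
    case (2 l')
    then show ?thesis by (cases l') auto
  qed simp
  then show ?case
  proof (elim disjE exE conjE)
    assume "x = Loop i S c" "K = []"
    then show ?thesis using Loop.prems(2) snoc[OF conts_self] conts_nil by auto
  next
    fix K' assume "x # K' \<in> conts c" "K = K' @ [Loop i S c]"
    then show ?thesis using snoc[OF Loop.IH[of x K' l]] Loop.prems(2) by simp
  qed
qed simp_all

definition ctl_states :: "com \<Rightarrow> ctl set" where
  "ctl_states c = {Acc, Rej} \<union> Run ` conts c \<union> (\<lambda>(i, x, K). Put i x K) ` (UNIV \<times> UNIV \<times> conts c)"

lemma finite_ctl_states: "finite (ctl_states c)"
proof -
  have "(UNIV :: reg set) = {RA, RB, RC}" using reg.exhaust by auto
  then have "finite (UNIV :: reg set)" by (metis finite.emptyI finite.insertI)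
  moreover have "(UNIV :: sym set) \<subseteq> {Bit True, Bit False, Mark}"
  proof
    show "x \<in> {Bit True, Bit False, Mark}" for x by (cases x) auto
  qed
  then have "finite (UNIV :: sym set)" by (rule finite_subset) simp
  ultimately show ?thesis by (simp add: ctl_states_def finite_conts)
qed

lemma ctl_step_closed:
  assumes "q \<in> ctl_states c"
  shows "fst (ctl_step q v) \<in> ctl_states c"
proof (cases q)
  case (Run L)
  then have L: "L \<in> conts c" using assms by (auto simp: ctl_states_def)
  show ?thesis
  proof (cases L)
    case Nil
    then show ?thesis using Run by (simp add: ctl_states_def)
  next
    case (Cons x K)
    have "Run (l @ K) \<in> ctl_states c \<and> Put i y (l @ K) \<in> ctl_states c" if "l \<in> expansions x" for l i y
      using conts_closed[of x K c l] L Cons that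
      by (auto simp: ctl_states_def intro!: image_eqI[of "Put i y (l @ K)" _ "(i, y, l @ K)"])
    note 1 = conjunct1[OF this] conjunct2[OF this]
    have "Rej \<in> ctl_states c" by (simp add: ctl_states_def)
    then show ?thesis using Run Cons 1[of "[]"] 1(1)[of "[_]"] 1(1)[of "[_, _]"]
      by (cases x) simp_all
  qed
qed (use assms in \<open>auto simp: ctl_states_def\<close>)

lemma sym_code_range: "sym_code x < 4"
  by (cases x) auto

lemma ctl_step_range: "range v \<subseteq> {..<4} \<Longrightarrow> fst (snd (ctl_step q v) i) < 4"
  by (induction q v rule: ctl_step.induct) (auto simp: image_subset_iff sym_code_range)

definition input_stacks :: "bool list \<Rightarrow> stacks" where
  "input_stacks w = (\<lambda>_. [])(RA := map Bit w)"

text \<open>The control states are finitely many and get numbered by the bijection \<open>f\<close>;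
  under the translation \<open>lay\<close>, one machine step is one
  \<open>conf_step\<close>.\<close>

lemma class_P_intro:
  fixes p :: "nat poly"
  assumes run: "\<And>w. \<exists>t r. t \<le> poly p (length w) \<and> exec c (input_stacks w) t r \<and>
      (w \<in> L \<longleftrightarrow> (\<exists>s. r = Some s \<and> top_sym (s RA) = Some (Bit True)))"
  shows "L \<in> class_P"
proof -
  define Q where "Q = ctl_states c"
  obtain f where f: "bij_betw f Q {0..<card Q}"
    using ex_bij_betw_finite_nat[OF finite_ctl_states] unfolding Q_def by blast
  define g where "g = inv_into Q f"
  have gf: "g (f q) = q" if "q \<in> Q" for q
    using f that by (simp add: g_def bij_betw_inv_into_left)
  have fQ: "f q < card Q" if "q \<in> Q" for q
    using bij_betw_apply[OF f that] by simp
  have gQ: "g n \<in> Q" if "n < card Q" for n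
    using bij_betw_apply[OF bij_betw_inv_into[OF f]] that by (simp add: g_def)
  have Q: "Acc \<in> Q" "Rej \<in> Q" "Run [c] \<in> Q"
    by (auto simp: Q_def ctl_states_def conts_self)
  have fneq: "f q = f q' \<longleftrightarrow> q = q'" if "q \<in> Q" "q' \<in> Q" for q q'
    using gf that by metis
  define val :: "nat list \<Rightarrow> reg \<Rightarrow> nat"
    where "val ss = (\<lambda>i. ss ! (case i of RA \<Rightarrow> 0 | RB \<Rightarrow> 1 | RC \<Rightarrow> 2))" for ss
  define M where "M = \<lparr>num_tapes = 3, num_symbols = 4, num_states = card Q,
     start = f (Run [c]), accept = f Acc, reject = f Rej,
     delta = \<lambda>q ss. case ctl_step (g q) (val ss) of (q', a) \<Rightarrow> (f q', [a RA, a RB, a RC])\<rparr>"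
  have wf: "wf_tm M"
  proof -
    have "f (fst (ctl_step (g q) v)) < card Q" if "q < card Q" for q v
      using fQ gQ[OF that] ctl_step_closed Q_def by blast
    moreover have "fst (snd (ctl_step q (val ss)) i) < 4"
      if "length ss = 3" "set ss \<subseteq> {..<4}" for q ss i
    proof (rule ctl_step_range)
      have "ss ! n < 4" if "n < 3" for n
        using \<open>set ss \<subseteq> {..<4}\<close> \<open>length ss = 3\<close> that by (metis lessThan_iff nth_mem subsetD)
      then show "range (val ss) \<subseteq> {..<4}" by (auto simp: val_def split: reg.split)
    qed
    ultimately show ?thesis using Q fQ fneq[of Acc Rej]
      by (auto simp: wf_tm_def M_def split_def)
  qed
  define lay where "lay = (\<lambda>(q, ts :: reg \<Rightarrow> tape). (f q, [ts RA, ts RB, ts RC]))"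
  have step: "tm_step M (lay (q, ts)) = lay (conf_step (q, ts))" if "q \<in> Q" for q ts
  proof -
    have "val (map read_tape [ts RA, ts RB, ts RC]) = (\<lambda>i. read_tape (ts i))"
      by (auto simp: val_def fun_eq_iff split: reg.split)
    moreover have "act (read_tape (ts i), Stay) (ts i) = ts i" for i by (cases "ts i") simp
    ultimately show ?thesis using that Q gf fneq
      by (auto simp: lay_def M_def Let_def split_def)
  qed
  have steps: "(tm_step M ^^ n) (lay Z) = lay ((conf_step ^^ n) Z) \<and> fst ((conf_step ^^ n) Z) \<in> Q"
    if "fst Z \<in> Q" for n Z
  proof (induction n)
    case 0
    then show ?case using that by simp
  next
    case (Suc n)
    obtain q ts where q: "(conf_step ^^ n) Z = (q, ts)" by fastforce
    then have "q \<in> Q" using Suc by simp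
    then have "fst (conf_step (q, ts)) \<in> Q"
      using ctl_step_closed[of q c] by (simp add: Q_def Let_def split_def)
    then show ?case using Suc q step[OF \<open>q \<in> Q\<close>] by simp
  qed
  \<comment> \<open>One step more than the program takes: in state \<open>Run []\<close> the machine
    inspects the top of \<open>RA\<close> and enters \<open>Acc\<close> or
    \<open>Rej\<close>.\<close>
  have "decides_in_time M L (poly (p + [:1:]))"
    unfolding decides_in_time_def
  proof
    fix w
    obtain t r where t: "t \<le> poly p (length w)" and ex: "exec c (input_stacks w) t r"
      and L: "w \<in> L \<longleftrightarrow> (\<exists>s. r = Some s \<and> top_sym (s RA) = Some (Bit True))" using run by blast
    define ts where "ts = (\<lambda>_. (\<lambda>_. 0, 0))(RA := input_tape w)"
    have init: "init_config M w = lay (Run [c], ts)"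
      by (simp add: init_config_def M_def lay_def ts_def numeral_2_eq_2)
    have "holds (map Bit w) (input_tape w)" by (auto simp: holds_def input_tape_def)
    then have "\<forall>i. holds (input_stacks w i) (ts i)"
      by (auto simp: input_stacks_def ts_def holds_def)
    note sim = exec_simulation[OF ex this, of "[]"]
    note st = steps[of "(Run [c], ts)", simplified, OF Q(3)]
    show "\<exists>n \<le> poly (p + [:1:]) (length w).
        fst ((tm_step M ^^ n) (init_config M w)) = (if w \<in> L then accept M else reject M)"
    proof (cases r)
      case None
      then show ?thesis using t L sim st[of t] init
        by (intro exI[of _ t]) (auto simp: lay_def M_def)
    next
      case (Some s')
      then obtain ts' where 1: "(conf_step ^^ t) (Run [c], ts) = (Run [], ts')"
        and h: "\<forall>i. holds (s' i) (ts' i)" using sim by auto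
      have "sym_decode (read_tape (ts' RA)) = top_sym (s' RA)" using h holds_read by blast
      moreover have "read_tape (ts' RA) < 4"
        using h[rule_format, of RA, unfolded holds_def, rule_format, of 0] sym_code_range
        by (cases "ts' RA") (auto split: if_splits)
      ultimately have "read_tape (ts' RA) = 2 \<longleftrightarrow> top_sym (s' RA) = Some (Bit True)"
        by (auto simp: sym_decode_def split: if_splits)
      then show ?thesis using t L Some st[of "Suc t"] init 1
        by (intro exI[of _ "Suc t"]) (auto simp: lay_def M_def Let_def)
    qed
  qed
  then show ?thesis using wf unfolding class_P_def by blast
qed

section \<open>Running stack programs\<close>

definition runs :: "com \<Rightarrow> stacks \<Rightarrow> nat \<Rightarrow> stacks \<Rightarrow> bool" where
  "runs c s T s' \<longleftrightarrow> (\<exists>t\<le>T. exec c s t (Some s'))"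

definition st :: "sym list \<Rightarrow> sym list \<Rightarrow> sym list \<Rightarrow> stacks" where
  "st a b d = (\<lambda>i. case i of RA \<Rightarrow> a | RB \<Rightarrow> b | RC \<Rightarrow> d)"

lemma st_simps [simp]:
  "st a b d RA = a" "st a b d RB = b" "st a b d RC = d"
  "(st a b d)(RA := x) = st x b d" "(st a b d)(RB := x) = st a x d" "(st a b d)(RC := x) = st a b x"
  by (auto simp: st_def fun_eq_iff split: reg.split)

lemma runs_mono: "runs c s T s' \<Longrightarrow> T \<le> T' \<Longrightarrow> runs c s T' s'"
  unfolding runs_def using order_trans by blast

lemma runs_push: "runs (Push i x) s 2 (s(i := x # s i))"
  unfolding runs_def using exec.Push by blast

lemma runs_pop: "runs (Pop i) s 1 (s(i := tl (s i)))"
  unfolding runs_def using exec.Pop by blast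

lemma runs_seq: "runs c1 s T1 s1 \<Longrightarrow> runs c2 s1 T2 s2 \<Longrightarrow> runs (c1 ;; c2) s (T1 + T2 + 1) s2"
  unfolding runs_def using exec.Seq by (metis Suc_eq_plus1 Suc_le_mono add_mono)

lemma runs_cond:
  "runs (if top_sym (s i) \<in> S then c1 else c2) s T s' \<Longrightarrow> runs (Cond i S c1 c2) s (T + 1) s'"
  unfolding runs_def using exec.Cond[of s i S c1 c2] by fastforce

lemma runs_loop_exit: "top_sym (s i) \<notin> S \<Longrightarrow> runs (Loop i S c) s 1 s"
  unfolding runs_def using exec.LoopExit by blast

lemma runs_loop:
  "top_sym (s i) \<in> S \<Longrightarrow> runs c s T1 s1 \<Longrightarrow> runs (Loop i S c) s1 T2 s2 \<Longrightarrow>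
    runs (Loop i S c) s (T1 + T2 + 1) s2"
  unfolding runs_def using exec.Loop by (metis Suc_eq_plus1 Suc_le_mono add_mono)

lemma runs_eq: "runs c s T s' \<Longrightarrow> s' = s'' \<Longrightarrow> T \<le> T' \<Longrightarrow> runs c s T' s''"
  using runs_mono by blast

lemma exec_length: "exec c s t r \<Longrightarrow> r = Some s' \<Longrightarrow> length (s' i) \<le> length (s i) + t"
proof (induction arbitrary: s' rule: exec.induct)
  case (Seq c1 s t1 s1 c2 t2 r)
  then show ?case using Seq.IH(1)[of s1] Seq.IH(2)[of s'] by simp
next
  case (Loop s i S c t1 s1 t2 r)
  then show ?case using Loop.IH(1)[of s1] Loop.IH(2)[of s'] by simp
next
  case (Cond s i S c1 c2 t r)
  then show ?case using Cond.IH[of s'] by simp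
qed auto

abbreviation "bits \<equiv> map Bit"

text \<open>The test set is empty, so the loop is left after one step without running its
  body.\<close>

definition skip :: com where "skip = Loop RA {} Abort"

lemma runs_skip: "runs skip s 1 s"
  unfolding skip_def by (rule runs_loop_exit) simp

definition erase :: "reg \<Rightarrow> com" where
  "erase i = (Loop i {Some (Bit False), Some (Bit True)} (Pop i) ;; Pop i)"

definition unroll :: "reg \<Rightarrow> com" where
  "unroll i = (Loop i {Some (Bit False), Some (Bit True)}
     (Cond i {Some (Bit True)} (Pop i ;; Push RA (Bit True)) (Pop i ;; Push RA (Bit False))) ;; Pop i)"

lemma runs_erase:
  assumes "s i = bits w @ Mark # r"
  shows "runs (erase i) s (2 * length w + 3) (s(i := r))"
proof -
  have "runs (Loop i {Some (Bit False), Some (Bit True)} (Pop i)) s (2 * length w + 1) (s(i := Mark # r))"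
    using assms
  proof (induction w arbitrary: s)
    case Nil
    then have "s(i := Mark # r) = s" by (simp add: fun_upd_idem)
    then show ?case using runs_loop_exit[of s i] Nil by simp
  next
    case (Cons x w)
    have "(s(i := tl (s i))) i = bits w @ Mark # r" using Cons.prems by simp
    note IH = Cons.IH[of "s(i := tl (s i))", OF this]
    have "top_sym (s i) \<in> {Some (Bit False), Some (Bit True)}" using Cons.prems by (cases x) auto
    from runs_loop[OF this runs_pop IH] show ?case
      by (rule runs_eq) (auto simp: fun_eq_iff)
  qed
  from runs_seq[OF this runs_pop] show ?thesis unfolding erase_def by (rule runs_eq) auto
qed

text \<open>Each bit costs 4 steps for popping and pushing and one each for the branch and the loop;
  the last 3 steps are the loop exit, the sequencing and the removal of the mark. Since bits are
  reversed, a value stored in reverse order comes back in the right order.\<close>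

lemma runs_unroll:
  assumes "s i = bits w @ Mark # r" "i \<noteq> RA"
  shows "runs (unroll i) s (6 * length w + 3) (s(i := r, RA := rev (bits w) @ s RA))"
proof -
  let ?L = "Loop i {Some (Bit False), Some (Bit True)}
     (Cond i {Some (Bit True)} (Pop i ;; Push RA (Bit True)) (Pop i ;; Push RA (Bit False)))"
  have "runs ?L s (6 * length w + 1) (s(i := Mark # r, RA := rev (bits w) @ s RA))"
    using assms
  proof (induction w arbitrary: s)
    case Nil
    then have *: "s(i := Mark # r, RA := rev (bits []) @ s RA) = s" by (auto simp: fun_eq_iff)
    show ?case unfolding * using runs_loop_exit[of s i] Nil.prems by simp
  next
    case (Cons x w)
    let ?s = "s(i := tl (s i), RA := Bit x # s RA)"
    have "runs (if top_sym (s i) \<in> {Some (Bit True)} then Pop i ;; Push RA (Bit True)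
        else Pop i ;; Push RA (Bit False)) s 4 ?s"
      using Cons.prems runs_eq[OF runs_seq[OF runs_pop runs_push]] by (cases x) simp_all
    note body = runs_cond[OF this]
    have "?s i = bits w @ Mark # r" using Cons.prems by simp
    note IH = Cons.IH[of ?s, OF this \<open>i \<noteq> RA\<close>]
    have "top_sym (s i) \<in> {Some (Bit False), Some (Bit True)}" using Cons.prems by (cases x) auto
    from runs_loop[OF this body IH] show ?case
      by (rule runs_eq) (auto simp: fun_eq_iff)
  qed
  from runs_seq[OF this runs_pop[of i]] show ?thesis unfolding unroll_def
    by (rule runs_eq) (use assms(2) in \<open>auto simp: fun_eq_iff\<close>)
qed

lemma runs_erase_st:
  "runs (erase RB) (st a (bits w @ Mark # b) d) (2 * length w + 3) (st a b d)"
  "runs (erase RC) (st a b (bits w @ Mark # d)) (2 * length w + 3) (st a b d)"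
  using runs_erase[of "st a (bits w @ Mark # b) d" RB] runs_erase[of "st a b (bits w @ Mark # d)" RC]
  by simp_all

lemma runs_unroll_st:
  "runs (unroll RB) (st a (bits w @ Mark # b) d) (6 * length w + 3) (st (rev (bits w) @ a) b d)"
  "runs (unroll RC) (st a b (bits w @ Mark # d)) (6 * length w + 3) (st (rev (bits w) @ a) b d)"
  using runs_unroll[of "st a (bits w @ Mark # b) d" RB] runs_unroll[of "st a b (bits w @ Mark # d)" RC]
  by simp_all

section \<open>Typed data on stacks\<close>

text \<open>The program \<open>tr\<close> parses one value at the top of \<open>RA\<close>; since the encoding is prefix-free,
  it needs no end marker. It aborts when the stack does not start with an encoding.\<close>

class encodable =
  fixes encode :: "'a \<Rightarrow> bool list"
    and tr :: "'a itself \<Rightarrow> com"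
  assumes encode_prefix_free: "encode x @ u = encode y @ v \<Longrightarrow> x = y \<and> u = v"
    and tr_runs: "\<exists>k. \<forall>x a b d. runs (tr TYPE('a)) (st (bits (encode x) @ a) b d) (k * (length (encode x) + 1))
      (st a (rev (bits (encode x)) @ b) (rev (bits (encode x)) @ d))"
    and tr_aborts: "\<exists>k. \<forall>w b d. (\<forall>x r. w \<noteq> encode x @ r) \<longrightarrow>
      (\<exists>t \<le> k * (length w + 1). exec (tr TYPE('a)) (st (bits w) b d) t None)"

text \<open>Reading a stack consumes it. Moving each bit to two stacks at once is what later allows
  a value to be used twice.\<close>

definition tr_bit :: com where
  "tr_bit = Cond RA {Some (Bit True)} (Pop RA ;; (Push RB (Bit True) ;; Push RC (Bit True)))
     (Cond RA {Some (Bit False)} (Pop RA ;; (Push RB (Bit False) ;; Push RC (Bit False))) Abort)"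

lemma runs_tr_bit: "runs tr_bit (st (Bit x # a) b d) 9 (st a (Bit x # b) (Bit x # d))"
proof -
  have 1: "runs (Pop RA ;; (Push RB (Bit x) ;; Push RC (Bit x))) (st (Bit x # a) b d) 7
      (st a (Bit x # b) (Bit x # d))"
    by (rule runs_eq[OF runs_seq[OF runs_pop runs_seq[OF runs_push runs_push]]]) simp_all
  show ?thesis
  proof (cases x)
    case True
    then show ?thesis unfolding tr_bit_def
      using runs_mono[OF runs_cond[of "st (Bit x # a) b d" RA "{Some (Bit True)}" _ _ 7], of _ _ _ 9] 1 by simp
  next
    case False
    have "runs (Cond RA {Some (Bit False)} (Pop RA ;; (Push RB (Bit False) ;; Push RC (Bit False))) Abort)
        (st (Bit x # a) b d) (7 + 1) (st a (Bit x # b) (Bit x # d))"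
      using 1 False by (intro runs_cond) simp
    then have "runs tr_bit (st (Bit x # a) b d) (7 + 1 + 1) (st a (Bit x # b) (Bit x # d))"
      using False unfolding tr_bit_def by (intro runs_cond) simp
    then show ?thesis by simp
  qed
qed

lemma tr_bit_aborts: "exec tr_bit (st [] b d) 3 None"
proof -
  have "exec (Cond RA {Some (Bit False)} (Pop RA ;; (Push RB (Bit False) ;; Push RC (Bit False))) Abort)
      (st [] b d) (Suc 1) None"
    using exec.Abort by (intro exec.Cond) simp
  then have "exec tr_bit (st [] b d) (Suc (Suc 1)) None" unfolding tr_bit_def
    by (intro exec.Cond) simp
  then show ?thesis by (simp add: numeral_3_eq_3)
qed

instantiation unit :: encodable
begin

definition "encode (x :: unit) = []"
definition "tr (_ :: unit itself) = skip"

instance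
proof
  show "\<exists>k. \<forall>(x::unit) a b d. runs (tr TYPE(unit)) (st (bits (encode x) @ a) b d) (k * (length (encode x) + 1))
      (st a (rev (bits (encode x)) @ b) (rev (bits (encode x)) @ d))"
    using runs_skip by (intro exI[of _ 1]) (simp add: encode_unit_def tr_unit_def)
qed (simp_all add: encode_unit_def)

end

instantiation bool :: encodable
begin

definition "encode (x :: bool) = [x]"
definition "tr (_ :: bool itself) = tr_bit"

instance
proof
  show "\<exists>k. \<forall>(x::bool) a b d. runs (tr TYPE(bool)) (st (bits (encode x) @ a) b d) (k * (length (encode x) + 1))
      (st a (rev (bits (encode x)) @ b) (rev (bits (encode x)) @ d))"
    using runs_mono[OF runs_tr_bit] by (intro exI[of _ 9]) (simp add: encode_bool_def tr_bool_def)
  have empty: "w = []" if "\<forall>x r. w \<noteq> encode (x::bool) @ r" for w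
    using that by (cases w) (auto simp: encode_bool_def)
  have ab: "exec (tr TYPE(bool)) (st (bits w) b d) 3 None" if "\<forall>x r. w \<noteq> encode (x::bool) @ r" for w b d
    using empty[OF that] tr_bit_aborts by (simp add: tr_bool_def)
  show "\<exists>k. \<forall>w b d. (\<forall>(x::bool) r. w \<noteq> encode x @ r) \<longrightarrow>
      (\<exists>t \<le> k * (length w + 1). exec (tr TYPE(bool)) (st (bits w) b d) t None)"
    by (intro exI[of _ 3]) (auto intro!: exI[of _ 3] ab)
qed (simp_all add: encode_bool_def)

end

instantiation prod :: (encodable, encodable) encodable
begin

definition "encode (x :: 'a \<times> 'b) = encode (fst x) @ encode (snd x)"
definition "tr (_ :: ('a \<times> 'b) itself) = (tr TYPE('a) ;; tr TYPE('b))"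

instance
proof
  fix x y :: "'a \<times> 'b" and u v
  assume "encode x @ u = encode y @ v"
  then show "x = y \<and> u = v"
    using encode_prefix_free[of "fst x" "encode (snd x) @ u" "fst y"] encode_prefix_free[of "snd x" u "snd y" v]
    by (simp add: encode_prod_def prod_eq_iff)
next
  obtain k where k: "\<And>(x::'a) a b d. runs (tr TYPE('a)) (st (bits (encode x) @ a) b d) (k * (length (encode x) + 1))
      (st a (rev (bits (encode x)) @ b) (rev (bits (encode x)) @ d))" using tr_runs by blast
  obtain l where l: "\<And>(x::'b) a b d. runs (tr TYPE('b)) (st (bits (encode x) @ a) b d) (l * (length (encode x) + 1))
      (st a (rev (bits (encode x)) @ b) (rev (bits (encode x)) @ d))" using tr_runs by blast
  have run: "runs (tr TYPE('a \<times> 'b)) (st (bits (encode x) @ a) b d) ((k + l + 1) * (length (encode x) + 1))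
      (st a (rev (bits (encode x)) @ b) (rev (bits (encode x)) @ d))" for x :: "'a \<times> 'b" and a b d
    unfolding tr_prod_def encode_prod_def map_append append_assoc
    by (rule runs_eq[OF runs_seq[OF k l]]) (auto simp: algebra_simps)
  then show "\<exists>k. \<forall>(x :: 'a \<times> 'b) a b d. runs (tr TYPE('a \<times> 'b)) (st (bits (encode x) @ a) b d)
      (k * (length (encode x) + 1)) (st a (rev (bits (encode x)) @ b) (rev (bits (encode x)) @ d))"
    by blast
  obtain m where m: "\<And>w b d. (\<forall>(x::'a) r. w \<noteq> encode x @ r) \<Longrightarrow>
      (\<exists>t \<le> m * (length w + 1). exec (tr TYPE('a)) (st (bits w) b d) t None)" using tr_aborts by blast
  obtain n where n: "\<And>w b d. (\<forall>(x::'b) r. w \<noteq> encode x @ r) \<Longrightarrow>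
      (\<exists>t \<le> n * (length w + 1). exec (tr TYPE('b)) (st (bits w) b d) t None)" using tr_aborts by blast
  \<comment> \<open>Parsing fails at the first component, or passes it and fails at the second:
    \<open>m\<close>, \<open>k\<close> and \<open>n\<close> pay for failing at the first, passing
    the first and failing at the second.\<close>
  have "\<exists>t \<le> (m + k + n + 1) * (length w + 1). exec (tr TYPE('a \<times> 'b)) (st (bits w) b d) t None"
    if no: "\<forall>(x :: 'a \<times> 'b) r. w \<noteq> encode x @ r" for w b d
  proof (cases "\<forall>(x::'a) r. w \<noteq> encode x @ r")
    case True
    then obtain t where "t \<le> m * (length w + 1)" "exec (tr TYPE('a)) (st (bits w) b d) t None"
      using m by blast
    then show ?thesis unfolding tr_prod_def
      by (intro exI[of _ "Suc t"]) (auto intro: exec.SeqAbort simp: algebra_simps)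
  next
    case False
    then obtain x :: 'a and w2 where w: "w = encode x @ w2" by blast
    have "\<forall>(y::'b) r. w2 \<noteq> encode y @ r" using no[rule_format, of "(x, _)"] w by (simp add: encode_prod_def)
    then obtain t2 where t2: "t2 \<le> n * (length w2 + 1)"
      "exec (tr TYPE('b)) (st (bits w2) (rev (bits (encode x)) @ b) (rev (bits (encode x)) @ d)) t2 None"
      using n by blast
    obtain t1 where t1: "t1 \<le> k * (length (encode x) + 1)" "exec (tr TYPE('a)) (st (bits w) b d) t1
        (Some (st (bits w2) (rev (bits (encode x)) @ b) (rev (bits (encode x)) @ d)))"
      using k[of x "bits w2" b d] w unfolding runs_def by auto
    have "t1 + t2 + 1 \<le> (m + k + n + 1) * (length w + 1)"
      using t1(1) t2(1) w by (simp add: algebra_simps)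
    then show ?thesis unfolding tr_prod_def
      using exec.Seq[OF t1(2) t2(2)] by (intro exI[of _ "Suc (t1 + t2)"]) simp
  qed
  then show "\<exists>k. \<forall>w b d. (\<forall>(x::'a \<times> 'b) r. w \<noteq> encode x @ r) \<longrightarrow>
      (\<exists>t \<le> k * (length w + 1). exec (tr TYPE('a \<times> 'b)) (st (bits w) b d) t None)" by blast
qed

end

instantiation list :: (encodable) encodable
begin

definition "encode (xs :: 'a list) = enc_list encode xs"
definition "tr (_ :: 'a list itself) = (Loop RA {Some (Bit True)} (tr_bit ;; tr TYPE('a)) ;; tr_bit)"

lemma encode_Nil [simp]: "encode ([] :: 'a list) = [False]"
  by (simp add: encode_list_def enc_list_def)

lemma encode_Cons [simp]: "encode (x # xs :: 'a list) = True # encode x @ encode xs"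
  by (simp add: encode_list_def enc_list_def)

instance
proof
  fix xs ys :: "'a list" and u v
  assume "encode xs @ u = encode ys @ v"
  then show "xs = ys \<and> u = v"
  proof (induction xs arbitrary: ys)
    case Nil
    then show ?case by (cases ys) simp_all
  next
    case (Cons x xs)
    then show ?case
      using encode_prefix_free[of x "encode xs @ u" "hd ys" "encode (tl ys) @ v"] by (cases ys) auto
  qed
next
  let ?L = "Loop RA {Some (Bit True)} (tr_bit ;; tr TYPE('a))"
  obtain k where k: "\<And>(x::'a) a b d. runs (tr TYPE('a)) (st (bits (encode x) @ a) b d) (k * (length (encode x) + 1))
      (st a (rev (bits (encode x)) @ b) (rev (bits (encode x)) @ d))" using tr_runs by blast
  have elem: "runs (tr_bit ;; tr TYPE('a)) (st (bits (True # encode x) @ a) b d) (k * (length (encode x) + 1) + 10)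
      (st a (rev (bits (True # encode x)) @ b) (rev (bits (True # encode x)) @ d))" for x :: 'a and a b d
    using runs_seq[OF runs_tr_bit k, of True x a b d] by (simp add: algebra_simps)
  \<comment> \<open>\<open>w\<close> is the encoding without its closing \<open>False\<close>. The
    loop stops in front of that bit, which the final \<open>tr_bit\<close> moves.\<close>
  have loop: "\<exists>w. encode xs = w @ [False] \<and> runs ?L (st (bits w @ a) b d) ((k + 11) * length w + 1)
      (st a (rev (bits w) @ b) (rev (bits w) @ d))"
    if "top_sym a = Some (Bit False)" for a b d and xs :: "'a list"
  proof (induction xs arbitrary: b d)
    case Nil
    then show ?case using runs_loop_exit[of "st a b d" RA] that by simp
  next
    case (Cons x xs)
    let ?u = "True # encode x"
    obtain w where w: "encode xs = w @ [False]" "runs ?L (st (bits w @ a) (rev (bits ?u) @ b) (rev (bits ?u) @ d))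
        ((k + 11) * length w + 1) (st a (rev (bits w) @ rev (bits ?u) @ b) (rev (bits w) @ rev (bits ?u) @ d))"
      using Cons.IH by blast
    have "runs ?L (st (bits ?u @ bits w @ a) b d) ((k + 11) * length (?u @ w) + 1)
      (st a (rev (bits w) @ rev (bits ?u) @ b) (rev (bits w) @ rev (bits ?u) @ d))"
      by (rule runs_eq[OF runs_loop[OF _ elem w(2)]]) (auto simp: algebra_simps)
    then show ?case using w(1) by (intro exI[of _ "?u @ w"]) simp
  qed
  show "\<exists>k. \<forall>(x::'a list) a b d. runs (tr TYPE('a list)) (st (bits (encode x) @ a) b d) (k * (length (encode x) + 1))
      (st a (rev (bits (encode x)) @ b) (rev (bits (encode x)) @ d))"
  proof (intro exI allI)
    fix x :: "'a list" and a b d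
    obtain w where w: "encode x = w @ [False]" "runs ?L (st (bits w @ Bit False # a) b d) ((k + 11) * length w + 1)
      (st (Bit False # a) (rev (bits w) @ b) (rev (bits w) @ d))"
      using loop[of "Bit False # a" x] by auto
    show "runs (tr TYPE('a list)) (st (bits (encode x) @ a) b d) ((k + 11) * (length (encode x) + 1))
      (st a (rev (bits (encode x)) @ b) (rev (bits (encode x)) @ d))"
      unfolding tr_list_def w(1) using runs_eq[OF runs_seq[OF w(2) runs_tr_bit]] by simp
  qed
  obtain m where m: "\<And>w b d. (\<forall>(x::'a) r. w \<noteq> encode x @ r) \<Longrightarrow>
      (\<exists>t \<le> m * (length w + 1). exec (tr TYPE('a)) (st (bits w) b d) t None)" using tr_aborts by blast
  \<comment> \<open>Either an element does not parse, or the input ends where a list marker is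
    expected. In the latter case the loop only ends with \<open>RA\<close> empty, and the abort
    comes from the final \<open>tr_bit\<close>. A leading \<open>False\<close> cannot occur, since
    it encodes the empty list.\<close>
  have abort: "\<exists>t \<le> (m + k + 12) * (length w + 1). exec ?L (st (bits w) b d) t None \<or>
      (\<exists>b' d'. exec ?L (st (bits w) b d) t (Some (st [] b' d')))"
    if "\<forall>(xs :: 'a list) r. w \<noteq> encode xs @ r" for w b d
    using that
  proof (induction w arbitrary: b d rule: length_induct)
    case (1 w)
    show ?case
    proof (cases w)
      case Nil
      then show ?thesis using exec.LoopExit[of "st [] b d" RA "{Some (Bit True)}"]
        by (intro exI[of _ 1]) fastforce
    next
      case (Cons h w1)
      have h: h using 1(2)[rule_format, of "[]"] Cons by (cases h) auto
      show ?thesis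
      proof (cases "\<forall>(x::'a) r. w1 \<noteq> encode x @ r")
        case True
        obtain t1 where t1: "t1 \<le> 9" "exec tr_bit (st (bits w) b d) t1
            (Some (st (bits w1) (Bit True # b) (Bit True # d)))"
          using runs_tr_bit[of True "bits w1" b d] Cons h unfolding runs_def by auto
        obtain t2 where t2: "t2 \<le> m * (length w1 + 1)"
          "exec (tr TYPE('a)) (st (bits w1) (Bit True # b) (Bit True # d)) t2 None"
          using m[OF True] by blast
        have "t1 + t2 + 2 \<le> (m + k + 12) * (length w + 1)"
          using t1(1) t2(1) Cons by (simp add: algebra_simps)
        then show ?thesis
          using exec.LoopAbort[of "st (bits w) b d" RA "{Some (Bit True)}", OF _ exec.Seq[OF t1(2) t2(2)]] Cons h
          by (intro exI[of _ "Suc (Suc (t1 + t2))"]) simp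
      next
        case False
        then obtain x :: 'a and w2 where w1: "w1 = encode x @ w2" by blast
        let ?u = "rev (bits (True # encode x))"
        obtain t1 where t1: "t1 \<le> k * (length (encode x) + 1) + 10"
            "exec (tr_bit ;; tr TYPE('a)) (st (bits w) b d) t1 (Some (st (bits w2) (?u @ b) (?u @ d)))"
          using elem[of x "bits w2" b d] Cons h w1 unfolding runs_def by auto
        have "\<forall>(xs :: 'a list) r. w2 \<noteq> encode xs @ r"
        proof (intro allI notI)
          fix xs :: "'a list" and r
          assume "w2 = encode xs @ r"
          then have "w = encode (x # xs) @ r" using Cons h w1 by simp
          then show False using 1(2) by blast
        qed
        then obtain t2 where t2: "t2 \<le> (m + k + 12) * (length w2 + 1)"
          "exec ?L (st (bits w2) (?u @ b) (?u @ d)) t2 None \<or>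
            (\<exists>b' d'. exec ?L (st (bits w2) (?u @ b) (?u @ d)) t2 (Some (st [] b' d')))"
          using 1(1)[rule_format, of w2 "?u @ b" "?u @ d"] Cons w1 by auto
        have "t1 + t2 + 1 \<le> (m + k + 12) * (length w + 1)"
          using t1(1) t2(1) Cons w1 by (simp add: algebra_simps)
        moreover have "top_sym (st (bits w) b d RA) \<in> {Some (Bit True)}" using Cons h by simp
        from exec.Loop[OF this t1(2)] t2(2)
        have "exec ?L (st (bits w) b d) (Suc (t1 + t2)) None \<or>
            (\<exists>b' d'. exec ?L (st (bits w) b d) (Suc (t1 + t2)) (Some (st [] b' d')))"
          by blast
        ultimately show ?thesis by (metis Suc_eq_plus1)
      qed
    qed
  qed
  have "\<exists>t \<le> (m + k + 16) * (length w + 1). exec (tr TYPE('a list)) (st (bits w) b d) t None"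
    if no: "\<forall>(xs :: 'a list) r. w \<noteq> encode xs @ r" for w b d
  proof -
    obtain t where t: "t \<le> (m + k + 12) * (length w + 1)" "exec ?L (st (bits w) b d) t None \<or>
      (\<exists>b' d'. exec ?L (st (bits w) b d) t (Some (st [] b' d')))" using abort[OF no, of b d] by blast
    have "Suc (t + 3) \<le> (m + k + 16) * (length w + 1)" using t(1) by (simp add: algebra_simps)
    moreover have "exec (tr TYPE('a list)) (st (bits w) b d) (Suc t) None \<or>
        exec (tr TYPE('a list)) (st (bits w) b d) (Suc (t + 3)) None"
      using t(2) exec.SeqAbort exec.Seq[OF _ tr_bit_aborts] unfolding tr_list_def by blast
    ultimately show ?thesis by (meson Suc_le_mono le_add1 order_trans)
  qed
  then show "\<exists>k. \<forall>w b d. (\<forall>(x::'a list) r. w \<noteq> encode x @ r) \<longrightarrow>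
      (\<exists>t \<le> k * (length w + 1). exec (tr TYPE('a list)) (st (bits w) b d) t None)" by blast
qed

end

instantiation nat :: encodable
begin

text \<open>Type \<open>nat\<close> is encoded in unary; it serves for counters only.\<close>

definition "encode (n :: nat) = encode (replicate n ())"
definition "tr (_ :: nat itself) = tr TYPE(unit list)"

instance
proof
  fix m n :: nat and u v
  assume "encode m @ u = encode n @ v"
  then show "m = n \<and> u = v"
    using encode_prefix_free[of "replicate m ()" u "replicate n ()" v]
    by (auto simp: encode_nat_def dest: arg_cong[of _ _ length])
next
  show "\<exists>k. \<forall>(x::nat) a b d. runs (tr TYPE(nat)) (st (bits (encode x) @ a) b d) (k * (length (encode x) + 1))
      (st a (rev (bits (encode x)) @ b) (rev (bits (encode x)) @ d))"
    unfolding encode_nat_def tr_nat_def using tr_runs[where 'a = "unit list"] by blast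
  have "(\<forall>(x::nat) r. w \<noteq> encode x @ r) \<longleftrightarrow> (\<forall>(x::unit list) r. w \<noteq> encode x @ r)" for w
  proof -
    have "xs = replicate (length xs) ()" for xs :: "unit list" by (induction xs) simp_all
    then show ?thesis unfolding encode_nat_def by metis
  qed
  then show "\<exists>k. \<forall>w b d. (\<forall>(x::nat) r. w \<noteq> encode x @ r) \<longrightarrow>
      (\<exists>t \<le> k * (length w + 1). exec (tr TYPE(nat)) (st (bits w) b d) t None)"
    unfolding tr_nat_def using tr_aborts[where 'a = "unit list"] by simp
qed

end

section \<open>Polynomial bounds\<close>

abbreviation sz :: "'a::encodable \<Rightarrow> nat" where
  "sz x \<equiv> length (encode x)"

definition poly_bd :: "('a::encodable \<Rightarrow> nat) \<Rightarrow> bool" where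
  "poly_bd F \<longleftrightarrow> (\<exists>p :: nat poly. \<forall>x. F x \<le> poly p (sz x))"

lemma poly_nat_mono: "m \<le> n \<Longrightarrow> poly (p :: nat poly) m \<le> poly p n"
  by (induction p) (auto intro!: mult_mono)

lemma poly_bd_const: "poly_bd (\<lambda>_. c)"
  unfolding poly_bd_def by (intro exI[of _ "[:c:]"]) simp

lemma poly_bd_sz: "poly_bd sz"
  unfolding poly_bd_def by (intro exI[of _ "[:0, 1:]"]) simp

lemma poly_bd_add: "poly_bd F \<Longrightarrow> poly_bd G \<Longrightarrow> poly_bd (\<lambda>x. F x + G x)"
  unfolding poly_bd_def by (metis add_mono poly_add)

lemma poly_bd_mult: "poly_bd F \<Longrightarrow> poly_bd G \<Longrightarrow> poly_bd (\<lambda>x. F x * G x)"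
  unfolding poly_bd_def by (metis mult_le_mono poly_mult)

lemma poly_bd_mono: "poly_bd G \<Longrightarrow> (\<And>x. F x \<le> G x) \<Longrightarrow> poly_bd F"
  unfolding poly_bd_def using order_trans by blast

lemma poly_bd_poly:
  assumes "poly_bd F"
  shows "poly_bd (\<lambda>x. poly p (F x))"
proof -
  obtain q where "F x \<le> poly q (sz x)" for x using assms unfolding poly_bd_def by blast
  then have "poly p (F x) \<le> poly (pcompose p q) (sz x)" for x
    using poly_nat_mono by (simp add: poly_pcompose)
  then show ?thesis unfolding poly_bd_def by blast
qed

lemma poly_bd_comp:
  assumes "poly_bd F" "poly_bd (\<lambda>x. sz (f x))"
  shows "poly_bd (\<lambda>x. F (f x))"
proof -
  obtain p where "F x \<le> poly p (sz x)" for x using assms(1) unfolding poly_bd_def by blast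
  then show ?thesis by (intro poly_bd_mono[OF poly_bd_poly[OF assms(2), of p]])
qed

lemma poly_bd_Suc: "poly_bd F \<Longrightarrow> poly_bd (\<lambda>x. Suc (F x))"
  using poly_bd_add[OF poly_bd_const[of 1]] by simp

lemmas poly_bd_intros = poly_bd_const poly_bd_sz poly_bd_Suc poly_bd_add poly_bd_mult

lemma sz_prod: "sz x = sz (fst x) + sz (snd x)"
  by (simp add: encode_prod_def)

lemma poly_bd_fst: "poly_bd F \<Longrightarrow> poly_bd (\<lambda>x. F (fst x))"
  by (rule poly_bd_comp) (auto intro: poly_bd_mono[OF poly_bd_sz] simp: encode_prod_def)

lemma poly_bd_snd: "poly_bd F \<Longrightarrow> poly_bd (\<lambda>x. F (snd x))"
  by (rule poly_bd_comp) (auto intro: poly_bd_mono[OF poly_bd_sz] simp: encode_prod_def)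

section \<open>Polynomial-time functions\<close>

definition computes :: "com \<Rightarrow> ('a::encodable \<Rightarrow> 'b::encodable) \<Rightarrow> ('a \<Rightarrow> nat) \<Rightarrow> bool" where
  "computes c f T \<longleftrightarrow> (\<forall>x a b d. runs c (st (bits (encode x) @ a) b d) (T x) (st (bits (encode (f x)) @ a) b d))"

definition pt :: "('a::encodable \<Rightarrow> 'b::encodable) \<Rightarrow> bool" where
  "pt f \<longleftrightarrow> (\<exists>c T. poly_bd T \<and> computes c f T)"

lemma ptI: "poly_bd T \<Longrightarrow> (\<And>x a b d. runs c (st (bits (encode x) @ a) b d) (T x)
    (st (bits (encode (f x)) @ a) b d)) \<Longrightarrow> pt f"
  unfolding pt_def computes_def by blast

lemma ptE:
  assumes "pt f"
  obtains c T where "poly_bd T" "\<And>x a b d. runs c (st (bits (encode x) @ a) b d) (T x)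
    (st (bits (encode (f x)) @ a) b d)"
  using assms unfolding pt_def computes_def by blast

text \<open>A stack grows by at most one symbol per step, so the output is no longer than input and
  running time together. This makes time bounds composable.\<close>

lemma poly_bd_sz_pt: "pt f \<Longrightarrow> poly_bd (\<lambda>x. sz (f x))"
proof (elim ptE)
  fix c T
  assume T: "poly_bd T" and r: "\<And>x a b d. runs c (st (bits (encode x) @ a) b d) (T x)
      (st (bits (encode (f x)) @ a) b d)"
  have "sz (f x) \<le> sz x + T x" for x
  proof -
    obtain t where "t \<le> T x" "exec c (st (bits (encode x)) [] []) t (Some (st (bits (encode (f x))) [] []))"
      using r[of x "[]" "[]" "[]"] unfolding runs_def by auto
    then show ?thesis using exec_length[of c _ t _ _ RA] by fastforce
  qed
  then show ?thesis by (rule poly_bd_mono[OF poly_bd_add[OF poly_bd_sz T]])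
qed

lemma pt_recode:
  assumes "\<And>x. encode (f x) = encode x"
  shows "pt f"
  by (rule ptI[where T = "\<lambda>_. 1", OF poly_bd_const, of skip]) (simp only: assms runs_skip)

lemma pt_id: "pt (\<lambda>x. x)"
  by (rule pt_recode) simp

lemma pt_comp:
  assumes "pt f" "pt g"
  shows "pt (\<lambda>x. f (g x))"
proof -
  obtain c T where f: "poly_bd T" "\<And>x a b d. runs c (st (bits (encode x) @ a) b d) (T x)
      (st (bits (encode (f x)) @ a) b d)" by (rule ptE[OF assms(1)], rule that)
  obtain c' T' where g: "poly_bd T'" "\<And>x a b d. runs c' (st (bits (encode x) @ a) b d) (T' x)
      (st (bits (encode (g x)) @ a) b d)" by (rule ptE[OF assms(2)], rule that)
  have "poly_bd (\<lambda>x. T' x + T (g x) + 1)"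
    by (intro poly_bd_intros g(1) poly_bd_comp[OF f(1)] poly_bd_sz_pt assms(2))
  then show ?thesis using runs_seq[OF g(2) f(2)] by (rule ptI)
qed

text \<open>Both copies end up reversed above a mark, which tells \<open>erase\<close> and
  \<open>unroll\<close> where the value ends.\<close>

definition stash :: "'a::encodable itself \<Rightarrow> com" where
  "stash t = (Push RB Mark ;; (Push RC Mark ;; tr t))"

lemma runs_stash: "\<exists>k. \<forall>(x::'a::encodable) a b d. runs (stash TYPE('a)) (st (bits (encode x) @ a) b d)
   (k * (sz x + 1)) (st a (bits (rev (encode x)) @ Mark # b) (bits (rev (encode x)) @ Mark # d))"
proof -
  obtain k where k: "\<And>(x::'a) a b d. runs (tr TYPE('a)) (st (bits (encode x) @ a) b d) (k * (length (encode x) + 1))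
      (st a (rev (bits (encode x)) @ b) (rev (bits (encode x)) @ d))" using tr_runs by blast
  have "runs (stash TYPE('a)) (st (bits (encode x) @ a) b d)
    ((k + 6) * (sz x + 1)) (st a (bits (rev (encode x)) @ Mark # b) (bits (rev (encode x)) @ Mark # d))"
    for x :: 'a and a b d
    unfolding stash_def rev_map
    by (rule runs_eq[OF runs_seq[OF runs_push runs_seq[OF runs_push]]])
      (use k[of x a "Mark # b" "Mark # d"] in \<open>auto simp: rev_map\<close>)
  then show ?thesis by blast
qed

lemma runs_unroll_rev:
  "runs (unroll RB) (st a (bits (rev w) @ Mark # b) d) (6 * length w + 3) (st (bits w @ a) b d)"
  "runs (unroll RC) (st a b (bits (rev w) @ Mark # d)) (6 * length w + 3) (st (bits w @ a) b d)"
  using runs_unroll_st[where w = "rev w"] by (simp_all add: rev_map)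

lemma runs_erase_rev:
  "runs (erase RB) (st a (bits (rev w) @ Mark # b) d) (2 * length w + 3) (st a b d)"
  "runs (erase RC) (st a b (bits (rev w) @ Mark # d)) (2 * length w + 3) (st a b d)"
  using runs_erase_st[where w = "rev w"] by simp_all

text \<open>One copy of the argument is put back and consumed by the program for \<open>f\<close>,
  the other waits on \<open>RB\<close>. The result is stashed and its copy on \<open>RB\<close>
  erased, which uncovers the argument for the program for \<open>g\<close>; finally the result of
  \<open>f\<close> is unrolled from \<open>RC\<close> on top of that of \<open>g\<close>.\<close>

lemma pt_pair:
  fixes f :: "'a::encodable \<Rightarrow> 'b::encodable" and g :: "'a \<Rightarrow> 'c::encodable"
  assumes "pt f" "pt g"
  shows "pt (\<lambda>x. (f x, g x))"
proof -
  obtain c T where f: "poly_bd T" "\<And>x a b d. runs c (st (bits (encode x) @ a) b d) (T x)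
      (st (bits (encode (f x)) @ a) b d)" by (rule ptE[OF assms(1)], rule that)
  obtain c' T' where g: "poly_bd T'" "\<And>x a b d. runs c' (st (bits (encode x) @ a) b d) (T' x)
      (st (bits (encode (g x)) @ a) b d)" by (rule ptE[OF assms(2)], rule that)
  obtain k where k: "\<And>(x::'a) a b d. runs (stash TYPE('a)) (st (bits (encode x) @ a) b d)
     (k * (sz x + 1)) (st a (bits (rev (encode x)) @ Mark # b) (bits (rev (encode x)) @ Mark # d))"
    using runs_stash by blast
  obtain l where l: "\<And>(x::'b) a b d. runs (stash TYPE('b)) (st (bits (encode x) @ a) b d)
     (l * (sz x + 1)) (st a (bits (rev (encode x)) @ Mark # b) (bits (rev (encode x)) @ Mark # d))"
    using runs_stash by blast
  have r: "runs (stash TYPE('a) ;; (unroll RC ;; (c ;; (stash TYPE('b) ;; (erase RB ;; (unroll RB ;; (c' ;; unroll RC)))))))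
     (st (bits (encode x) @ a) b d)
     (k * (sz x + 1) + (6 * sz x + 3 + (T x + (l * (sz (f x) + 1) + ((2 * sz (f x) + 3) + (6 * sz x + 3 +
       (T' x + (6 * sz (f x) + 3) + 1) + 1) + 1) + 1) + 1) + 1) + 1)
     (st (bits (encode (f x, g x)) @ a) b d)" for x a b d
    unfolding encode_prod_def fst_conv snd_conv map_append append_assoc
    by (rule runs_seq k l runs_unroll_rev runs_erase_rev f(2) g(2))+
  show ?thesis
    by (rule ptI[OF _ r]) (intro poly_bd_intros f(1) g(1) poly_bd_sz_pt assms)
qed

lemma pt_fst0: "pt (fst :: 'a::encodable \<times> 'b::encodable \<Rightarrow> 'a)"
proof -
  obtain k where k: "\<And>(x::'a) a b d. runs (stash TYPE('a)) (st (bits (encode x) @ a) b d)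
     (k * (sz x + 1)) (st a (bits (rev (encode x)) @ Mark # b) (bits (rev (encode x)) @ Mark # d))"
    using runs_stash by blast
  obtain l where l: "\<And>(x::'b) a b d. runs (stash TYPE('b)) (st (bits (encode x) @ a) b d)
     (l * (sz x + 1)) (st a (bits (rev (encode x)) @ Mark # b) (bits (rev (encode x)) @ Mark # d))"
    using runs_stash by blast
  have r: "runs (stash TYPE('a) ;; (stash TYPE('b) ;; (erase RB ;; (erase RC ;; (erase RB ;; unroll RC)))))
     (st (bits (encode x) @ a) b d)
     (k * (sz (fst x) + 1) + (l * (sz (snd x) + 1) + ((2 * sz (snd x) + 3) + ((2 * sz (snd x) + 3) +
       ((2 * sz (fst x) + 3) + (6 * sz (fst x) + 3) + 1) + 1) + 1) + 1) + 1)
     (st (bits (encode (fst x)) @ a) b d)" for x :: "'a \<times> 'b" and a b d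
    unfolding encode_prod_def fst_conv snd_conv map_append append_assoc
    by (rule runs_seq k l runs_unroll_rev runs_erase_rev)+
  show ?thesis
    by (rule ptI[OF _ r]) (intro poly_bd_intros poly_bd_fst[OF poly_bd_sz] poly_bd_snd[OF poly_bd_sz])
qed

lemma pt_snd0: "pt (snd :: 'a::encodable \<times> 'b::encodable \<Rightarrow> 'b)"
proof -
  obtain k where k: "\<And>(x::'a) a b d. runs (stash TYPE('a)) (st (bits (encode x) @ a) b d)
     (k * (sz x + 1)) (st a (bits (rev (encode x)) @ Mark # b) (bits (rev (encode x)) @ Mark # d))"
    using runs_stash by blast
  have r: "runs (stash TYPE('a) ;; (erase RB ;; erase RC))
     (st (bits (encode x) @ a) b d)
     (k * (sz (fst x) + 1) + ((2 * sz (fst x) + 3) + (2 * sz (fst x) + 3) + 1) + 1)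
     (st (bits (encode (snd x)) @ a) b d)" for x :: "'a \<times> 'b" and a b d
    unfolding encode_prod_def fst_conv snd_conv map_append append_assoc
    by (rule runs_seq k runs_unroll_rev runs_erase_rev)+
  show ?thesis
    by (rule ptI[OF _ r]) (intro poly_bd_intros poly_bd_fst[OF poly_bd_sz])
qed

fun push_bits :: "bool list \<Rightarrow> com" where
  "push_bits [] = skip"
| "push_bits (x # w) = (push_bits w ;; Push RA (Bit x))"

lemma runs_push_bits: "runs (push_bits w) (st a b d) (3 * length w + 1) (st (bits w @ a) b d)"
proof (induction w)
  case (Cons x w)
  from runs_seq[OF this runs_push[of RA "Bit x"]] show ?case by simp (erule runs_mono, simp)
qed (simp add: runs_skip[simplified])

lemma pt_const: "pt (\<lambda>_ :: 'a::encodable. v)"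
proof -
  obtain k where k: "\<And>(x::'a) a b d. runs (stash TYPE('a)) (st (bits (encode x) @ a) b d)
     (k * (sz x + 1)) (st a (bits (rev (encode x)) @ Mark # b) (bits (rev (encode x)) @ Mark # d))"
    using runs_stash by blast
  have r: "runs (stash TYPE('a) ;; (erase RB ;; (erase RC ;; push_bits (encode v))))
     (st (bits (encode x) @ a) b d)
     (k * (sz x + 1) + ((2 * sz x + 3) + ((2 * sz x + 3) + (3 * sz v + 1) + 1) + 1) + 1)
     (st (bits (encode v) @ a) b d)" for x :: 'a and a b d
    unfolding encode_prod_def fst_conv snd_conv map_append append_assoc
    by (rule runs_seq k runs_unroll_rev runs_erase_rev runs_push_bits)+
  show ?thesis by (rule ptI[OF _ r]) (intro poly_bd_intros)
qed

text \<open>The encoding of the pair lacks only the leading list marker.\<close>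

lemma pt_Cons0: "pt (\<lambda>p. fst p # snd p :: 'a::encodable list)"
  by (rule ptI[where T = "\<lambda>_. 2", OF poly_bd_const, of "Push RA (Bit True)"])
    (rule runs_eq[OF runs_push], simp_all add: encode_prod_def)

lemma pt_if0:
  fixes f g :: "'a::encodable \<Rightarrow> 'b::encodable"
  assumes "pt f" "pt g"
  shows "pt (\<lambda>p. if fst p then f (snd p) else g (snd p))"
proof -
  obtain c T where f: "poly_bd T" "\<And>x a b d. runs c (st (bits (encode x) @ a) b d) (T x)
      (st (bits (encode (f x)) @ a) b d)" by (rule ptE[OF assms(1)], rule that)
  obtain c' T' where g: "poly_bd T'" "\<And>x a b d. runs c' (st (bits (encode x) @ a) b d) (T' x)
      (st (bits (encode (g x)) @ a) b d)" by (rule ptE[OF assms(2)], rule that)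
  have "runs (Cond RA {Some (Bit True)} (Pop RA ;; c) (Pop RA ;; c')) (st (bits (encode p) @ a) b d)
      (T (snd p) + T' (snd p) + 3) (st (bits (encode (if fst p then f (snd p) else g (snd p))) @ a) b d)"
    for p :: "bool \<times> 'a" and a b d
  proof -
    obtain u x where p: "p = (u, x)" by (cases p)
    have "runs (if u then Pop RA ;; c else Pop RA ;; c') (st (bits (encode p) @ a) b d)
        (T x + T' x + 2) (st (bits (encode (if u then f x else g x)) @ a) b d)"
      using runs_eq[OF runs_seq[OF runs_pop[of RA "st (bits (encode p) @ a) b d"]]] f(2)[of x a b d] g(2)[of x a b d]
      by (auto simp: p encode_prod_def encode_bool_def)
    then have "runs (Cond RA {Some (Bit True)} (Pop RA ;; c) (Pop RA ;; c')) (st (bits (encode p) @ a) b d)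
       (T x + T' x + 2 + 1) (st (bits (encode (if u then f x else g x)) @ a) b d)"
      by (intro runs_cond) (simp add: p encode_prod_def encode_bool_def)
    then show ?thesis by (cases u) (simp_all add: p eval_nat_numeral)
  qed
  then show ?thesis
    by (rule ptI[rotated]) (intro poly_bd_intros poly_bd_snd[OF f(1)] poly_bd_snd[OF g(1)])
qed

lemma pt_case_list0:
  fixes f :: "('e::encodable \<times> 'e list) \<times> 'a::encodable \<Rightarrow> 'b::encodable"
  assumes "pt f" "pt g"
  shows "pt (\<lambda>p. case fst p of [] \<Rightarrow> g (snd p) | e # es \<Rightarrow> f ((e, es), snd p))"
proof -
  obtain c T where f: "poly_bd T" "\<And>x a b d. runs c (st (bits (encode x) @ a) b d) (T x)
      (st (bits (encode (f x)) @ a) b d)" by (rule ptE[OF assms(1)], rule that)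
  obtain c' T' where g: "poly_bd T'" "\<And>x a b d. runs c' (st (bits (encode x) @ a) b d) (T' x)
      (st (bits (encode (g x)) @ a) b d)" by (rule ptE[OF assms(2)], rule that)
  \<comment> \<open>The argument of \<open>f\<close> exists only in the nonempty case, so its time
    bound is replaced by a monotone polynomial in the size of the whole input.\<close>
  obtain p q where p: "\<And>x. T x \<le> poly p (sz x)" and q: "\<And>x. T' x \<le> poly q (sz x)"
    using f(1) g(1) unfolding poly_bd_def by blast
  let ?h = "\<lambda>p. case fst p of [] \<Rightarrow> g (snd p) | e # es \<Rightarrow> f ((e, es), snd p)"
  have "runs (Cond RA {Some (Bit True)} (Pop RA ;; c) (Pop RA ;; c')) (st (bits (encode y) @ a) b d)
      (poly p (sz y) + poly q (sz y) + 2 + 1) (st (bits (encode (?h y)) @ a) b d)" for y a b d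
  proof (rule runs_cond, cases "fst y")
    case Nil
    then have y: "encode y = False # encode (snd y)" by (simp add: encode_prod_def)
    have "T' (snd y) \<le> poly q (sz y)"
      using q[of "snd y"] poly_nat_mono[of "sz (snd y)" "sz y" q] y by simp
    then show "runs (if top_sym (st (bits (encode y) @ a) b d RA) \<in> {Some (Bit True)} then Pop RA ;; c else Pop RA ;; c')
      (st (bits (encode y) @ a) b d) (poly p (sz y) + poly q (sz y) + 2) (st (bits (encode (?h y)) @ a) b d)"
      using runs_eq[OF runs_seq[OF runs_pop[of RA "st (bits (encode y) @ a) b d"]]] g(2)[of "snd y" a b d] Nil
      by (auto simp: y)
  next
    case (Cons e es)
    then have y: "encode y = True # encode ((e, es), snd y)" by (simp add: encode_prod_def)
    have "T ((e, es), snd y) \<le> poly p (sz y)"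
      using p[of "((e, es), snd y)"] poly_nat_mono[of "sz ((e, es), snd y)" "sz y" p] y by simp
    then show "runs (if top_sym (st (bits (encode y) @ a) b d RA) \<in> {Some (Bit True)} then Pop RA ;; c else Pop RA ;; c')
      (st (bits (encode y) @ a) b d) (poly p (sz y) + poly q (sz y) + 2) (st (bits (encode (?h y)) @ a) b d)"
      using runs_eq[OF runs_seq[OF runs_pop[of RA "st (bits (encode y) @ a) b d"]]] f(2)[of "((e, es), snd y)" a b d] Cons
      by (auto simp: y)
  qed
  then show ?thesis by (rule ptI[rotated]) (intro poly_bd_intros poly_bd_poly)
qed

named_theorems pt_intros

declare pt_id[pt_intros] pt_const[pt_intros] pt_pair[pt_intros]

lemma pt_fst [pt_intros]: "pt f \<Longrightarrow> pt (\<lambda>x. fst (f x))"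
  by (rule pt_comp[OF pt_fst0])

lemma pt_snd [pt_intros]: "pt f \<Longrightarrow> pt (\<lambda>x. snd (f x))"
  by (rule pt_comp[OF pt_snd0])

lemma pt_binary:
  assumes "pt (\<lambda>p. F (fst p) (snd p))"
  shows "pt f \<Longrightarrow> pt g \<Longrightarrow> pt (\<lambda>x. F (f x) (g x))"
  using pt_comp[OF assms pt_pair[of f g]] by simp

lemma pt_ternary:
  assumes "pt (\<lambda>p. F (fst p) (fst (snd p)) (snd (snd p)))"
  shows "pt f \<Longrightarrow> pt g \<Longrightarrow> pt h \<Longrightarrow> pt (\<lambda>x. F (f x) (g x) (h x))"
  using pt_comp[OF assms pt_pair[of f "\<lambda>x. (g x, h x)"]] pt_pair[of g h] by simp

lemma pt_Cons [pt_intros]: "pt f \<Longrightarrow> pt g \<Longrightarrow> pt (\<lambda>x. f x # g x)"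
  using pt_binary[OF pt_Cons0] .

lemma pt_if [pt_intros]: "pt b \<Longrightarrow> pt f \<Longrightarrow> pt g \<Longrightarrow> pt (\<lambda>x. if b x then f x else g x)"
  using pt_comp[OF pt_if0[of f g] pt_pair[OF _ pt_id, of b]] by (simp cong: if_cong)

lemma pt_conj [pt_intros]: "pt f \<Longrightarrow> pt g \<Longrightarrow> pt (\<lambda>x. f x \<and> g x)"
proof -
  have "(a \<and> b) = (if a then b else False)" for a b by simp
  then show "pt f \<Longrightarrow> pt g \<Longrightarrow> pt (\<lambda>x. f x \<and> g x)" by (simp only:) (intro pt_if pt_const)
qed

lemma pt_not [pt_intros]: "pt f \<Longrightarrow> pt (\<lambda>x. \<not> f x)"
proof -
  have "(\<not> a) = (if a then False else True)" for a by simp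
  then show "pt f \<Longrightarrow> pt (\<lambda>x. \<not> f x)" by (simp only:) (intro pt_if pt_const)
qed

lemma pt_disj [pt_intros]: "pt f \<Longrightarrow> pt g \<Longrightarrow> pt (\<lambda>x. f x \<or> g x)"
  using pt_not[OF pt_conj[OF pt_not pt_not, of f g]] by simp

lemma pt_case_list [pt_intros]:
  assumes "pt l" "pt g" "pt (\<lambda>p. f (fst p) (fst (snd p)) (snd (snd p)))"
  shows "pt (\<lambda>x. case l x of [] \<Rightarrow> g x | e # es \<Rightarrow> f x e es)"
proof -
  have "pt (\<lambda>q. f (snd q) (fst (fst q)) (snd (fst q)))"
    using pt_comp[OF assms(3), of "\<lambda>q. (snd q, (fst (fst q), snd (fst q)))"] by (simp add: pt_intros)
  from pt_comp[OF pt_case_list0[OF this assms(2)] pt_pair[OF assms(1) pt_id]] show ?thesis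
    by (simp cong: list.case_cong)
qed

section \<open>Iteration over lists\<close>

text \<open>The remaining list lies above accumulator and parameter. Popping its marker
  \<open>True\<close> leaves exactly the encoding that the body expects; the marker
  \<open>False\<close> ends the loop. The bound \<open>K\<close> is asked for only at the states
  actually visited.\<close>

lemma runs_foldl:
  fixes h :: "'x::encodable \<Rightarrow> 'a::encodable \<Rightarrow> 'e::encodable \<Rightarrow> 'a"
  assumes body: "\<And>e es u x a b d. runs c (st (bits (encode ((e, es), u, x)) @ a) b d) (T ((e, es), u, x))
      (st (bits (encode (es, h x u e, x)) @ a) b d)"
    and K: "\<And>i. i < length es \<Longrightarrow> T ((es ! i, drop (Suc i) es), foldl (h x) u (take i es), x) \<le> K"
  shows "runs (Loop RA {Some (Bit True)} (Pop RA ;; c) ;; Pop RA) (st (bits (encode (es, u, x)) @ a) b d)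
      (length es * (K + 3) + 3) (st (bits (encode (foldl (h x) u es, x)) @ a) b d)"
proof -
  have "runs (Loop RA {Some (Bit True)} (Pop RA ;; c)) (st (bits (encode (es, u, x)) @ a) b d)
      (length es * (K + 3) + 1) (st (Bit False # bits (encode (foldl (h x) u es, x)) @ a) b d)"
    using K
  proof (induction es arbitrary: u)
    case Nil
    then show ?case using runs_loop_exit[of "st (bits (encode ([] :: 'e list, u, x)) @ a) b d" RA]
      by (simp add: encode_prod_def)
  next
    case (Cons e es)
    have 1: "T ((e, es), u, x) \<le> K" using Cons.prems[of 0] by simp
    have 2: "T ((es ! i, drop (Suc i) es), foldl (h x) (h x u e) (take i es), x) \<le> K"
      if "i < length es" for i
      using Cons.prems[of "Suc i"] that by simp
    have pop: "runs (Pop RA) (st (bits (encode (e # es, u, x)) @ a) b d) 1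
        (st (bits (encode ((e, es), u, x)) @ a) b d)"
      by (rule runs_eq[OF runs_pop]) (simp_all add: encode_prod_def)
    have top_bit: "top_sym (st (bits (encode (e # es, u, x)) @ a) b d RA) \<in> {Some (Bit True)}"
      by (simp add: encode_prod_def)
    show ?case
      by (rule runs_eq[OF runs_loop[OF top_bit runs_seq[OF pop runs_mono[OF body 1]] Cons.IH[OF 2]]]) auto
  qed
  from runs_seq[OF this runs_pop] show ?thesis by (rule runs_eq) simp_all
qed

lemma sz_nth: "i < length xs \<Longrightarrow> sz (xs ! i) \<le> sz xs"
proof (induction xs arbitrary: i)
  case (Cons x xs)
  then show ?case by (cases i) (auto simp: le_SucI trans_le_add2)
qed simp

lemma sz_drop: "sz (drop i xs) \<le> sz xs"
proof (induction xs arbitrary: i)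
  case (Cons x xs)
  then show ?case by (cases i) (auto simp: le_SucI trans_le_add2)
qed simp

lemma length_le_sz: "length xs < sz xs"
  by (induction xs) auto

lemma sz_append: "sz (xs @ ys) + 1 = sz xs + sz ys"
  by (induction xs) auto

lemma sz_mem: "e \<in> set es \<Longrightarrow> sz e \<le> sz es"
  using sz_nth by (metis in_set_conv_nth)

text \<open>Iterating a polynomial-time step can produce exponentially large values, for instance by
  doubling the accumulator in each round. The bound \<open>S\<close> on all intermediate
  accumulators excludes this and bounds every round by one polynomial.\<close>

lemma pt_foldl:
  fixes h :: "'x::encodable \<Rightarrow> 'a::encodable \<Rightarrow> 'e::encodable \<Rightarrow> 'a"
  assumes h: "pt (\<lambda>p. h (fst p) (fst (snd p)) (snd (snd p)))"
    and init: "pt u" and l: "pt l" and S: "poly_bd S"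
    and bound: "\<And>x i. i < length (l x) \<Longrightarrow> sz (foldl (h x) (u x) (take i (l x))) \<le> S x"
  shows "pt (\<lambda>x. foldl (h x) (u x) (l x))"
proof -
  let ?f = "\<lambda>q :: ('e \<times> 'e list) \<times> 'a \<times> 'x. (snd (fst q), h (snd (snd q)) (fst (snd q)) (fst (fst q)), snd (snd q))"
  have "pt (\<lambda>q. h (snd (snd q)) (fst (snd q)) (fst (fst q)))"
    using pt_comp[OF h, of "\<lambda>q. (snd (snd q), fst (snd q), fst (fst q))"] by (simp add: pt_intros)
  then have pt_body: "pt ?f" by (intro pt_intros)
  obtain c T where T: "poly_bd T" "\<And>x a b d. runs c (st (bits (encode x) @ a) b d) (T x)
      (st (bits (encode (?f x)) @ a) b d)" by (rule ptE[OF pt_body], rule that)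
  obtain p where p: "\<And>x. T x \<le> poly p (sz x)" using T(1) unfolding poly_bd_def by blast
  let ?init = "\<lambda>x. (l x, u x, x)"
  have pt_init: "pt ?init" by (intro pt_intros init l)
  obtain c0 T0 where T0: "poly_bd T0" "\<And>x a b d. runs c0 (st (bits (encode x) @ a) b d) (T0 x)
      (st (bits (encode (?init x)) @ a) b d)" by (rule ptE[OF pt_init], rule that)
  let ?K = "\<lambda>x. poly p (sz (l x) + sz (l x) + S x + sz x)"
  let ?c = "Loop RA {Some (Bit True)} (Pop RA ;; c) ;; Pop RA"
  have "runs ?c (st (bits (encode (?init x)) @ a) b d) (sz (l x) * (?K x + 3) + 3)
      (st (bits (encode (foldl (h x) (u x) (l x), x)) @ a) b d)" for x a b d
  proof (rule runs_mono[OF runs_foldl[where T = T and K = "?K x"]])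
    show "runs c (st (bits (encode ((e, es), v, y)) @ a) b d) (T ((e, es), v, y))
        (st (bits (encode (es, h y v e, y)) @ a) b d)" for e es v y a b d
      using T(2)[of "((e, es), v, y)"] by simp
    show "T ((l x ! i, drop (Suc i) (l x)), foldl (h x) (u x) (take i (l x)), x) \<le> ?K x"
      if "i < length (l x)" for i
      using bound[OF that] sz_nth[OF that] sz_drop[of "Suc i" "l x"]
      by (intro order_trans[OF p] poly_nat_mono) (simp add: sz_prod add_mono)
    show "length (l x) * (?K x + 3) + 3 \<le> sz (l x) * (?K x + 3) + 3"
      using length_le_sz[of "l x"] by (intro add_mono mult_le_mono) simp_all
  qed
  note run = runs_seq[OF T0(2) this]
  have "poly_bd (\<lambda>x. T0 x + (sz (l x) * (?K x + 3) + 3) + 1)"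
    by (intro poly_bd_intros poly_bd_poly T0(1) S poly_bd_sz_pt l)
  from ptI[OF this run] have "pt (\<lambda>x. (foldl (h x) (u x) (l x), x))" .
  from pt_fst[OF this] show ?thesis by simp
qed

text \<open>An increment that depends on the parameter and the list element, but not on the
  accumulator, adds up to at most the list length times one polynomial.\<close>

lemma pt_foldl_growth:
  fixes h :: "'x::encodable \<Rightarrow> 'a::encodable \<Rightarrow> 'e::encodable \<Rightarrow> 'a"
  assumes h: "pt (\<lambda>p. h (fst p) (fst (snd p)) (snd (snd p)))"
    and init: "pt u" and l: "pt l" and D: "poly_bd D"
    and growth: "\<And>x v e. sz (h x v e) \<le> sz v + D (x, e)"
  shows "pt (\<lambda>x. foldl (h x) (u x) (l x))"
proof -
  obtain p where p: "\<And>x. D x \<le> poly p (sz x)" using D unfolding poly_bd_def by blast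
  have "sz (foldl (h x) v es) \<le> sz v + length es * poly p (sz x + sz (l x))"
    if "set es \<subseteq> set (l x)" for x v es
    using that
  proof (induction es arbitrary: v)
    case (Cons e es)
    have "D (x, e) \<le> poly p (sz x + sz (l x))"
      using Cons.prems sz_mem[of e "l x"] by (intro order_trans[OF p] poly_nat_mono) (simp add: sz_prod)
    then show ?case using Cons.IH[of "h x v e"] Cons.prems growth[of x v e] by simp
  qed simp
  note b = this
  have "sz (foldl (h x) (u x) (take i (l x))) \<le> sz (u x) + sz (l x) * poly p (sz x + sz (l x))" for x i
  proof -
    have "length (take i (l x)) \<le> sz (l x)" using length_le_sz[of "l x"] by simp
    from mult_le_mono1[OF this] show ?thesis
      using b[OF set_take_subset, of x "u x" i] by (meson add_left_mono order_trans)
  qed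
  moreover have "poly_bd (\<lambda>x. sz (u x) + sz (l x) * poly p (sz x + sz (l x)))"
    by (intro poly_bd_intros poly_bd_poly poly_bd_sz_pt init l)
  ultimately show ?thesis by (intro pt_foldl[OF h init l])
qed

lemma pt_rev [pt_intros]: "pt l \<Longrightarrow> pt (\<lambda>x. rev (l x))"
proof -
  assume l: "pt l"
  have "foldl (\<lambda>v e. e # v) ys xs = rev xs @ ys" for xs ys :: "'b list"
    by (induction xs arbitrary: ys) auto
  from this[of "[]"] have *: "rev xs = foldl (\<lambda>v e. e # v) [] xs" for xs :: "'b list" by simp
  show ?thesis unfolding *
    by (rule pt_foldl_growth[where D = "\<lambda>p. sz (snd p) + 1"])
      (auto intro!: pt_intros poly_bd_intros poly_bd_sz_pt l)
qed

lemma pt_foldr_growth: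
  fixes h :: "'x::encodable \<Rightarrow> 'e::encodable \<Rightarrow> 'a::encodable \<Rightarrow> 'a"
  assumes h: "pt (\<lambda>p. h (fst p) (fst (snd p)) (snd (snd p)))"
    and init: "pt u" and l: "pt l" and D: "poly_bd D"
    and growth: "\<And>x v e. sz (h x e v) \<le> sz v + D (x, e)"
  shows "pt (\<lambda>x. foldr (h x) (l x) (u x))"
  unfolding foldr_conv_foldl
proof (rule pt_foldl_growth[where D = D])
  show "pt (\<lambda>p. h (fst p) (snd (snd p)) (fst (snd p)))"
    using pt_comp[OF h, of "\<lambda>p. (fst p, snd (snd p), fst (snd p))"] by (simp add: pt_intros)
qed (use assms in \<open>auto intro: pt_intros\<close>)

lemma pt_map [pt_intros]:
  assumes f: "pt (\<lambda>p. f (fst p) (snd p))" and l: "pt l"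
  shows "pt (\<lambda>x. map (f x) (l x))"
proof -
  have *: "map g xs = foldr (\<lambda>e v. g e # v) xs []" for g xs
    by (induction xs) auto
  have "pt (\<lambda>p. f (fst p) (fst (snd p)))"
    using pt_comp[OF f, of "\<lambda>p. (fst p, fst (snd p))"] by (simp add: pt_intros)
  then show ?thesis unfolding *
    by (intro pt_foldr_growth[where D = "\<lambda>p. sz (f (fst p) (snd p)) + 1"])
      (auto intro!: pt_intros poly_bd_intros poly_bd_sz_pt f l)
qed

lemma pt_filter [pt_intros]:
  assumes f: "pt (\<lambda>p. f (fst p) (snd p))" and l: "pt l"
  shows "pt (\<lambda>x. filter (f x) (l x))"
proof -
  have *: "filter g xs = foldr (\<lambda>e v. if g e then e # v else v) xs []" for g xs
    by (induction xs) auto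
  have "pt (\<lambda>p. f (fst p) (fst (snd p)))"
    using pt_comp[OF f, of "\<lambda>p. (fst p, fst (snd p))"] by (simp add: pt_intros)
  then show ?thesis unfolding *
    by (intro pt_foldr_growth[where D = "\<lambda>p. sz (snd p) + 1"])
      (auto intro!: pt_intros poly_bd_intros poly_bd_sz_pt f l)
qed

lemma pt_list_all [pt_intros]:
  assumes f: "pt (\<lambda>p. f (fst p) (snd p))" and l: "pt l"
  shows "pt (\<lambda>x. list_all (f x) (l x))"
proof -
  have *: "list_all g xs = foldr (\<lambda>e v. g e \<and> v) xs True" for g xs
    by (induction xs) auto
  have "pt (\<lambda>p. f (fst p) (fst (snd p)))"
    using pt_comp[OF f, of "\<lambda>p. (fst p, fst (snd p))"] by (simp add: pt_intros)
  then show ?thesis unfolding *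
    by (intro pt_foldr_growth[where D = "\<lambda>p. 1"])
      (auto intro!: pt_intros poly_bd_intros l simp: encode_bool_def)
qed

lemma pt_list_ex [pt_intros]:
  assumes f: "pt (\<lambda>p. f (fst p) (snd p))" and l: "pt l"
  shows "pt (\<lambda>x. list_ex (f x) (l x))"
proof -
  have *: "list_ex g xs = (\<not> list_all (\<lambda>e. \<not> g e) xs)" for g xs
    by (induction xs) auto
  show ?thesis unfolding * by (intro pt_intros f l)
qed

lemma pt_append [pt_intros]:
  assumes "pt f" "pt g"
  shows "pt (\<lambda>x. f x @ g x)"
proof -
  have *: "xs @ ys = foldr (#) xs ys" for xs ys :: "'b list"
    by (induction xs) auto
  show ?thesis unfolding *
    by (intro pt_foldr_growth[where D = "\<lambda>p. sz (snd p) + 1"] assms)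
      (auto intro!: pt_intros poly_bd_intros poly_bd_sz_pt)
qed

lemma pt_concat [pt_intros]:
  assumes "pt f"
  shows "pt (\<lambda>x. concat (f x))"
proof -
  have *: "concat xs = foldr (@) xs []" for xs :: "'b list list"
    by (induction xs) auto
  have "sz (xs @ ys) \<le> sz ys + sz xs" for xs ys :: "'b list"
    using sz_append[of xs ys] by simp
  then show ?thesis unfolding *
    by (intro pt_foldr_growth[where D = "\<lambda>p. sz (snd p)"] assms)
      (auto intro!: pt_intros poly_bd_intros poly_bd_sz_pt)
qed

lemma pt_zip [pt_intros]:
  assumes "pt f" "pt g"
  shows "pt (\<lambda>x. zip (f x) (g x))"
proof -
  \<comment> \<open>The second list sits in the accumulator and loses its head in each round. That
    head only changes place, so the growth is covered by the element of the first list.\<close>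
  let ?h = "\<lambda>(v :: ('b \<times> 'c) list \<times> 'c list) e.
    case snd v of [] \<Rightarrow> (fst v, []) | e' # es \<Rightarrow> ((e, e') # fst v, es)"
  have "rev (fst (foldl ?h (acc, ys) xs)) = rev acc @ zip xs ys" for acc xs ys
  proof (induction xs arbitrary: ys acc)
    case (Cons x xs)
    have "fst (foldl ?h (acc, []) xs) = acc" by (induction xs) auto
    then show ?case using Cons by (cases ys) auto
  qed simp
  from this[of "[]"] have *: "zip xs ys = rev (fst (foldl ?h ([], ys) xs))" for xs ys by simp
  have "sz (?h v e) \<le> sz v + (sz e + 1)" for v e
    by (auto simp: sz_prod split: list.split)
  then show ?thesis unfolding *
    by (intro pt_rev pt_fst pt_foldl_growth[where D = "\<lambda>p. sz (snd p) + 1"] assms)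
      (auto intro!: pt_intros poly_bd_intros poly_bd_sz_pt assms)
qed

section \<open>Unary numbers and equality\<close>

lemma sz_nat [simp]: "sz (n :: nat) = n + 1"
proof -
  have "sz (replicate n ()) = n + 1" by (induction n) (simp_all add: encode_unit_def)
  then show ?thesis by (simp add: encode_nat_def)
qed

lemma pt_replicate_unit: "pt (\<lambda>n. replicate n ())"
  by (rule pt_recode) (simp add: encode_nat_def)

lemma pt_length_unit: "pt (\<lambda>xs :: unit list. length xs)"
proof (rule pt_recode)
  fix xs :: "unit list"
  have "replicate (length xs) () = xs" by (induction xs) simp_all
  then show "encode (length xs) = encode xs" by (simp add: encode_nat_def)
qed

lemma pt_length [pt_intros]: "pt l \<Longrightarrow> pt (\<lambda>x. length (l x))"
  using pt_comp[OF pt_length_unit pt_map[OF pt_const[of "()"]], of l] by simp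

lemma pt_Suc [pt_intros]: "pt f \<Longrightarrow> pt (\<lambda>x. Suc (f x))"
  using pt_comp[OF pt_length_unit pt_Cons[OF pt_const[of "()"] pt_comp[OF pt_replicate_unit]], of f] by simp

lemma pt_add [pt_intros]: "pt f \<Longrightarrow> pt g \<Longrightarrow> pt (\<lambda>x. f x + g x :: nat)"
  using pt_comp[OF pt_length_unit pt_append[OF pt_comp[OF pt_replicate_unit] pt_comp[OF pt_replicate_unit]], of f g]
  by simp

text \<open>Dropping one entry of \<open>m\<close> for each entry of \<open>n\<close> computes the
  truncated difference of the unary numbers, and emptiness is testable.\<close>

lemma pt_le [pt_intros]:
  assumes "pt f" "pt g"
  shows "pt (\<lambda>x. f x \<le> (g x :: nat))"
proof -
  let ?h = "\<lambda>(xs :: unit list) (_ :: unit). case xs of [] \<Rightarrow> [] | _ # es \<Rightarrow> es"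
  have "foldl ?h (replicate m ()) (replicate n ()) = replicate (m - n) ()" for m n
  proof (induction n arbitrary: m)
    case (Suc n)
    then show ?case using Suc[of "m - 1"] by (cases m) simp_all
  qed simp
  then have *: "m \<le> n \<longleftrightarrow> (case foldl ?h (replicate m ()) (replicate n ()) of [] \<Rightarrow> True | _ # _ \<Rightarrow> False)"
    for m n :: nat by (cases "m - n") simp_all
  have "pt (\<lambda>x. replicate (f x) ())" "pt (\<lambda>x. replicate (g x) ())"
    using pt_comp[OF pt_replicate_unit] assms by auto
  then show ?thesis unfolding *
    by (intro pt_case_list pt_const pt_foldl_growth[where D = "\<lambda>_. 0"])
      (auto intro!: pt_intros poly_bd_intros split: list.split)
qed

lemma pt_less [pt_intros]: "pt f \<Longrightarrow> pt g \<Longrightarrow> pt (\<lambda>x. f x < (g x :: nat))"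
  unfolding Suc_le_eq[symmetric] by (intro pt_intros)

lemma pt_eq_nat [pt_intros]: "pt f \<Longrightarrow> pt g \<Longrightarrow> pt (\<lambda>x. f x = (g x :: nat))"
  unfolding eq_iff by (intro pt_intros)

lemma pt_eq_bool [pt_intros]: "pt f \<Longrightarrow> pt g \<Longrightarrow> pt (\<lambda>x. f x = (g x :: bool))"
  unfolding iff_conv_conj_imp imp_conv_disj by (intro pt_intros)

lemma pt_eq_prod [pt_intros]:
  fixes f g :: "'x::encodable \<Rightarrow> 'a::encodable \<times> 'b::encodable"
  assumes "pt (\<lambda>x. fst (f x) = fst (g x))" "pt (\<lambda>x. snd (f x) = snd (g x))"
  shows "pt (\<lambda>x. f x = g x)"
  unfolding prod_eq_iff by (intro pt_intros assms)

lemma pt_eq_list [pt_intros]: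
  fixes f g :: "'x::encodable \<Rightarrow> 'a::encodable list"
  assumes "pt (\<lambda>p :: 'x \<times> 'a \<times> 'a. fst (snd p) = snd (snd p))" "pt f" "pt g"
  shows "pt (\<lambda>x. f x = g x)"
proof -
  have "xs = ys \<longleftrightarrow> length xs = length ys \<and> list_all (\<lambda>p. fst p = snd p) (zip xs ys)" for xs ys :: "'a list"
    by (auto simp: list_eq_iff_zip_eq list_all_iff)
  then show ?thesis by (simp only:) (intro pt_intros assms)
qed

text \<open>The appended number depends on the accumulator, which the additive growth rule does not
  permit. The intermediate lists are known, however: they are initial segments, of quadratic
  size.\<close>

lemma pt_upt [pt_intros]:
  assumes "pt f"
  shows "pt (\<lambda>x. [0..<f x])"
proof -
  have *: "foldl (\<lambda>v (_::unit). v @ [length v]) [] (replicate n ()) = [0..<n]" for n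
    by (induction n) (simp_all flip: replicate_append_same)
  have sz: "sz [0..<n] \<le> n * (n + 2) + 1" for n
  proof (induction n)
    case (Suc n)
    then show ?case using sz_append[of "[0..<n]" "[n]"] by simp
  qed simp
  have "pt (\<lambda>x. foldl (\<lambda>v (_::unit). v @ [length v]) [] (replicate (f x) ()))"
  proof (rule pt_foldl[where S = "\<lambda>x. sz (f x) * (sz (f x) + 2) + 1"])
    fix x i assume "i < length (replicate (f x) ())"
    then have "foldl (\<lambda>v (_::unit). v @ [length v]) [] (take i (replicate (f x) ())) = [0..<i]" "i \<le> sz (f x)"
      by (simp_all add: min_def *)
    then show "sz (foldl (\<lambda>v (_::unit). v @ [length v]) [] (take i (replicate (f x) ())))
        \<le> sz (f x) * (sz (f x) + 2) + 1"
      using order_trans[OF sz[of i] add_right_mono[OF mult_le_mono]] by (metis add_right_mono)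
  qed (use assms pt_comp[OF pt_replicate_unit] in
      \<open>auto intro!: pt_intros poly_bd_intros poly_bd_sz_pt simp del: sz_nat\<close>)
  then show ?thesis by (simp add: *)
qed

text \<open>A word falls into one of three cases: it starts with no encoding and the parser aborts;
  an encoding is followed by further bits and the check for an empty \<open>RA\<close> aborts; or it
  is an encoding. In the last case the program for \<open>good\<close> runs on the copy kept on
  \<open>RC\<close>.\<close>

lemma class_P_pt:
  fixes good :: "'a::encodable \<Rightarrow> bool"
  assumes "pt good"
  shows "encode ` {x. good x} \<in> class_P"
proof -
  obtain c T where T: "poly_bd T" "\<And>x a b d. runs c (st (bits (encode x) @ a) b d) (T x)
      (st (bits (encode (good x)) @ a) b d)" by (rule ptE[OF assms], rule that)
  obtain p where p: "\<And>x. T x \<le> poly p (sz x)" using T(1) unfolding poly_bd_def by blast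
  obtain k where k: "\<And>(x::'a) a b d. runs (stash TYPE('a)) (st (bits (encode x) @ a) b d)
     (k * (sz x + 1)) (st a (bits (rev (encode x)) @ Mark # b) (bits (rev (encode x)) @ Mark # d))"
    using runs_stash by blast
  obtain m where m: "\<And>w b d. (\<forall>(x::'a) r. w \<noteq> encode x @ r) \<Longrightarrow>
      (\<exists>t \<le> m * (length w + 1). exec (tr TYPE('a)) (st (bits w) b d) t None)" using tr_aborts by blast
  let ?chk = "Cond RA {None} skip Abort"
  let ?c = "stash TYPE('a) ;; (?chk ;; (erase RB ;; (unroll RC ;; c)))"
  \<comment> \<open>The slope 8 pays for erasing one copy (2 per bit) and unrolling the other (6 per
    bit), \<open>k\<close> and \<open>m\<close> pay for parsing, and 20 covers the constant
    overhead.\<close>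
  let ?P = "p + [:k + m + 20, k + m + 8:]"
  show ?thesis
  proof (rule class_P_intro[where c = ?c and p = ?P])
    fix w
    have init: "input_stacks w = st (bits w) [] []"
      by (auto simp: input_stacks_def st_def fun_eq_iff split: reg.split)
    consider (good) x :: 'a where "w = encode x" | (extra) x :: 'a and r where "w = encode x @ r" "r \<noteq> []"
      | (none) "\<forall>(x::'a) r. w \<noteq> encode x @ r" by (metis append_Nil2)
    then show "\<exists>t r. t \<le> poly ?P (length w) \<and> exec ?c (input_stacks w) t r \<and>
        (w \<in> encode ` {x. good x} \<longleftrightarrow> (\<exists>s. r = Some s \<and> top_sym (s RA) = Some (Bit True)))"
    proof cases
      case (good x)
      let ?s = "st [] (bits (rev (encode x)) @ [Mark]) (bits (rev (encode x)) @ [Mark])"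
      have chk: "runs ?chk ?s (1 + 1) ?s"
        using runs_skip by (intro runs_cond) simp
      have "runs ?c (st (bits (encode x)) [] []) (k * (sz x + 1) + (1 + 1 + ((2 * sz x + 3) +
          ((6 * sz x + 3) + T x + 1) + 1) + 1) + 1) (st (bits (encode (good x))) [] [])"
        using runs_seq[OF k[of x "[]" "[]" "[]"] runs_seq[OF chk runs_seq[OF runs_erase_rev(1) runs_seq[OF runs_unroll_rev(2) T(2)]]]]
        by simp
      then obtain t where t: "t \<le> k * (sz x + 1) + (1 + 1 + ((2 * sz x + 3) +
          ((6 * sz x + 3) + T x + 1) + 1) + 1) + 1"
          "exec ?c (st (bits (encode x)) [] []) t (Some (st (bits (encode (good x))) [] []))"
        unfolding runs_def by blast
      have "t \<le> poly ?P (length w)" using t(1) p[of x] good by (simp add: algebra_simps)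
      moreover have "w \<in> encode ` {x. good x} \<longleftrightarrow> good x"
        using encode_prefix_free[of x "[]" _ "[]"] good by auto
      ultimately show ?thesis using t(2) init good
        by (intro exI[of _ t] exI[of _ "Some (st (bits (encode (good x))) [] [])"]) (simp add: encode_bool_def)
    next
      case (extra x r)
      obtain t where t: "t \<le> k * (sz x + 1)" "exec (stash TYPE('a)) (st (bits w) [] []) t
          (Some (st (bits r) (bits (rev (encode x)) @ [Mark]) (bits (rev (encode x)) @ [Mark])))"
        using k[of x "bits r" "[]" "[]"] extra unfolding runs_def by auto
      have "exec ?chk (st (bits r) b d) (Suc 1) None" for b d
        using extra(2) exec.Abort by (intro exec.Cond) (cases r, auto)
      from exec.Seq[OF t(2) exec.SeqAbort[OF this]] have "exec ?c (st (bits w) [] []) (Suc (t + Suc (Suc 1))) None" .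
      moreover have "Suc (t + Suc (Suc 1)) \<le> poly ?P (length w)" using t(1) extra by (simp add: algebra_simps)
      moreover have "w \<notin> encode ` {x. good x}"
        using encode_prefix_free[of x r _ "[]"] extra by auto
      ultimately show ?thesis using init by (metis option.distinct(1))
    next
      case none
      obtain t where t: "t \<le> m * (length w + 1)" "exec (tr TYPE('a)) (st (bits w) [Mark] [Mark]) t None"
        using m[OF none] by blast
      have "exec (Push RB Mark) (st (bits w) [] []) 2 (Some (st (bits w) [Mark] []))"
          "exec (Push RC Mark) (st (bits w) [Mark] []) 2 (Some (st (bits w) [Mark] [Mark]))"
        using exec.Push[of RB Mark "st (bits w) [] []"] exec.Push[of RC Mark "st (bits w) [Mark] []"] by simp_all
      from exec.SeqAbort[OF exec.Seq[OF this(1) exec.Seq[OF this(2) t(2)]]]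
      have "exec ?c (st (bits w) [] []) (Suc (Suc (2 + Suc (2 + t)))) None" unfolding stash_def .
      moreover have "Suc (Suc (2 + Suc (2 + t))) \<le> poly ?P (length w)"
        using t(1) by (simp add: algebra_simps)
      moreover have "w \<notin> encode ` {x. good x}"
        using none by (metis append_Nil2 imageE)
      ultimately show ?thesis using init by (metis option.distinct(1))
    qed
  qed
qed

section \<open>Bucklin elections and shifts\<close>

lemma pos_append:
  "pos (a @ b) c = (if c \<in> set a then pos a c else length a + pos b c)"
  by (induction a) (auto simp: pos_def)

lemma pos_Cons: "pos (x # r) c = (if x = c then 1 else Suc (pos r c))"
  by (simp add: pos_def)

lemma pos_le_length: "c \<in> set r \<Longrightarrow> pos r c \<le> length r"
  by (induction r) (auto simp: pos_Cons)

lemma pos_ge_1: "1 \<le> pos r c"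
  by (simp add: pos_def)

lemma pos_le_iff: "c \<in> set r \<Longrightarrow> pos r c \<le> n \<longleftrightarrow> c \<in> set (take n r)"
proof (induction r arbitrary: n)
  case (Cons x r)
  then show ?case by (cases n) (auto simp: pos_Cons dest: in_set_takeD)
qed simp

text \<open>In \<open>r = xs @ d # ys\<close>, the shift lifts the block \<open>take t ys\<close>
  over \<open>d\<close>, and a candidate of \<open>ys\<close> lies in this block iff its position in
  \<open>ys\<close> is at most \<open>t\<close>.\<close>

lemma pos_shift_back_other:
  assumes "distinct r" "d \<in> set r" "c \<in> set r" "c \<noteq> d"
  shows "pos (shift_back d t r) c =
    (if pos r d < pos r c \<and> pos r c \<le> pos r d + t then pos r c - 1 else pos r c)"
proof -
  obtain xs ys where r: "r = xs @ d # ys" using split_list[OF assms(2)] by blast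
  then have nd: "d \<notin> set xs" "d \<notin> set ys" using assms(1) by auto
  have pd: "pos r d = Suc (length xs)" using r nd by (simp add: pos_append pos_Cons)
  have shift: "shift_back d t r = xs @ take t ys @ d # drop t ys"
    using r nd pd by (simp add: shift_back_def Let_def)
  show ?thesis
  proof (cases "c \<in> set xs")
    case True
    then show ?thesis using pos_le_length[OF True] unfolding pd unfolding shift by (simp add: r pos_append)
  next
    case False
    then have c: "c \<in> set ys" using assms r by auto
    have "pos ys c = (if c \<in> set (take t ys) then pos (take t ys) c else length (take t ys) + pos (drop t ys) c)"
      by (metis append_take_drop_id pos_append)
    moreover have "c \<in> set (take t ys) \<longleftrightarrow> pos ys c \<le> t" by (simp add: pos_le_iff[OF c])
    moreover have "\<not> pos ys c \<le> t \<Longrightarrow> t \<le> length ys" using pos_le_length[OF c] by simp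
    ultimately show ?thesis using False assms(4) pos_ge_1[of ys c] unfolding pd unfolding shift
      by (auto simp: r pos_append pos_Cons)
  qed
qed

text \<open>From left to right, the witnesses are the winning round and any winner other than
  \<open>d\<close>; some winner exists because the scores attain a maximum. From right to left,
  \<open>c\<close> forces the winning round to be at most \<open>l\<close>, and an earlier one would
  give a sole winner \<open>d\<close> a majority among the top \<open>l - 1\<close>.\<close>

lemma bucklin_not_unique_iff:
  assumes E: "is_election (C, V)" and d: "d \<in> C" and V: "V \<noteq> []"
  shows "bucklin (C, V) \<noteq> {d} \<longleftrightarrow> (\<exists>c\<in>C. c \<noteq> d \<and> (\<exists>l\<le>card C.
     2 * length (filter (\<lambda>r. pos r d < l) V) \<le> length V \<and>
     length V < 2 * approval_score V l c \<and> approval_score V l d \<le> approval_score V l c))"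
proof -
  define L where "L = bucklin_round (C, V)"
  let ?maj = "\<lambda>l. \<exists>c\<in>C. approval_score V l c \<ge> length V div 2 + 1"
  have L: "L = (LEAST l. ?maj l)" by (simp add: L_def bucklin_round_def)
  have "pos r d \<le> card C" if "r \<in> set V" for r
    using that E d pos_le_length[of d r] distinct_card[of r] by (auto simp: is_election_def)
  \<comment> \<open>In round \<open>card C\<close> every voter approves \<open>d\<close>. This
    bounds the winning round, and with it the search for \<open>l\<close>.\<close>
  then have "filter (\<lambda>r. pos r d \<le> card C) V = V" by simp
  then have "approval_score V (card C) d = length V" by (simp add: approval_score_def)
  moreover have "length V div 2 + 1 \<le> length V" using V by (cases V) auto
  ultimately have m: "?maj (card C)" using d by (intro bexI[of _ d]) simp_all
  then have maj_L: "?maj L" and L_le: "L \<le> card C" unfolding L by (rule LeastI, rule Least_le)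
  have L_min: "L \<le> l" if "?maj l" for l unfolding L using that by (rule Least_le)
  have W: "c \<in> bucklin (C, V) \<longleftrightarrow> c \<in> C \<and> (\<forall>c'\<in>C. approval_score V L c' \<le> approval_score V L c)" for c
    by (simp add: bucklin_def bucklin_score_def L_def)
  have mono: "approval_score V L d \<le> length (filter (\<lambda>r. pos r d < l) V)" if "L < l" for l
    unfolding approval_score_def using that by (induction V) auto
  show ?thesis
  proof
    assume ne: "bucklin (C, V) \<noteq> {d}"
    have "finite C" "C \<noteq> {}" using E d by (auto simp: is_election_def)
    then have "Max (approval_score V L ` C) \<in> approval_score V L ` C" by (intro Max_in) auto
    then obtain w where "w \<in> C" "approval_score V L w = Max (approval_score V L ` C)" by auto
    then have "w \<in> C" "\<forall>c'\<in>C. approval_score V L c' \<le> approval_score V L w"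
      using \<open>finite C\<close> by simp_all
    then have "bucklin (C, V) \<noteq> {}" using W by auto
    then obtain c where c: "c \<in> bucklin (C, V)" "c \<noteq> d" using ne by auto
    \<comment> \<open>Round \<open>L - 1\<close> has no majority by minimality; for
      \<open>L = 0\<close> the filter is empty, as no position lies below 0.\<close>
    have "2 * length (filter (\<lambda>r. pos r d < L) V) \<le> length V"
    proof (cases L)
      case (Suc L')
      then have "\<not> ?maj L'" using L_min[of L'] by auto
      then have "approval_score V L' d < length V div 2 + 1" using d by force
      then show ?thesis using Suc by (simp add: approval_score_def less_Suc_eq_le)
    qed simp
    moreover have "length V < 2 * approval_score V L c" using maj_L c W by fastforce
    ultimately show "\<exists>c\<in>C. c \<noteq> d \<and> (\<exists>l\<le>card C. 2 * length (filter (\<lambda>r. pos r d < l) V) \<le> length V \<and>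
       length V < 2 * approval_score V l c \<and> approval_score V l d \<le> approval_score V l c)"
      using c W d L_le by blast
  next
    assume "\<exists>c\<in>C. c \<noteq> d \<and> (\<exists>l\<le>card C. 2 * length (filter (\<lambda>r. pos r d < l) V) \<le> length V \<and>
       length V < 2 * approval_score V l c \<and> approval_score V l d \<le> approval_score V l c)"
    then obtain c l where c: "c \<in> C" "c \<noteq> d" "2 * length (filter (\<lambda>r. pos r d < l) V) \<le> length V"
      "length V < 2 * approval_score V l c" "approval_score V l d \<le> approval_score V l c" by blast
    have "L \<le> l" using c by (intro L_min bexI[of _ c]) auto
    show "bucklin (C, V) \<noteq> {d}"
    proof
      assume "bucklin (C, V) = {d}"
      then have dW: "\<forall>c'\<in>C. approval_score V L c' \<le> approval_score V L d" "c \<notin> bucklin (C, V)"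
        using W c by auto
      then have "length V div 2 + 1 \<le> approval_score V L d" using maj_L by force
      then have "L = l" using mono[of l] \<open>L \<le> l\<close> c(3) by (cases "L = l") auto
      then have "c \<in> bucklin (C, V)" using dW(1) c W by (meson order_trans)
      then show False using dW by simp
    qed
  qed
qed

section \<open>Binary subtraction\<close>

fun bits_val :: "bool list \<Rightarrow> nat" where
  "bits_val [] = 0"
| "bits_val (b # bs) = of_bool b + 2 * bits_val bs"

lemma bits_val_binary [simp]: "bits_val (binary n) = n"
proof (induction n rule: less_induct)
  case (less n)
  then show ?case by (cases "n = 0") (auto simp: binary.simps[of n] binary.simps[of 0])
qed

definition canonical :: "bool list \<Rightarrow> bool" where
  "canonical bs = (case rev bs of [] \<Rightarrow> True | b # _ \<Rightarrow> b)"

lemma bits_val_eq_0_iff: "bits_val bs = 0 \<longleftrightarrow> \<not> list_ex id bs"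
  by (induction bs) auto

lemma canonical_Cons: "canonical (b # bs) \<longleftrightarrow> (if bs = [] then b else canonical bs)"
  by (cases bs rule: rev_cases) (auto simp: canonical_def)

lemma binary_bits_val: "canonical bs \<Longrightarrow> binary (bits_val bs) = bs"
proof (induction bs)
  case (Cons b bs)
  show ?case
  proof (cases "bs = []")
    case True
    then show ?thesis using Cons.prems by (simp add: canonical_Cons binary.simps)
  next
    case False
    then have "canonical bs" using Cons.prems by (simp add: canonical_Cons)
    note IH = Cons.IH[OF this]
    then have "bits_val bs \<noteq> 0" using False by (metis binary.simps)
    then show ?thesis using IH by (subst binary.simps) auto
  qed
qed (simp add: binary.simps)

lemma canonical_binary: "canonical (binary n)"
proof (induction n rule: less_induct)
  case (less n)
  show ?case
  proof (cases "n = 0")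
    case True
    then show ?thesis by (simp add: binary.simps canonical_def)
  next
    case False
    then have "binary n = odd n # binary (n div 2)" by (simp add: binary.simps)
    moreover have "canonical (binary (n div 2))" using less False by simp
    moreover have "odd n" if "binary (n div 2) = []"
    proof -
      have "n div 2 = 0" using that by (metis bits_val.simps(1) bits_val_binary)
      then show ?thesis using False by (cases "n = 1") auto
    qed
    ultimately show ?thesis by (auto simp: canonical_Cons)
  qed
qed

definition head_bit :: "bool list \<Rightarrow> bool" where
  "head_bit bs = (case bs of [] \<Rightarrow> False | b # _ \<Rightarrow> b)"

text \<open>The state consists of the borrow, the remaining digits of the subtrahend, and the digits of
  the difference in reverse order.\<close>

definition sub_step :: "bool \<times> bool list \<times> bool list \<Rightarrow> bool \<Rightarrow> bool \<times> bool list \<times> bool list" where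
  "sub_step s x =
     ((\<not> x \<and> (head_bit (fst (snd s)) \<or> fst s)) \<or> (head_bit (fst (snd s)) \<and> fst s), tl (fst (snd s)),
      (x \<noteq> (head_bit (fst (snd s)) \<noteq> fst s)) # snd (snd s))"

text \<open>The first component is the sign: the difference is negative iff a borrow is left or the
  subtrahend has nonzero digits beyond the minuend. The digits are not trimmed, so they keep the
  length of \<open>xs\<close>, on which the size of the tables relies.\<close>

definition bits_sub :: "bool list \<Rightarrow> bool list \<Rightarrow> bool \<times> bool list" where
  "bits_sub xs ys = (let s = foldl sub_step (False, ys, []) xs in
     (fst s \<or> list_ex id (fst (snd s)), rev (snd (snd s))))"

lemma bits_val_head: "bits_val ys = of_bool (head_bit ys) + 2 * bits_val (tl ys)"
  by (cases ys) (auto simp: head_bit_def)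

text \<open>The invariant of schoolbook subtraction: the borrow and the unread digits of the
  subtrahend carry the weight of the next position.\<close>

lemma foldl_sub_step:
  "\<exists>b' ys' ds. foldl sub_step (b, ys, out) xs = (b', ys', rev ds @ out) \<and> length ds = length xs \<and>
     bits_val ds + bits_val ys + of_bool b = bits_val xs + 2 ^ length xs * (of_bool b' + bits_val ys')"
proof (induction xs arbitrary: b ys out)
  case (Cons x xs)
  let ?y = "head_bit ys"
  let ?b = "(\<not> x \<and> (?y \<or> b)) \<or> (?y \<and> b)" and ?d = "x \<noteq> (?y \<noteq> b)"
  obtain b' ys' ds where IH: "foldl sub_step (?b, tl ys, ?d # out) xs = (b', ys', rev ds @ ?d # out)"
    "length ds = length xs"
    "bits_val ds + bits_val (tl ys) + of_bool ?b = bits_val xs + 2 ^ length xs * (of_bool b' + bits_val ys')"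
    using Cons.IH by blast
  \<comment> \<open>The full subtractor at one position, checked over all bit values.\<close>
  have "of_bool ?d + of_bool ?y + of_bool b = (of_bool x + 2 * of_bool ?b :: nat)" by auto
  then have "bits_val (?d # ds) + bits_val ys + of_bool b =
      bits_val (x # xs) + 2 ^ length (x # xs) * (of_bool b' + bits_val ys')"
    using arg_cong[OF IH(3), of "\<lambda>n. 2 * n"] bits_val_head[of ys] by (simp add: algebra_simps)
  moreover have "sub_step (b, ys, out) x = (?b, tl ys, ?d # out)" by (simp add: sub_step_def)
  then have "foldl sub_step (b, ys, out) (x # xs) = (b', ys', rev (?d # ds) @ out)" using IH(1) by simp
  ultimately show ?case using IH(2) by (metis length_Cons)
qed simp

lemma bits_val_less: "bits_val bs < 2 ^ length bs"
  by (induction bs) auto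

lemma bits_sub:
  "length (snd (bits_sub xs ys)) = length xs"
  "fst (bits_sub xs ys) \<longleftrightarrow> bits_val xs < bits_val ys"
  "bits_val ys \<le> bits_val xs \<Longrightarrow> bits_val (snd (bits_sub xs ys)) = bits_val xs - bits_val ys"
proof -
  obtain b' ys' ds where f: "foldl sub_step (False, ys, []) xs = (b', ys', rev ds)" "length ds = length xs"
    "bits_val ds + bits_val ys = bits_val xs + 2 ^ length xs * (of_bool b' + bits_val ys')"
    using foldl_sub_step[of False ys "[]" xs] by auto
  have s: "bits_sub xs ys = (b' \<or> list_ex id ys', ds)" by (simp add: bits_sub_def f(1))
  show "length (snd (bits_sub xs ys)) = length xs" by (simp add: s f(2))
  have neg: "b' \<or> list_ex id ys' \<longleftrightarrow> of_bool b' + bits_val ys' \<noteq> (0::nat)"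
    using bits_val_eq_0_iff[of ys'] by auto
  have "fst (bits_sub xs ys) \<longleftrightarrow> bits_val xs < bits_val ys \<and>
      (bits_val ys \<le> bits_val xs \<longrightarrow> bits_val ds = bits_val xs - bits_val ys)"
  proof (cases "of_bool b' + bits_val ys' = (0::nat)")
    case True
    then show ?thesis using f(3) neg s by simp
  next
    case False
    then have "2 ^ length xs * 1 \<le> 2 ^ length xs * (of_bool b' + bits_val ys')"
      by (intro mult_le_mono) auto
    \<comment> \<open>The uncovered rest weighs at least \<open>2 ^ length ds\<close>, more than the
      digits \<open>ds\<close> can express; so the minuend is the smaller number.\<close>
    then have "2 ^ length ds + bits_val xs \<le> bits_val ds + bits_val ys" using f(2,3) by simp
    then have "bits_val xs < bits_val ys" using bits_val_less[of ds] by linarith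
    then show ?thesis using neg s False by simp
  qed
  moreover have "\<not> fst (bits_sub xs ys) \<Longrightarrow> bits_val ds = bits_val xs - bits_val ys \<and> bits_val ys \<le> bits_val xs"
    using f(3) neg s by (cases "of_bool b' + bits_val ys' = (0::nat)") auto
  ultimately show "fst (bits_sub xs ys) \<longleftrightarrow> bits_val xs < bits_val ys"
    and "bits_val ys \<le> bits_val xs \<Longrightarrow> bits_val (snd (bits_sub xs ys)) = bits_val xs - bits_val ys"
    by (auto simp: s)
qed

definition bits_le :: "bool list \<Rightarrow> bool list \<Rightarrow> bool" where
  "bits_le xs ys = (\<not> fst (bits_sub ys xs))"

lemma bits_le_iff: "bits_le xs ys \<longleftrightarrow> bits_val xs \<le> bits_val ys"
  by (auto simp: bits_le_def bits_sub)

section \<open>Dynamic program\<close>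

type_synonym counts = "nat \<times> nat \<times> nat"

definition add_counts :: "counts \<Rightarrow> counts \<Rightarrow> counts" where
  "add_counts k k' = (fst k + fst k', fst (snd k) + fst (snd k'), snd (snd k) + snd (snd k'))"

text \<open>A table assigns to reachable triples of counts the largest budget that can be left over.\<close>

type_synonym table = "(counts \<times> bool list) list"

text \<open>The flag is the sign reported by \<open>bits_sub\<close>: an option beyond the remaining
  budget is dropped.\<close>

definition insert_best :: "counts \<times> bool \<times> bool list \<Rightarrow> table \<Rightarrow> table" where
  "insert_best e T =
     (if fst (snd e) \<or> list_ex (\<lambda>f. fst f = fst e \<and> bits_le (snd (snd e)) (snd f)) T then T
      else (fst e, snd (snd e)) # filter (\<lambda>f. fst f \<noteq> fst e) T)"

definition extend :: "table \<Rightarrow> (counts \<times> bool list) list \<Rightarrow> table" where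
  "extend T os = foldr insert_best
     (concat (map (\<lambda>e. map (\<lambda>q. (add_counts (fst e) (fst q), bits_sub (snd e) (snd q))) os) T)) []"

text \<open>Equality would be too strong, because the table forgets smaller remainders: every entry
  has to be attained, and every attained pair dominated.\<close>

definition represents :: "table \<Rightarrow> (counts \<times> nat) set \<Rightarrow> bool" where
  "represents T R \<longleftrightarrow> (\<forall>(k, r) \<in> set T. (k, bits_val r) \<in> R) \<and>
     (\<forall>(k, v) \<in> R. \<exists>r. (k, r) \<in> set T \<and> v \<le> bits_val r)"

lemma insert_best_sound:
  "(k, r) \<in> set (foldr insert_best es []) \<Longrightarrow> (k, False, r) \<in> set es"
  by (induction es) (auto simp: insert_best_def split: if_splits)

text \<open>An entry leaves the table only in favour of a larger remainder for the same triple, and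
  a nonnegative new entry is refused only if it is dominated.\<close>

lemma insert_best_complete:
  "(k, False, r) \<in> set es \<Longrightarrow> \<exists>r'. (k, r') \<in> set (foldr insert_best es []) \<and> bits_val r \<le> bits_val r'"
proof (induction es)
  case (Cons e es)
  let ?T = "foldr insert_best es []"
  show ?case
  proof (cases "e = (k, False, r)")
    case True
    then show ?thesis by (auto simp: insert_best_def list_ex_iff bits_le_iff)
  next
    case False
    then obtain r' where r': "(k, r') \<in> set ?T" "bits_val r \<le> bits_val r'" using Cons by auto
    show ?thesis
    proof (cases "(k, r') \<in> set (insert_best e ?T)")
      case True
      then show ?thesis using r' by auto
    next
      case False
      then have "fst e = k" "insert_best e ?T = (fst e, snd (snd e)) # filter (\<lambda>f. fst f \<noteq> fst e) ?T"
        "\<not> bits_le (snd (snd e)) r'"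
        using r' by (auto simp: insert_best_def list_ex_iff split: if_splits)
      then show ?thesis using r'(2) by (auto simp: bits_le_iff)
    qed
  qed
qed simp

text \<open>Forgetting dominated remainders is safe: a larger remainder affords every option that a
  smaller one affords and leaves at least as much.\<close>

lemma represents_extend:
  assumes "represents T R"
  shows "represents (extend T os)
    {(add_counts k (fst q), v - bits_val (snd q)) | k v q. (k, v) \<in> R \<and> q \<in> set os \<and> bits_val (snd q) \<le> v}"
    (is "represents _ ?R")
  unfolding represents_def
proof (intro conjI ballI, goal_cases)
  case (1 e)
  obtain k r where e: "e = (k, r)" by (cases e)
  from insert_best_sound[OF 1[unfolded e extend_def]] obtain f q
    where fq: "f \<in> set T" "q \<in> set os" "k = add_counts (fst f) (fst q)" "bits_sub (snd f) (snd q) = (False, r)"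
    by auto
  have le: "bits_val (snd q) \<le> bits_val (snd f)" using bits_sub(2)[of "snd f" "snd q"] fq(4) by simp
  have "bits_val r = bits_val (snd f) - bits_val (snd q)" using bits_sub(3)[OF le] fq(4) by simp
  moreover have "(fst f, bits_val (snd f)) \<in> R" using assms fq(1) by (auto simp: represents_def)
  ultimately show ?case unfolding e using fq le
    by (intro CollectI case_prodI exI[of _ "fst f"] exI[of _ "bits_val (snd f)"] exI[of _ q]) auto
next
  case (2 e)
  then obtain k v q where e: "e = (add_counts k (fst q), v - bits_val (snd q))" "(k, v) \<in> R" "q \<in> set os"
    "bits_val (snd q) \<le> v" by auto
  then obtain r where r: "(k, r) \<in> set T" "v \<le> bits_val r" using assms by (auto simp: represents_def)
  let ?s = "bits_sub r (snd q)"
  have le: "bits_val (snd q) \<le> bits_val r" using e r by simp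
  have s: "?s = (False, snd ?s)" "bits_val (snd ?s) = bits_val r - bits_val (snd q)"
    using bits_sub(2)[of r "snd q"] bits_sub(3)[OF le] le by (auto simp: prod_eq_iff)
  let ?F = "\<lambda>e. map (\<lambda>q. (add_counts (fst e) (fst q), bits_sub (snd e) (snd q))) os"
  let ?es = "concat (map ?F T)"
  have "(add_counts k (fst q), ?s) \<in> set (?F (k, r))"
    using imageI[OF e(3), of "\<lambda>q. (add_counts k (fst q), bits_sub r (snd q))"] by simp
  moreover have "?F (k, r) \<in> set (map ?F T)" unfolding set_map using r(1) by (rule imageI)
  ultimately have "(add_counts k (fst q), ?s) \<in> set ?es" unfolding set_concat by (rule UnionI[OF imageI, rotated])
  then have "(add_counts k (fst q), False, snd ?s) \<in> set ?es" using s(1) by simp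
  from insert_best_complete[OF this] obtain r' where
    "(add_counts k (fst q), r') \<in> set (extend T os)" "bits_val (snd ?s) \<le> bits_val r'"
    unfolding extend_def by blast
  moreover have "v - bits_val (snd q) \<le> bits_val (snd ?s)" using s(2) r(2) by simp
  ultimately show ?case unfolding e(1) by (intro case_prodI exI[of _ r']) simp
qed

text \<open>Distinct triples in a cube allow at most \<open>(n + 1) ^ 3\<close> entries, all of them
  short. In the application, \<open>n\<close> is the number of voters processed and \<open>m\<close>
  the number of digits of the budget.\<close>

definition table_bound :: "nat \<Rightarrow> nat \<Rightarrow> table \<Rightarrow> bool" where
  "table_bound n m T \<longleftrightarrow> distinct (map fst T) \<and>
     (\<forall>e\<in>set T. fst e \<in> {..n} \<times> {..n} \<times> {..n} \<and> length (snd e) = m)"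

lemma distinct_insert_best: "distinct (map fst (foldr insert_best es []))"
proof (induction es)
  case (Cons e es)
  then show ?case by (auto simp: insert_best_def distinct_map_filter)
qed simp

lemma table_bound_extend:
  assumes "table_bound n m T" "\<forall>q\<in>set os. fst q \<in> {..1} \<times> {..1} \<times> {..1}"
  shows "table_bound (Suc n) m (extend T os)"
  unfolding table_bound_def
proof (intro conjI ballI)
  show "distinct (map fst (extend T os))" unfolding extend_def by (rule distinct_insert_best)
  fix e assume "e \<in> set (extend T os)"
  then have "(fst e, False, snd e) \<in> set (concat (map (\<lambda>e. map (\<lambda>q. (add_counts (fst e) (fst q), bits_sub (snd e) (snd q))) os) T))"
    unfolding extend_def by (intro insert_best_sound) simp
  then obtain f q where fq: "f \<in> set T" "q \<in> set os" "fst e = add_counts (fst f) (fst q)"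
      "bits_sub (snd f) (snd q) = (False, snd e)" by force
  have "length (snd e) = length (snd f)" using bits_sub(1)[of "snd f" "snd q"] fq(4) by simp
  then show "fst e \<in> {..Suc n} \<times> {..Suc n} \<times> {..Suc n}" "length (snd e) = m"
    using assms fq by (fastforce simp: table_bound_def add_counts_def mem_Times_iff)+
qed

text \<open>For a voter \<open>r\<close> who shifts \<open>d\<close> back by \<open>t\<close>: whether \<open>d\<close> is among the top \<open>l - 1\<close>, whether
  \<open>d\<close> is among the top \<open>l\<close>, and whether \<open>c\<close> is among the top \<open>l\<close> (\<open>c\<close> moves
  up by one place if \<open>d\<close> passes it).\<close>

definition option_counts :: "'a \<Rightarrow> 'a \<Rightarrow> nat \<Rightarrow> 'a list \<Rightarrow> nat \<Rightarrow> counts" where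
  "option_counts d c l r t =
     (if pos r d + t < l then 1 else 0, if pos r d + t \<le> l then 1 else 0,
      if pos r c \<le> l \<or> (pos r c = Suc l \<and> pos r d < pos r c \<and> pos r c \<le> pos r d + t) then 1 else 0)"

text \<open>Shifts beyond the listed prices cost infinitely much and are no options.\<close>

definition options_of :: "'a \<Rightarrow> 'a \<Rightarrow> nat \<Rightarrow> 'a list \<times> bool list list \<Rightarrow> (counts \<times> bool list) list" where
  "options_of d c l v = map (\<lambda>q. (option_counts d c l (fst v) (fst q), snd q)) (zip [0..<length (snd v)] (snd v))"

definition final_table :: "'a \<Rightarrow> 'a \<Rightarrow> nat \<Rightarrow> ('a list \<times> bool list list) list \<Rightarrow> bool list \<Rightarrow> table" where
  "final_table d c l vs B = foldl (\<lambda>T v. extend T (options_of d c l v)) [((0, 0, 0), B)] vs"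

text \<open>The conditions of \<open>bucklin_not_unique_iff\<close> in terms of the three counters.
  Doubling is written as a sum because the closure rules provide addition.\<close>

definition winning :: "nat \<Rightarrow> counts \<Rightarrow> bool" where
  "winning n k \<longleftrightarrow> fst k + fst k \<le> n \<and> n < snd (snd k) + snd (snd k) \<and> fst (snd k) \<le> snd (snd k)"

text \<open>Without voters every candidate wins, so the question is whether a second candidate
  exists; the criterion by rounds presupposes a voter.\<close>

definition bribable :: "'a list \<Rightarrow> 'a list list \<Rightarrow> 'a \<Rightarrow> bool list \<Rightarrow> bool list list list \<Rightarrow> bool" where
  "bribable C V d B P \<longleftrightarrow> (if length V = 0 then list_ex (\<lambda>c. c \<noteq> d) C
     else list_ex (\<lambda>c. c \<noteq> d \<and> list_ex (\<lambda>l. list_ex (\<lambda>e. winning (length V) (fst e))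
       (final_table d c l (zip V P) B)) [0..<Suc (length C)]) C)"

section \<open>Correctness of the dynamic program\<close>

definition total_counts :: "'a \<Rightarrow> 'a \<Rightarrow> nat \<Rightarrow> ('a list \<times> bool list list) list \<Rightarrow> nat \<Rightarrow> (nat \<Rightarrow> nat) \<Rightarrow> counts" where
  "total_counts d c l vs n t =
     (\<Sum>i<n. fst (option_counts d c l (fst (vs ! i)) (t i)),
      \<Sum>i<n. fst (snd (option_counts d c l (fst (vs ! i)) (t i))),
      \<Sum>i<n. snd (snd (option_counts d c l (fst (vs ! i)) (t i))))"

definition total_cost :: "('a list \<times> bool list list) list \<Rightarrow> nat \<Rightarrow> (nat \<Rightarrow> nat) \<Rightarrow> nat" where
  "total_cost vs n t = (\<Sum>i<n. bits_val (snd (vs ! i) ! t i))"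

definition outcomes :: "'a \<Rightarrow> 'a \<Rightarrow> nat \<Rightarrow> ('a list \<times> bool list list) list \<Rightarrow> nat \<Rightarrow> nat \<Rightarrow> (counts \<times> nat) set" where
  "outcomes d c l vs b n = {(total_counts d c l vs n t, b - total_cost vs n t) | t.
     (\<forall>i<n. t i < length (snd (vs ! i))) \<and> total_cost vs n t \<le> b}"

lemma total_cong:
  "(\<And>i. i < n \<Longrightarrow> t i = t' i) \<Longrightarrow> total_counts d c l vs n t = total_counts d c l vs n t'"
  "(\<And>i. i < n \<Longrightarrow> t i = t' i) \<Longrightarrow> total_cost vs n t = total_cost vs n t'"
  by (auto simp: total_counts_def total_cost_def intro!: sum.cong)

lemma total_Suc:
  "total_counts d c l vs (Suc n) t = add_counts (total_counts d c l vs n t) (option_counts d c l (fst (vs ! n)) (t n))"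
  "total_cost vs (Suc n) t = total_cost vs n t + bits_val (snd (vs ! n) ! t n)"
  by (auto simp: total_counts_def total_cost_def add_counts_def)

lemma set_options_of:
  "q \<in> set (options_of d c l v) \<longleftrightarrow> (\<exists>s<length (snd v). q = (option_counts d c l (fst v) s, snd v ! s))"
  by (auto simp: options_of_def set_zip image_iff) force+

text \<open>The right-hand side has the shape of the set in \<open>represents_extend\<close>, so the
  table follows the outcomes voter by voter.\<close>

lemma outcomes_Suc:
  "outcomes d c l vs b (Suc n) = {(add_counts k (fst q), v - bits_val (snd q)) | k v q.
     (k, v) \<in> outcomes d c l vs b n \<and> q \<in> set (options_of d c l (vs ! n)) \<and> bits_val (snd q) \<le> v}"
    (is "?L = ?R")
proof
  show "?L \<subseteq> ?R"
  proof
    fix x assume "x \<in> ?L"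
    then obtain t where t: "x = (total_counts d c l vs (Suc n) t, b - total_cost vs (Suc n) t)"
      "\<forall>i<Suc n. t i < length (snd (vs ! i))" "total_cost vs (Suc n) t \<le> b"
      by (auto simp: outcomes_def)
    let ?q = "(option_counts d c l (fst (vs ! n)) (t n), snd (vs ! n) ! t n)"
    have "(total_counts d c l vs n t, b - total_cost vs n t) \<in> outcomes d c l vs b n"
      using t by (auto simp: outcomes_def total_Suc)
    moreover have "?q \<in> set (options_of d c l (vs ! n))" using t by (auto simp: set_options_of)
    moreover have "bits_val (snd ?q) \<le> b - total_cost vs n t" using t by (simp add: total_Suc)
    ultimately show "x \<in> ?R" unfolding t(1)
      by (intro CollectI exI[of _ "total_counts d c l vs n t"] exI[of _ "b - total_cost vs n t"] exI[of _ ?q])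
        (simp add: total_Suc)
  qed
  show "?R \<subseteq> ?L"
  proof
    fix x assume "x \<in> ?R"
    then obtain k v q where x: "x = (add_counts k (fst q), v - bits_val (snd q))" "(k, v) \<in> outcomes d c l vs b n"
      "q \<in> set (options_of d c l (vs ! n))" "bits_val (snd q) \<le> v" by blast
    then obtain s where s: "s < length (snd (vs ! n))" "q = (option_counts d c l (fst (vs ! n)) s, snd (vs ! n) ! s)"
      by (auto simp: set_options_of)
    obtain t where t: "k = total_counts d c l vs n t" "v = b - total_cost vs n t"
      "\<forall>i<n. t i < length (snd (vs ! i))" "total_cost vs n t \<le> b"
      using x(2) by (auto simp: outcomes_def)
    let ?t = "t(n := s)"
    have "total_counts d c l vs n ?t = total_counts d c l vs n t" "total_cost vs n ?t = total_cost vs n t"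
      by (auto intro!: total_cong)
    then have "x = (total_counts d c l vs (Suc n) ?t, b - total_cost vs (Suc n) ?t)" "total_cost vs (Suc n) ?t \<le> b"
      using x t s by (simp_all add: total_Suc)
    moreover have "\<forall>i<Suc n. ?t i < length (snd (vs ! i))" using t s by (simp add: less_Suc_eq)
    ultimately show "x \<in> ?L" unfolding outcomes_def by blast
  qed
qed

lemma represents_final_table:
  "represents (final_table d c l vs B) (outcomes d c l vs (bits_val B) (length vs))"
proof -
  have "represents (final_table d c l (take n vs) B) (outcomes d c l vs (bits_val B) n)" if "n \<le> length vs" for n
    using that
  proof (induction n)
    case 0
    then show ?case
      by (auto simp: represents_def final_table_def outcomes_def total_counts_def total_cost_def)
  next
    case (Suc n)
    then have "final_table d c l (take (Suc n) vs) B = extend (final_table d c l (take n vs) B) (options_of d c l (vs ! n))"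
      by (simp add: final_table_def take_Suc_conv_app_nth)
    then show ?case using represents_extend[OF Suc.IH] Suc.prems by (simp add: outcomes_Suc)
  qed
  from this[of "length vs"] show ?thesis by simp
qed

lemma list_ex_winning_iff:
  "list_ex (\<lambda>e. winning m (fst e)) (final_table d c l vs B) \<longleftrightarrow>
    (\<exists>t. (\<forall>i<length vs. t i < length (snd (vs ! i))) \<and> total_cost vs (length vs) t \<le> bits_val B \<and>
      winning m (total_counts d c l vs (length vs) t))" (is "?L \<longleftrightarrow> ?R")
proof
  note r = represents_final_table[of d c l vs B, unfolded represents_def]
  show "?L \<Longrightarrow> ?R"
  proof -
    assume ?L
    then obtain k v where "(k, v) \<in> set (final_table d c l vs B)" "winning m k" by (auto simp: list_ex_iff)
    then have "(k, bits_val v) \<in> outcomes d c l vs (bits_val B) (length vs)" using r by auto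
    then show ?R using \<open>winning m k\<close> unfolding outcomes_def by blast
  qed
  show "?R \<Longrightarrow> ?L"
  proof -
    assume ?R
    then obtain t where "(total_counts d c l vs (length vs) t, bits_val B - total_cost vs (length vs) t)
        \<in> outcomes d c l vs (bits_val B) (length vs)" "winning m (total_counts d c l vs (length vs) t)"
      unfolding outcomes_def by blast
    moreover from this(1) r obtain v where
      "(total_counts d c l vs (length vs) t, v) \<in> set (final_table d c l vs B)" by blast
    ultimately show ?L unfolding list_ex_iff by (metis fst_conv)
  qed
qed

section \<open>From tables to bribery\<close>

definition price_fun :: "bool list list \<Rightarrow> nat \<Rightarrow> enat" where
  "price_fun pl i = (if i < length pl then enat (bits_val (pl ! i)) else \<infinity>)"

lemma sum_price_fun:
  fixes n :: nat
  shows "(\<Sum>i<n. price_fun (f i) (t i)) =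
    (if \<forall>i<n. t i < length (f i) then enat (\<Sum>i<n. bits_val (f i ! t i)) else \<infinity>)"
  by (induction n) (auto simp: price_fun_def zero_enat_def less_Suc_eq)

lemma length_filter_upt: "length (filter Q (map f [0..<n])) = (\<Sum>i<n. if Q (f i) then 1 else 0)"
  by (induction n) auto

text \<open>By \<open>len\<close>, a shift of finite price never moves \<open>d\<close> beyond the
  last place. So the new position of \<open>d\<close> is the old one plus the shift, and the
  counters are the true scores after the bribe. A shift of infinite price exceeds every
  budget.\<close>

lemma bribable_iff:
  assumes C: "distinct C" and E: "is_election (set C, V)" and d: "d \<in> set C" and P: "length P = length V"
    and len: "\<And>i. i < length V \<Longrightarrow> length (P ! i) + pos (V ! i) d \<le> Suc (length C)"
  shows "bribable C V d B P \<longleftrightarrow> (\<exists>t. (\<Sum>i<length V. price_fun (P ! i) (t i)) \<le> enat (bits_val B) \<and>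
     bucklin (set C, map (\<lambda>i. shift_back d (t i) (V ! i)) [0..<length V]) \<noteq> {d})"
proof (cases "V = []")
  case True
  have "bucklin (set C, []) = set C"
    by (auto simp: bucklin_def bucklin_score_def approval_score_def)
  then show ?thesis using True d by (auto simp: bribable_def list_ex_iff zero_enat_def)
next
  case False
  let ?n = "length V" and ?W = "\<lambda>t. map (\<lambda>i. shift_back d (t i) (V ! i)) [0..<length V]"
  let ?ok = "\<lambda>t. (\<forall>i<?n. t i < length (P ! i)) \<and> (\<Sum>i<?n. bits_val (P ! i ! t i)) \<le> bits_val B"
  have vote: "distinct (V ! i)" "set (V ! i) = set C" "length (V ! i) = length C" if "i < ?n" for i
  proof -
    show v: "distinct (V ! i)" "set (V ! i) = set C" using E nth_mem[OF that] by (auto simp: is_election_def)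
    show "length (V ! i) = length C" using distinct_card[OF C] distinct_card[OF v(1)] v(2) by simp
  qed
  have counts: "winning ?n (total_counts d c l (zip V P) ?n t) \<longleftrightarrow>
     2 * length (filter (\<lambda>r. pos r d < l) (?W t)) \<le> length (?W t) \<and>
     length (?W t) < 2 * approval_score (?W t) l c \<and> approval_score (?W t) l d \<le> approval_score (?W t) l c"
    if t: "\<forall>i<?n. t i < length (P ! i)" and c: "c \<in> set C" "c \<noteq> d" for c l t
  proof -
    have pd: "pos (shift_back d (t i) (V ! i)) d = pos (V ! i) d + t i" if "i < ?n" for i
      using vote[OF that] len[OF that] t that d by (intro pos_shift_back) auto
    \<comment> \<open>A passed candidate gains one place, so it enters the top \<open>l\<close> only
      from position \<open>l + 1\<close>.\<close>
    have pc: "pos (shift_back d (t i) (V ! i)) c \<le> l \<longleftrightarrow> pos (V ! i) c \<le> l \<or>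
        (pos (V ! i) c = Suc l \<and> pos (V ! i) d < pos (V ! i) c \<and> pos (V ! i) c \<le> pos (V ! i) d + t i)"
      if "i < ?n" for i
      using vote[OF that] c d by (subst pos_shift_back_other) auto
    have "total_counts d c l (zip V P) ?n t = (length (filter (\<lambda>r. pos r d < l) (?W t)),
        approval_score (?W t) l d, approval_score (?W t) l c)"
      unfolding total_counts_def approval_score_def length_filter_upt
      by (auto simp: P pd pc option_counts_def intro!: sum.cong)
    then show ?thesis by (simp add: winning_def mult_2)
  qed
  have election: "is_election (set C, ?W t)" for t
    using vote d by (auto simp: is_election_def distinct_shift_back set_shift_back)
  have unique: "bucklin (set C, ?W t) \<noteq> {d} \<longleftrightarrow>
      (\<exists>c\<in>set C. c \<noteq> d \<and> (\<exists>l\<le>length C. winning ?n (total_counts d c l (zip V P) ?n t)))"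
    if "\<forall>i<?n. t i < length (P ! i)" for t
    using bucklin_not_unique_iff[OF election d, of t] counts[OF that] False
    by (simp add: distinct_card[OF C] cong: conj_cong bex_cong)
  have upt_ex: "list_ex Q [0..<Suc n] \<longleftrightarrow> (\<exists>l\<le>n. Q l)" for Q n
    by (auto simp: list_ex_iff less_Suc_eq_le simp del: upt_Suc)
  have "bribable C V d B P \<longleftrightarrow> (\<exists>c\<in>set C. c \<noteq> d \<and> (\<exists>l\<le>length C. \<exists>t. ?ok t \<and>
      winning ?n (total_counts d c l (zip V P) ?n t)))"
    using False P unfolding bribable_def list_ex_winning_iff upt_ex
    by (simp add: list_ex_iff total_cost_def Bex_def cong: conj_cong)
  \<comment> \<open>The program fixes \<open>c\<close> and \<open>l\<close> before the shifts, the
    problem chooses the shifts first; existential quantifiers commute.\<close>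
  also have "\<dots> \<longleftrightarrow> (\<exists>t. ?ok t \<and> bucklin (set C, ?W t) \<noteq> {d})"
    using unique by blast
  also have "\<dots> \<longleftrightarrow> (\<exists>t. (\<Sum>i<?n. price_fun (P ! i) (t i)) \<le> enat (bits_val B) \<and> bucklin (set C, ?W t) \<noteq> {d})"
    unfolding sum_price_fun by auto
  finally show ?thesis .
qed

section \<open>Invariance under renaming of candidates\<close>

lemma pos_map: "inj_on f A \<Longrightarrow> set r \<subseteq> A \<Longrightarrow> c \<in> A \<Longrightarrow> pos (map f r) (f c) = pos r c"
proof (induction r)
  case (Cons x r)
  then have "f x = f c \<longleftrightarrow> x = c" by (auto dest: inj_onD)
  then show ?case using Cons by (simp add: pos_Cons)
qed (simp add: pos_def)

lemma final_table_map:
  assumes "inj_on f A" "d \<in> A" "c \<in> A" "\<forall>v\<in>set vs. set (fst v) \<subseteq> A"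
  shows "final_table (f d) (f c) l (map (\<lambda>v. (map f (fst v), snd v)) vs) B = final_table d c l vs B"
proof -
  have "options_of (f d) (f c) l (map f (fst v), snd v) = options_of d c l v" if "v \<in> set vs" for v
    using that assms by (simp add: options_of_def option_counts_def pos_map)
  then show ?thesis unfolding final_table_def foldl_map by (intro foldl_cong) auto
qed

text \<open>Names are only compared with each other, so an injective renaming changes nothing. This
  permits running the program on digit lists instead of the numbers that they denote.\<close>

lemma bribable_map:
  assumes f: "inj_on f A" and A: "set C \<subseteq> A" "d \<in> A" "\<forall>r\<in>set V. set r \<subseteq> A"
  shows "bribable (map f C) (map (map f) V) (f d) B P \<longleftrightarrow> bribable C V d B P"
proof -
  have zip: "zip (map (map f) V) P = map (\<lambda>v. (map f (fst v), snd v)) (zip V P)"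
    by (simp add: zip_map1 split_def)
  have "\<forall>v\<in>set (zip V P). set (fst v) \<subseteq> A" using A(3) by (fastforce dest: set_zip_leftD)
  then have "final_table (f d) (f c) l (zip (map (map f) V) P) B = final_table d c l (zip V P) B"
    if "c \<in> set C" for c l
    unfolding zip using A that by (intro final_table_map[OF f]) auto
  moreover have "f c = f d \<longleftrightarrow> c = d" if "c \<in> set C" for c
    using f A that by (auto dest: inj_onD)
  ultimately show ?thesis
    by (simp add: bribable_def list_ex_iff cong: bex_cong conj_cong del: upt_Suc)
qed

section \<open>Instances\<close>

text \<open>The components follow the order in \<open>enc_instance\<close>, with numbers replaced by
  digit lists and price functions by the lists of their finite values.\<close>

type_synonym raw = "bool list list \<times> bool list list list \<times> bool list \<times> bool list \<times> bool list list list"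

definition all_canonical :: "raw \<Rightarrow> bool" where
  "all_canonical x \<longleftrightarrow> list_all canonical (fst x) \<and> list_all (list_all canonical) (fst (snd x)) \<and>
     canonical (fst (snd (snd x))) \<and> canonical (fst (snd (snd (snd x)))) \<and>
     list_all (list_all canonical) (snd (snd (snd (snd x))))"

definition no_repetition :: "'a list \<Rightarrow> bool" where
  "no_repetition xs \<longleftrightarrow> list_all (\<lambda>e. length (filter (\<lambda>y. y = e) xs) \<le> 1) xs"

definition included :: "'a list \<Rightarrow> 'a list \<Rightarrow> bool" where
  "included xs ys \<longleftrightarrow> list_all (\<lambda>e. list_ex (\<lambda>y. y = e) ys) xs"

text \<open>The canonical digit list of zero is empty, whence \<open>p = []\<close>. Comparing
  neighbours suffices for monotonicity. The length condition, stated without subtraction, says that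
  no price is finite beyond \<open>m - j\<close>; the list may be shorter, since prices may become
  infinite earlier.\<close>

definition prices_ok :: "nat \<Rightarrow> nat \<Rightarrow> bool list list \<Rightarrow> bool" where
  "prices_ok m j pl = (case pl of [] \<Rightarrow> False
     | p # ps \<Rightarrow> p = [] \<and> list_all (\<lambda>q. bits_le (fst q) (snd q)) (zip pl ps) \<and> length pl + j \<le> Suc m)"

definition well_formed :: "'a list \<Rightarrow> 'a list list \<Rightarrow> 'a \<Rightarrow> bool list list list \<Rightarrow> bool" where
  "well_formed C V d P \<longleftrightarrow> no_repetition C \<and>
     list_all (\<lambda>r. no_repetition r \<and> included r C \<and> included C r) V \<and>
     included [d] C \<and> length P = length V \<and>
     list_all (\<lambda>v. prices_ok (length C) (pos (fst v) d) (snd v)) (zip V P)"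

definition good :: "raw \<Rightarrow> bool" where
  "good x \<longleftrightarrow> all_canonical x \<and>
     well_formed (fst x) (fst (snd x)) (fst (snd (snd x))) (snd (snd (snd (snd x)))) \<and>
     bribable (fst x) (fst (snd x)) (fst (snd (snd x))) (fst (snd (snd (snd x)))) (snd (snd (snd (snd x))))"

definition inst :: "raw \<Rightarrow> dsb_instance" where
  "inst x = \<lparr>candidates = map bits_val (fst x), votes = map (map bits_val) (fst (snd x)),
     despised = bits_val (fst (snd (snd x))), budget = bits_val (fst (snd (snd (snd x)))),
     prices = map price_fun (snd (snd (snd (snd x))))\<rparr>"

lemma no_repetition_iff: "no_repetition xs \<longleftrightarrow> distinct xs"
proof -
  have "length (filter (\<lambda>y. y = e) xs) = count_list xs e" for e
    by (induction xs) auto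
  then have "no_repetition xs \<longleftrightarrow> (\<forall>e\<in>set xs. count_list xs e \<le> 1)"
    by (simp add: no_repetition_def list_all_iff)
  also have "\<dots> \<longleftrightarrow> distinct xs"
  proof (induction xs)
    case (Cons x xs)
    have "(\<forall>e\<in>set (x # xs). count_list (x # xs) e \<le> 1) \<longleftrightarrow> x \<notin> set xs \<and> (\<forall>e\<in>set xs. count_list xs e \<le> 1)"
      by (auto simp: count_list_0_iff)
    then show ?case using Cons by simp
  qed simp
  finally show ?thesis .
qed

lemma included_iff: "included xs ys \<longleftrightarrow> set xs \<subseteq> set ys"
  by (auto simp: included_def list_all_iff list_ex_iff)

lemma canonical_eq_0_iff: "canonical p \<Longrightarrow> bits_val p = 0 \<longleftrightarrow> p = []"
  using binary_bits_val[of p] by (auto simp: binary.simps)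

lemma prices_ok_iff:
  assumes c: "list_all canonical pl" and j: "1 \<le> j" "j \<le> m"
  shows "is_price_function m j (price_fun pl) \<longleftrightarrow> prices_ok m j pl"
proof (cases pl)
  case Nil
  then show ?thesis by (simp add: is_price_function_def prices_ok_def price_fun_def)
next
  case (Cons p ps)
  have adj: "list_all (\<lambda>q. bits_le (fst q) (snd q)) (zip pl ps) \<longleftrightarrow>
      (\<forall>i. Suc i < length pl \<longrightarrow> bits_val (pl ! i) \<le> bits_val (pl ! Suc i))"
    using Cons by (auto simp: list_all_length bits_le_iff)
  have sorted: "\<dots> \<longleftrightarrow> (\<forall>i i'. i \<le> i' \<and> i' < length pl \<longrightarrow> bits_val (pl ! i) \<le> bits_val (pl ! i'))"
    using sorted_iff_nth_Suc[of "map bits_val pl"] sorted_iff_nth_mono[of "map bits_val pl"] by auto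
  have zero: "price_fun pl 0 = 0 \<longleftrightarrow> p = []"
    using Cons c by (simp add: price_fun_def zero_enat_def canonical_eq_0_iff)
  have inf: "(\<forall>i > m - j. price_fun pl i = \<infinity>) \<longleftrightarrow> length pl + j \<le> Suc m"
  proof
    assume a: "\<forall>i > m - j. price_fun pl i = \<infinity>"
    show "length pl + j \<le> Suc m"
    proof (rule ccontr)
      assume n: "\<not> length pl + j \<le> Suc m"
      \<comment> \<open>\<open>length pl - 1\<close> is the last argument with a finite
        price.\<close>
      then have "length pl - 1 > m - j" using j by simp
      then have "price_fun pl (length pl - 1) = \<infinity>" using a by blast
      then show False using Cons by (simp add: price_fun_def)
    qed
  qed (use j in \<open>auto simp: price_fun_def\<close>)
  have mono: "(\<forall>i i'. i < i' \<and> i' \<le> m - j \<longrightarrow> price_fun pl i \<le> price_fun pl i') \<longleftrightarrow>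
      (\<forall>i i'. i \<le> i' \<and> i' < length pl \<longrightarrow> bits_val (pl ! i) \<le> bits_val (pl ! i'))"
    if "length pl + j \<le> Suc m"
  proof -
    have le: "price_fun pl i \<le> price_fun pl i' \<longleftrightarrow> (i' < length pl \<longrightarrow> bits_val (pl ! i) \<le> bits_val (pl ! i'))"
      if "i < i'" for i i' using that by (auto simp: price_fun_def)
    have "i' < length pl \<Longrightarrow> i' \<le> m - j" for i' using that j by simp
    then show ?thesis using le by (metis le_eq_less_or_eq)
  qed
  show ?thesis
    unfolding is_price_function_def zero inf using mono adj sorted Cons by (auto simp: prices_ok_def)
qed

lemma inj_on_bits_val: "inj_on bits_val {p. canonical p}"
  by (metis binary_bits_val inj_onI mem_Collect_eq)

text \<open>\<open>bits_val\<close> is injective on canonical lists, so distinctness, sets of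
  candidates and positions can be checked on the digits.\<close>

lemma valid_inst_iff:
  assumes "all_canonical (C, V, d, B, P)"
  shows "valid_instance (inst (C, V, d, B, P)) \<longleftrightarrow> well_formed C V d P"
proof -
  let ?A = "{p. canonical p}"
  note inj = inj_on_bits_val
  have A: "set C \<subseteq> ?A" "d \<in> ?A" "\<And>r. r \<in> set V \<Longrightarrow> set r \<subseteq> ?A" "\<And>pl. pl \<in> set P \<Longrightarrow> list_all canonical pl"
    using assms by (auto simp: all_canonical_def list_all_iff)
  have dist: "distinct (map bits_val r) \<longleftrightarrow> distinct r" if "set r \<subseteq> ?A" for r
    using inj_on_subset[OF inj that] by (simp add: distinct_map)
  have 1: "(\<forall>r\<in>set (map (map bits_val) V). distinct r \<and> set r = set (map bits_val C)) \<longleftrightarrow>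
     (\<forall>r\<in>set V. distinct r \<and> set r = set C)"
    using dist A inj_on_image_eq_iff[OF inj] by (metis (no_types, lifting) list.set_map image_iff)
  have 2: "bits_val d \<in> set (map bits_val C) \<longleftrightarrow> d \<in> set C"
    using inj_on_image_mem_iff[OF inj A(2) A(1)] by simp
  have 3: "is_price_function (length C) (pos (map bits_val (V ! i)) (bits_val d)) (price_fun (P ! i)) \<longleftrightarrow>
      prices_ok (length C) (pos (V ! i) d) (P ! i)"
    if "i < length V" "length P = length V" "distinct C" "d \<in> set C" "distinct (V ! i)" "set (V ! i) = set C" for i
  proof -
    have "pos (map bits_val (V ! i)) (bits_val d) = pos (V ! i) d"
      using that A by (intro pos_map[OF inj]) auto
    moreover have "pos (V ! i) d \<le> length C"
      using pos_le_length[of d "V ! i"] that distinct_card[of C] distinct_card[of "V ! i"] by simp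
    ultimately show ?thesis using prices_ok_iff[OF A(4)[OF nth_mem], of i "pos (V ! i) d" "length C"] that pos_ge_1[of "V ! i" d] by simp
  qed
  have "valid_instance (inst (C, V, d, B, P)) \<longleftrightarrow> distinct C \<and> (\<forall>r\<in>set V. distinct r \<and> set r = set C) \<and>
     d \<in> set C \<and> length P = length V \<and>
     (\<forall>i<length V. is_price_function (length C) (pos (map bits_val (V ! i)) (bits_val d)) (price_fun (P ! i)))"
    unfolding valid_instance_def is_election_def inst_def
    using 1 2 dist[OF A(1)] by auto
  also have "\<dots> \<longleftrightarrow> distinct C \<and> (\<forall>r\<in>set V. distinct r \<and> set r = set C) \<and> d \<in> set C \<and> length P = length V \<and>
     (\<forall>i<length V. prices_ok (length C) (pos (V ! i) d) (P ! i))"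
    using 3 nth_mem by (auto cong: conj_cong)
  also have "\<dots> \<longleftrightarrow> well_formed C V d P"
    unfolding well_formed_def no_repetition_iff included_iff
    by (auto simp: list_all_length[of _ "zip V P"]) (auto simp: list_all_iff)
  finally show ?thesis .
qed

text \<open>Renaming by \<open>bits_val\<close> passes from digits to numbers, and the length test
  in \<open>prices_ok\<close> supplies what \<open>bribable_iff\<close> demands of the price
  lists.\<close>

lemma yes_inst_iff:
  assumes can: "all_canonical (C, V, d, B, P)" and wf: "well_formed C V d P"
  shows "yes_instance bucklin (inst (C, V, d, B, P)) \<longleftrightarrow> bribable C V d B P"
proof -
  let ?f = "bits_val" and ?A = "{p. canonical p}"
  have A: "set C \<subseteq> ?A" "d \<in> ?A" "\<forall>r\<in>set V. set r \<subseteq> ?A"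
    using can by (auto simp: all_canonical_def list_all_iff)
  have v: "valid_instance (inst (C, V, d, B, P))" using valid_inst_iff[OF can] wf by simp
  have len: "length (P ! i) + pos (map (map ?f) V ! i) (?f d) \<le> Suc (length (map ?f C))"
    if "i < length (map (map ?f) V)" for i
  proof -
    have "(V ! i, P ! i) \<in> set (zip V P)" using that wf by (auto simp: well_formed_def set_zip)
    then have "prices_ok (length C) (pos (V ! i) d) (P ! i)" using wf by (auto simp: well_formed_def list_all_iff)
    moreover have "pos (map (map ?f) V ! i) (?f d) = pos (V ! i) d"
      using pos_map[OF inj_on_bits_val] A that by (metis length_map nth_map nth_mem)
    ultimately show ?thesis by (auto simp: prices_ok_def split: list.splits)
  qed
  have "bribable C V d B P \<longleftrightarrow> bribable (map ?f C) (map (map ?f) V) (?f d) B P"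
    using bribable_map[OF inj_on_bits_val A] by simp
  also have "\<dots> \<longleftrightarrow> yes_instance bucklin (inst (C, V, d, B, P))"
    using v wf by (subst bribable_iff[OF _ _ _ _ len])
      (auto simp: valid_instance_def inst_def yes_instance_def well_formed_def)
  finally show ?thesis by simp
qed

lemma good_iff: "good x \<longleftrightarrow> all_canonical x \<and> valid_instance (inst x) \<and> yes_instance bucklin (inst x)"
  using valid_inst_iff yes_inst_iff by (cases x) (auto simp: good_def)

section \<open>Agreement of the two encodings\<close>

lemma finite_prices_price_fun: "finite_prices (price_fun pl) = map bits_val pl"
proof -
  have "{i. price_fun pl i \<noteq> \<infinity>} = {0..<length pl}" by (auto simp: price_fun_def split: if_splits)
  then have "finite_prices (price_fun pl) = map (\<lambda>i. the_enat (price_fun pl i)) [0..<length pl]"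
    unfolding finite_prices_def by (simp only: sorted_list_of_set_range)
  then show ?thesis by (auto intro!: nth_equalityI simp: price_fun_def)
qed

lemma enc_list_map: "enc_list f (map g xs) = enc_list (\<lambda>x. f (g x)) xs"
  by (simp add: enc_list_def comp_def)

lemma enc_list_cong: "(\<And>x. x \<in> set xs \<Longrightarrow> f x = g x) \<Longrightarrow> enc_list f xs = enc_list g xs"
  by (simp add: enc_list_def cong: map_cong)

text \<open>Both encodings are built with \<open>enc_list\<close>, a bit encodes itself, and
  canonical lists are those produced by \<open>binary\<close>. So the words coincide, and the
  machine has nothing to translate.\<close>

lemma enc_inst:
  assumes "all_canonical x"
  shows "enc_instance (inst x) = encode x"
proof -
  obtain C V d B P where x: "x = (C, V, d, B, P)" by (cases x)
  have bit: "encode = (\<lambda>b :: bool. [b])" by (auto simp: encode_bool_def)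
  have nat: "enc_nat (bits_val p) = encode p" if "canonical p" for p
    using that by (simp add: enc_nat_def binary_bits_val encode_list_def bit)
  have nats: "enc_list (\<lambda>p. enc_nat (bits_val p)) ps = encode ps" if "list_all canonical ps" for ps
    using that by (auto simp: encode_list_def list_all_iff nat intro!: enc_list_cong)
  have "enc_list (enc_list enc_nat) (map (map bits_val) V) = encode V"
    unfolding enc_list_map encode_list_def[of V] using assms
    by (intro enc_list_cong) (simp add: x all_canonical_def list_all_iff[of _ V] nats)
  moreover have "enc_list (\<lambda>\<rho>. enc_list enc_nat (finite_prices \<rho>)) (map price_fun P) = encode P"
    unfolding enc_list_map encode_list_def[of P] using assms
    by (intro enc_list_cong) (simp add: x all_canonical_def list_all_iff[of _ P] nats finite_prices_price_fun enc_list_map)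
  ultimately show ?thesis using assms
    by (simp add: x enc_instance_def inst_def encode_prod_def nat nats all_canonical_def enc_list_map)
qed

lemma inst_surj:
  assumes v: "valid_instance I"
  shows "\<exists>x. all_canonical x \<and> inst x = I"
proof -
  let ?x = "(map binary (candidates I), map (map binary) (votes I), binary (despised I), binary (budget I),
     map (\<lambda>\<rho>. map binary (finite_prices \<rho>)) (prices I))"
  have "price_fun (map binary (finite_prices \<rho>)) = \<rho>" if "\<rho> \<in> set (prices I)" for \<rho>
  proof -
    obtain i where i: "i < length (prices I)" "\<rho> = prices I ! i" using \<open>\<rho> \<in> _\<close> by (auto simp: in_set_conv_nth)
    then have "is_price_function (length (candidates I)) (pos (votes I ! i) (despised I)) \<rho>"
      using v by (simp add: valid_instance_def)
    from finite_prices_nth[OF this] show ?thesis by (auto simp: price_fun_def fun_eq_iff)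
  qed
  then have "map price_fun (map (\<lambda>\<rho>. map binary (finite_prices \<rho>)) (prices I)) = prices I"
    by (simp add: map_idI)
  then have "inst ?x = I" by (simp add: inst_def comp_def)
  moreover have "all_canonical ?x" by (simp add: all_canonical_def list_all_iff canonical_binary)
  ultimately show ?thesis by blast
qed

lemma destructive_shift_bribery_bucklin: "destructive_shift_bribery bucklin = encode ` {x. good x}"
proof
  show "destructive_shift_bribery bucklin \<subseteq> encode ` {x. good x}"
  proof
    fix w assume "w \<in> destructive_shift_bribery bucklin"
    then obtain I where I: "w = enc_instance I" "valid_instance I" "yes_instance bucklin I"
      by (auto simp: destructive_shift_bribery_def)
    then obtain x where "all_canonical x" "inst x = I" using inst_surj by blast
    then show "w \<in> encode ` {x. good x}" using I enc_inst[of x] good_iff[of x] by (intro image_eqI[of _ _ x]) auto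
  qed
  show "encode ` {x. good x} \<subseteq> destructive_shift_bribery bucklin"
  proof
    fix w assume "w \<in> encode ` {x. good x}"
    then obtain x where x: "good x" "w = encode x" by blast
    then have "w = enc_instance (inst x)" "valid_instance (inst x)" "yes_instance bucklin (inst x)"
      using enc_inst[of x] good_iff[of x] by simp_all
    then show "w \<in> destructive_shift_bribery bucklin" unfolding destructive_shift_bribery_def by blast
  qed
qed

section \<open>Polynomial time of the decision procedure\<close>

lemma pt_tl [pt_intros]: "pt f \<Longrightarrow> pt (\<lambda>x. tl (f x))"
  unfolding tl_def by (intro pt_intros)

lemma pt_head_bit [pt_intros]: "pt f \<Longrightarrow> pt (\<lambda>x. head_bit (f x))"
  unfolding head_bit_def by (intro pt_intros)

lemma pt_sub_step: "pt (\<lambda>p. sub_step (fst (snd p)) (snd (snd p)))"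
  unfolding sub_step_def by (intro pt_intros)

lemma sz_tl: "sz (tl xs) \<le> sz xs"
  by (cases xs) auto

lemma pt_bits_sub [pt_intros]:
  assumes "pt f" "pt g"
  shows "pt (\<lambda>x. bits_sub (f x) (g x))"
proof -
  \<comment> \<open>The new digit costs two bits, list marker and digit; the subtrahend does not
    grow, and the borrow keeps its size.\<close>
  have "sz (sub_step s b) \<le> sz s + 2" for s b
    using sz_tl[of "fst (snd s)"] by (simp add: sub_step_def sz_prod encode_bool_def)
  then have "pt (\<lambda>x. foldl sub_step (False, g x, []) (f x))"
    by (intro pt_foldl_growth[where D = "\<lambda>_. 2"] pt_sub_step)
      (auto intro!: pt_intros poly_bd_intros assms)
  then show ?thesis unfolding bits_sub_def Let_def id_def by (intro pt_intros)
qed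

lemma pt_bits_le [pt_intros]: "pt f \<Longrightarrow> pt g \<Longrightarrow> pt (\<lambda>x. bits_le (f x) (g x))"
  unfolding bits_le_def by (intro pt_intros)

lemma pt_add_counts [pt_intros]: "pt f \<Longrightarrow> pt g \<Longrightarrow> pt (\<lambda>x. add_counts (f x) (g x))"
  unfolding add_counts_def by (intro pt_intros)

lemma pt_insert_best0: "pt (\<lambda>p. insert_best (fst p) (snd p))"
  unfolding insert_best_def by (intro pt_intros)

lemma sz_filter: "sz (filter Q xs) \<le> sz xs"
  by (induction xs) auto

text \<open>An insertion adds at most the inserted entry, whatever the table, so additive growth
  holds within the treatment of one voter.\<close>

lemma pt_extend0: "pt (\<lambda>p. extend (fst p) (snd p))"
proof -
  have growth: "sz (insert_best e T) \<le> sz T + (sz e + 1)" for e T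
    using sz_filter[of _ T] by (auto simp: insert_best_def sz_prod intro: trans_le_add1)
  have "pt (\<lambda>p :: table \<times> (counts \<times> bool list) list. foldr insert_best
     (concat (map (\<lambda>e. map (\<lambda>q. (add_counts (fst e) (fst q), bits_sub (snd e) (snd q))) (snd p)) (fst p))) [])"
  proof (rule pt_foldr_growth[where D = "\<lambda>p. sz (snd p) + 1"])
    show "sz (insert_best e T) \<le> sz T + (sz (snd (x, e)) + 1)"
      for x :: "table \<times> (counts \<times> bool list) list" and e T
      using growth by simp
  qed (intro pt_intros pt_binary[OF pt_insert_best0] poly_bd_intros poly_bd_sz_pt)+
  then show ?thesis unfolding extend_def .
qed

text \<open>Scanning from the right, every hit resets the result to 1, so the leftmost occurrence
  decides.\<close>

lemma pos_foldr: "pos r c = foldr (\<lambda>e n. if e = c then 1 else Suc n) r 1"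
  by (induction r) (auto simp: pos_Cons, simp add: pos_def)

lemma pt_pos0: "pt (\<lambda>p. pos (fst p) (snd p :: bool list))"
  unfolding pos_foldr
  by (rule pt_foldr_growth[where D = "\<lambda>_. 1"]) (auto intro!: pt_intros poly_bd_intros)

lemmas pt_pos [pt_intros] = pt_binary[OF pt_pos0]

lemmas pt_extend = pt_binary[OF pt_extend0]

lemma pt_option_counts0: "pt (\<lambda>p. option_counts (fst p :: bool list) (fst (snd p)) (fst (snd (snd p)))
    (fst (snd (snd (snd p)))) (snd (snd (snd (snd p)))))"
  unfolding option_counts_def by (intro pt_intros)

lemma pt_option_counts [pt_intros]:
  fixes d :: "'x::encodable \<Rightarrow> bool list"
  assumes "pt d" "pt c" "pt l" "pt r" "pt t"
  shows "pt (\<lambda>x. option_counts (d x) (c x) (l x) (r x) (t x))"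
  using pt_comp[OF pt_option_counts0, of "\<lambda>x. (d x, c x, l x, r x, t x)"] assms by (simp add: pt_intros)

lemma pt_options_of0: "pt (\<lambda>p. options_of (fst p :: bool list) (fst (snd p)) (fst (snd (snd p))) (snd (snd (snd p))))"
  unfolding options_of_def by (intro pt_intros)

lemma pt_options_of [pt_intros]:
  fixes d :: "'x::encodable \<Rightarrow> bool list"
  assumes "pt d" "pt c" "pt l" "pt v"
  shows "pt (\<lambda>x. options_of (d x) (c x) (l x) (v x))"
  using pt_comp[OF pt_options_of0, of "\<lambda>x. (d x, c x, l x, v x)"] assms by (simp add: pt_intros)

lemma table_bound_final_table: "table_bound (length vs) (length B) (final_table d c l vs B)"
proof (induction vs rule: rev_induct)
  case Nil
  then show ?case by (simp add: table_bound_def final_table_def)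
next
  case (snoc v vs)
  have "\<forall>q\<in>set (options_of d c l v). fst q \<in> {..1} \<times> {..1} \<times> {..1}"
    by (auto simp: set_options_of option_counts_def)
  from table_bound_extend[OF snoc.IH this] show ?case by (simp add: final_table_def)
qed

lemma table_bound_mono: "table_bound n m T \<Longrightarrow> n \<le> n' \<Longrightarrow> table_bound n' m T"
  by (fastforce simp: table_bound_def)

lemma sz_list_le: "(\<And>e. e \<in> set es \<Longrightarrow> sz e + 1 \<le> K) \<Longrightarrow> sz es \<le> length es * K + 1"
  by (induction es) fastforce+

lemma sz_table:
  assumes "table_bound n m T"
  shows "sz T \<le> (n + 1) * ((n + 1) * (n + 1)) * (3 * n + 2 * m + 5) + 1"
proof -
  have d: "distinct (map fst T)" and e: "\<And>e. e \<in> set T \<Longrightarrow> fst e \<in> {..n} \<times> {..n} \<times> {..n} \<and> length (snd e) = m"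
    using assms by (auto simp: table_bound_def)
  have "length T = card (set (map fst T))" using distinct_card[OF d] by simp
  also have "\<dots> \<le> card ({..n} \<times> {..n} \<times> {..n})" using e by (intro card_mono) auto
  finally have len: "length T \<le> (n + 1) * ((n + 1) * (n + 1))" by (simp add: card_cartesian_product)
  have bool: "sz (bs :: bool list) = 2 * length bs + 1" for bs
    by (induction bs) (simp_all add: encode_bool_def)
  \<comment> \<open>An entry consists of three unary counters of at most \<open>n + 1\<close> bits,
    a remainder of \<open>2 * m + 1\<close> bits and a list marker.\<close>
  have "sz T \<le> length T * (3 * n + 2 * m + 5) + 1"
  proof (rule sz_list_le)
    fix f assume "f \<in> set T"
    then show "sz f + 1 \<le> 3 * n + 2 * m + 5" using e[of f] by (auto simp: sz_prod bool)
  qed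
  also have "\<dots> \<le> (n + 1) * ((n + 1) * (n + 1)) * (3 * n + 2 * m + 5) + 1"
    using mult_le_mono1[OF len] by (rule add_right_mono)
  finally show ?thesis .
qed

text \<open>Since \<open>extend\<close> combines every entry with every option, its increment may
  depend on the size of the table. The intermediate tables are bounded through
  \<open>table_bound\<close> instead, applied to each prefix of the voters.\<close>

lemma pt_final_table0: "pt (\<lambda>p. final_table (fst p :: bool list) (fst (snd p)) (fst (snd (snd p)))
    (fst (snd (snd (snd p)))) (snd (snd (snd (snd p)))))"
  unfolding final_table_def
proof (rule pt_foldl[where S = "\<lambda>p. (sz (fst (snd (snd (snd p)))) + 1) * ((sz (fst (snd (snd (snd p)))) + 1) *
    (sz (fst (snd (snd (snd p)))) + 1)) * (3 * sz (fst (snd (snd (snd p)))) + 2 * sz (snd (snd (snd (snd p)))) + 5) + 1"])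
  fix p :: "bool list \<times> bool list \<times> nat \<times> (bool list list \<times> bool list list) list \<times> bool list" and i
  let ?d = "fst p" and ?c = "fst (snd p)" and ?l = "fst (snd (snd p))" and ?vs = "fst (snd (snd (snd p)))"
    and ?B = "snd (snd (snd (snd p)))"
  let ?T = "foldl (\<lambda>T v. extend T (options_of ?d ?c ?l v)) [((0, 0, 0), ?B)] (take i ?vs)"
  have "table_bound (length ?vs) (length ?B) ?T"
    using table_bound_mono[OF table_bound_final_table, of "take i ?vs" "length ?vs" ?B ?d ?c ?l]
    by (simp add: final_table_def)
  from sz_table[OF this] have "sz ?T \<le> (length ?vs + 1) * ((length ?vs + 1) * (length ?vs + 1)) *
      (3 * length ?vs + 2 * length ?B + 5) + 1" .
  also have "\<dots> \<le> (sz ?vs + 1) * ((sz ?vs + 1) * (sz ?vs + 1)) * (3 * sz ?vs + 2 * sz ?B + 5) + 1"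
    using length_le_sz[of ?vs] length_le_sz[of ?B] by (intro add_mono mult_le_mono) auto
  finally show "sz ?T \<le> (sz ?vs + 1) * ((sz ?vs + 1) * (sz ?vs + 1)) * (3 * sz ?vs + 2 * sz ?B + 5) + 1" .
qed (intro pt_intros pt_extend poly_bd_intros poly_bd_sz_pt)+

lemma pt_final_table [pt_intros]:
  fixes d :: "'x::encodable \<Rightarrow> bool list"
  assumes "pt d" "pt c" "pt l" "pt vs" "pt B"
  shows "pt (\<lambda>x. final_table (d x) (c x) (l x) (vs x) (B x))"
  using pt_comp[OF pt_final_table0, of "\<lambda>x. (d x, c x, l x, vs x, B x)"] assms by (simp add: pt_intros)

lemma pt_winning [pt_intros]: "pt f \<Longrightarrow> pt g \<Longrightarrow> pt (\<lambda>x. winning (f x) (g x))"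
  unfolding winning_def by (intro pt_intros)

lemma pt_canonical [pt_intros]: "pt f \<Longrightarrow> pt (\<lambda>x. canonical (f x))"
  unfolding canonical_def by (intro pt_intros)

lemma pt_all_canonical: "pt all_canonical"
  unfolding all_canonical_def by (intro pt_intros)

lemma pt_no_repetition0: "pt (\<lambda>xs :: bool list list. no_repetition xs)"
  unfolding no_repetition_def by (intro pt_intros)

lemmas pt_no_repetition [pt_intros] = pt_comp[OF pt_no_repetition0]

lemma pt_included0: "pt (\<lambda>p :: bool list list \<times> bool list list. included (fst p) (snd p))"
  unfolding included_def by (intro pt_intros)

lemmas pt_included [pt_intros] = pt_binary[OF pt_included0]

lemma pt_prices_ok0: "pt (\<lambda>p. prices_ok (fst p) (fst (snd p)) (snd (snd p)))"
  unfolding prices_ok_def by (intro pt_intros)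

lemmas pt_prices_ok [pt_intros] = pt_ternary[OF pt_prices_ok0]

lemma pt_good: "pt good"
  unfolding good_def well_formed_def bribable_def by (intro pt_intros pt_all_canonical)

theorem theorem4: "destructive_shift_bribery bucklin \<in> class_P"
  unfolding destructive_shift_bribery_bucklin by (rule class_P_pt[OF pt_good])

end
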